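(* Let $G$ be a finite group with $\mathrm{tp}(G) > (1/2)^8$. Then either $G$ is supersoluble, or $G$ has a section isomorphic to the alternating group $A_4$. Moreover, the bound $(1/2)^8$ is sharp: for no real number $c<(1/2)^8$ is it true that every finite group $G$ with $\mathrm{tp}(G)>c$ is supersoluble or has a section isomorphic to $A_4$.
   Context: For a subgroup $H$ of index $n$ in a finite group $G$, $P_G(H) := |\mathrm{DT}_G(H)|/|H|^n$, where $\mathrm{DT}_G(H)$ is the set of all subsets of $G$ that are simultaneously a left transversal (exactly one element of each left coset $gH$) and a right transversal (exactly one element of each right coset $Hg$) of $H$ in $G$. The common transversal probability of $G$ is $\mathrm{tp}(G) := \min_{H\leq G} P_G(H)$, the minimum over all subgroups $H$ of $G$. A section of $G$ is a quotient $U/N$ with $N\unlhd U\leq G$. A finite group is supersoluble if it has a normal series (all terms normal in the whole group) with cyclic factors. *)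

theory Defs
  imports Complex_Main "HOL-Algebra.Algebra" "HOL-Algebra.Left_Coset"
begin

definition left_transversal :: "('a, 'b) monoid_scheme \<Rightarrow> 'a set \<Rightarrow> 'a set \<Rightarrow> bool"
  where "left_transversal G H T \<longleftrightarrow>
    T \<subseteq> carrier G \<and> (\<forall>C \<in> lcosets\<^bsub>G\<^esub> H. \<exists>!t. t \<in> T \<and> t \<in> C)"

definition right_transversal :: "('a, 'b) monoid_scheme \<Rightarrow> 'a set \<Rightarrow> 'a set \<Rightarrow> bool"
  where "right_transversal G H T \<longleftrightarrow>
    T \<subseteq> carrier G \<and> (\<forall>C \<in> rcosets\<^bsub>G\<^esub> H. \<exists>!t. t \<in> T \<and> t \<in> C)"

definition DT :: "('a, 'b) monoid_scheme \<Rightarrow> 'a set \<Rightarrow> 'a set set"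
  where "DT G H = {T. left_transversal G H T \<and> right_transversal G H T}"

definition transversal_prob :: "('a, 'b) monoid_scheme \<Rightarrow> 'a set \<Rightarrow> real"
  where "transversal_prob G H = real (card (DT G H)) / real (card H) ^ card (rcosets\<^bsub>G\<^esub> H)"

text \<open>The minimum is meaningful for finite \<open>G\<close>, which then has finitely many subgroups.\<close>

definition tp :: "('a, 'b) monoid_scheme \<Rightarrow> real"
  where "tp G = Min (transversal_prob G ` {H. subgroup H G})"

definition has_section_iso ::
    "('a, 'b) monoid_scheme \<Rightarrow> ('c, 'd) monoid_scheme \<Rightarrow> bool"
  where "has_section_iso G K \<longleftrightarrow>
    (\<exists>U N. subgroup U G \<and> N \<lhd> G\<lparr>carrier := U\<rparr> \<and> (G\<lparr>carrier := U\<rparr> Mod N) \<cong> K)"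

definition supersoluble :: "('a, 'b) monoid_scheme \<Rightarrow> bool"
  where "supersoluble G \<longleftrightarrow>
    (\<exists>(k::nat) N. N 0 = {\<one>\<^bsub>G\<^esub>} \<and> N k = carrier G \<and> (\<forall>i\<le>k. N i \<lhd> G) \<and>
      (\<forall>i<k. N i \<subseteq> N (Suc i) \<and> cyclic_group (G\<lparr>carrier := N (Suc i)\<rparr> Mod N i)))"

end

theory Submission
  imports Defs "HOL-Library.Numeral_Type"
begin

text \<open>
  In a double coset of \<open>H\<close> consisting of \<open>m\<close> left cosets, the left and right cosets form an
  \<open>m \<times> m\<close> grid with cells of equal size, so \<open>P\<^sub>G(H)\<close> is the product of \<open>m! / m\<^sup>m\<close> over the
  double cosets. In particular \<open>P\<^sub>G(H)\<close> does not change when a normal subgroup contained in \<open>H\<close>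
  is factored out, so \<open>tp\<close> does not decrease in quotients.

  If \<open>H\<close> has prime order \<open>p\<close>, then \<open>|G| = |N(H)| + p\<^sup>2 k\<close> and \<open>P\<^sub>G(H) = (p! / p\<^sup>p)\<^sup>k\<close>. When \<open>tp G\<close>
  exceeds \<open>1/256\<close> and no subgroup of prime order is normal, this leaves finitely many orders
  divisible by an odd prime, since \<open>|N(H)|\<close> divides \<open>p\<^sup>2 k\<close>. All of them are excluded except 12 and
  24, where the action on the four subgroups of order 3 yields \<open>A\<^sub>4\<close>. Factoring out normal subgroups
  of prime order proves the first claim.

  For sharpness, every group of order 36 has \<open>tp \<ge> 1/256\<close>, and the group of maps \<open>z \<mapsto> u z + v\<close>
  with \<open>u\<^sup>4 = 1\<close> on the field with nine elements is neither supersoluble nor has a section \<open>A\<^sub>4\<close>.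
\<close>

text \<open>The constant 1/256 comes from an involution. A subgroup of order 2 has probability
  (1/2)^k with |G| = |N(H)| + 4k, and in the affine group of order 36 the map sending z to -z has a
  centralizer of order 4, so k = 8. The strict hypothesis gives k \<le> 7, which excludes that case.
  For odd primes the range is short because m!/m^m decreases and drops below 1/256 at m = 8. The
  candidate orders are eliminated by counting, without any classification: a subgroup of odd prime
  order inside the centralizer of an involution has a normalizer of even order, so the constraints
  for 2 and for the odd prime can be played against each other. A section is carried along as a
  homomorphism from a subgroup onto A4, a form that pulls back along a quotient map by mere
  composition. Sharpness needs one group only, since it refutes every c < 1/256 at once; as the
  claim ranges over groups on \<open>nat\<close>, the affine group is transported there.\<close>

no_notation (ASCII) subset_mset  (infix \<open><#\<close> 50)

section \<open>Common transversals and double cosets\<close>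

text \<open>Rows and columns are named by arbitrary maps \<open>l\<close> and \<open>r\<close>, and
  the label sets are kept apart from \<open>Z\<close>, so that a recursion can delete one row and
  one column. On a double coset, \<open>l\<close> and \<open>r\<close> will send an element to its
  left and its right coset.\<close>

definition grid_transversals :: "('x \<Rightarrow> 'l) \<Rightarrow> ('x \<Rightarrow> 'r) \<Rightarrow> 'x set \<Rightarrow> 'l set \<Rightarrow> 'r set \<Rightarrow> 'x set set"
  where "grid_transversals l r Z A B =
    {T. T \<subseteq> Z \<and> inj_on l T \<and> l ` T = A \<and> inj_on r T \<and> r ` T = B}"

text \<open>A transversal meets row \<open>a\<close> in exactly one point \<open>t\<close>. Removing
  \<open>t\<close> leaves a transversal of the grid without the row and the column of
  \<open>t\<close>, and inserting \<open>t\<close> reverses this.\<close>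

lemma grid_transversals_step:
  assumes "a \<in> A" and r: "r ` Z \<subseteq> B"
  shows "grid_transversals l r Z A B =
    (\<Union>t\<in>{x \<in> Z. l x = a}. insert t `
        grid_transversals l r {x \<in> Z. l x \<noteq> a \<and> r x \<noteq> r t} (A - {a}) (B - {r t}))"
    (is "_ = ?R")
proof (intro equalityI subsetI)
  fix T assume T: "T \<in> grid_transversals l r Z A B"
  then have T': "T \<subseteq> Z" "inj_on l T" "l ` T = A" "inj_on r T" "r ` T = B"
    by (auto simp: grid_transversals_def)
  obtain t where t: "t \<in> T" "l t = a" using T' assms(1) by auto
  let ?Z = "{x \<in> Z. l x \<noteq> a \<and> r x \<noteq> r t}"
  have ne: "l x \<noteq> a" "r x \<noteq> r t" if "x \<in> T - {t}" for x
    using that t T'(2,4) by (auto dest: inj_onD)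
  have "T - {t} \<subseteq> ?Z" using T' ne by auto
  moreover have "inj_on l (T - {t})" "inj_on r (T - {t})"
    using T' by (auto intro: inj_on_subset)
  moreover have "l ` (T - {t}) = A - {a}" using T'(2,3) t
    by (auto simp: inj_on_image_set_diff[of l T T "{t}"])
  moreover have "r ` (T - {t}) = B - {r t}" using T'(4,5) t
    by (auto simp: inj_on_image_set_diff[of r T T "{t}"])
  ultimately have "T - {t} \<in> grid_transversals l r ?Z (A - {a}) (B - {r t})"
    by (simp add: grid_transversals_def)
  moreover have "T = insert t (T - {t})" using t by auto
  ultimately show "T \<in> ?R" using t T'(1) by blast
next
  fix T assume "T \<in> ?R"
  then obtain t S where t: "t \<in> Z" "l t = a" and T: "T = insert t S"
    and S: "S \<subseteq> {x \<in> Z. l x \<noteq> a \<and> r x \<noteq> r t}" "inj_on l S" "l ` S = A - {a}"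
       "inj_on r S" "r ` S = B - {r t}"
    by (auto simp: grid_transversals_def)
  have "r t \<in> B" using t r by auto
  then show "T \<in> grid_transversals l r Z A B"
    using S t T assms(1) unfolding grid_transversals_def by (auto simp: insert_absorb)
qed

text \<open>A fixed row offers \<open>m * c\<close> points, and each choice leaves a grid with one
  row and one column fewer and the same cell size. The product of m c, (m-1) c, ..., c is the
  count.\<close>

lemma card_grid_transversals:
  assumes "finite Z" "l ` Z \<subseteq> A" "r ` Z \<subseteq> B" "finite A" "finite B" "card A = m" "card B = m"
    and "\<And>a b. a \<in> A \<Longrightarrow> b \<in> B \<Longrightarrow> card {x \<in> Z. l x = a \<and> r x = b} = c"
  shows "card (grid_transversals l r Z A B) = fact m * c ^ m"
  using assms
proof (induction m arbitrary: Z A B)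
  case 0
  then have "A = {}" "B = {}" "Z = {}" by auto
  then have "grid_transversals l r Z A B = {{}}"
    by (auto simp: grid_transversals_def)
  then show ?case by simp
next
  case (Suc m)
  then obtain a where a: "a \<in> A" by fastforce
  let ?Za = "{x \<in> Z. l x = a}"
  let ?G = "\<lambda>t. grid_transversals l r {x \<in> Z. l x \<noteq> a \<and> r x \<noteq> r t} (A - {a}) (B - {r t})"
  have "?Za = (\<Union>b\<in>B. {x \<in> Z. l x = a \<and> r x = b})" using Suc.prems by auto
  then have "card ?Za = (\<Sum>b\<in>B. card {x \<in> Z. l x = a \<and> r x = b})"
    by (simp only:) (rule card_UN_disjoint; use Suc.prems in auto)
  then have cZa: "card ?Za = Suc m * c" using Suc.prems a by simp
  have IH: "card (?G t) = fact m * c ^ m" if t: "t \<in> ?Za" for t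
  proof (rule Suc.IH)
    have rt: "r t \<in> B" using t Suc.prems by auto
    show "card (A - {a}) = m" "card (B - {r t}) = m" using Suc.prems a rt by auto
    fix a' b' assume ab: "a' \<in> A - {a}" "b' \<in> B - {r t}"
    then have "{x \<in> {x \<in> Z. l x \<noteq> a \<and> r x \<noteq> r t}. l x = a' \<and> r x = b'} =
       {x \<in> Z. l x = a' \<and> r x = b'}" by auto
    then show "card {x \<in> {x \<in> Z. l x \<noteq> a \<and> r x \<noteq> r t}. l x = a' \<and> r x = b'} = c"
      using Suc.prems(8) ab by auto
  qed (use Suc.prems in auto)
  \<comment> \<open>The rest of a transversal avoids row \<open>a\<close>, hence all of
    \<open>?Za\<close>. So the chosen point can be recovered, which gives both the injectivity of
    \<open>insert t\<close> and the disjointness of the union.\<close>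
  have notin: "t \<notin> S" if "S \<in> ?G u" "t \<in> ?Za" for t u S
    using that by (auto simp: grid_transversals_def)
  have card1: "card (insert t ` ?G t) = fact m * c ^ m" if t: "t \<in> ?Za" for t
  proof -
    have "inj_on (insert t) (?G t)"
    proof (rule inj_onI)
      fix S S' assume S: "S \<in> ?G t" "S' \<in> ?G t" and eq: "insert t S = insert t S'"
      show "S = S'" using eq insert_ident[OF notin[OF S(1) t] notin[OF S(2) t]] by simp
    qed
    then show ?thesis using IH[OF t] by (simp add: card_image)
  qed
  have fin: "finite (?G t)" for t
    by (rule finite_subset[of _ "Pow Z"]) (use Suc.prems in \<open>auto simp: grid_transversals_def\<close>)
  have "card (grid_transversals l r Z A B) = card (\<Union>t\<in>?Za. insert t ` ?G t)"
    using grid_transversals_step[OF a Suc.prems(3)] by simp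
  also have "\<dots> = (\<Sum>t\<in>?Za. card (insert t ` ?G t))"
  proof (rule card_UN_disjoint)
    show "\<forall>i\<in>?Za. \<forall>j\<in>?Za. i \<noteq> j \<longrightarrow> insert i ` ?G i \<inter> insert j ` ?G j = {}"
      using notin by blast
  qed (use Suc.prems fin in auto)
  also have "\<dots> = (Suc m * c) * (fact m * c ^ m)" using card1 cZa by simp
  finally show ?case by (simp add: algebra_simps)
qed

definition double_coset :: "('a, 'b) monoid_scheme \<Rightarrow> 'a set \<Rightarrow> 'a \<Rightarrow> 'a set"
  where "double_coset G H x = {h \<otimes>\<^bsub>G\<^esub> x \<otimes>\<^bsub>G\<^esub> k | h k. h \<in> H \<and> k \<in> H}"

definition double_cosets :: "('a, 'b) monoid_scheme \<Rightarrow> 'a set \<Rightarrow> 'a set set"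
  where "double_cosets G H = double_coset G H ` carrier G"

locale finite_group_subgroup = group G + subgroup H G for G (structure) and H +
  assumes finG: "finite (carrier G)"
begin

lemma subgroupH: "subgroup H G" by (rule subgroup_axioms)

lemma finH: "finite H" using finG subset finite_subset by blast

lemma one_in_H: "\<one> \<in> H" by (rule subgroup.one_closed[OF subgroup_axioms])

lemma cardH_pos: "card H > 0" using finH one_in_H card_gt_0_iff by blast

lemma inv_mult_cancel [simp]:
  "\<lbrakk>x \<in> carrier G; y \<in> carrier G\<rbrakk> \<Longrightarrow> inv x \<otimes> (x \<otimes> y) = y"
  "\<lbrakk>x \<in> carrier G; y \<in> carrier G\<rbrakk> \<Longrightarrow> x \<otimes> (inv x \<otimes> y) = y"
  by (simp_all add: m_assoc[symmetric])

lemma in_l_coset: "x \<in> carrier G \<Longrightarrow> y \<in> x <# H \<longleftrightarrow> (\<exists>h\<in>H. y = x \<otimes> h)"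
  by (auto simp: l_coset_def)

lemma in_r_coset: "x \<in> carrier G \<Longrightarrow> y \<in> H #> x \<longleftrightarrow> (\<exists>h\<in>H. y = h \<otimes> x)"
  by (auto simp: r_coset_def)

lemma l_coset_eq_iff: "x \<in> carrier G \<Longrightarrow> y \<in> carrier G \<Longrightarrow> y <# H = x <# H \<longleftrightarrow> y \<in> x <# H"
  by (metis l_repr_independence lcos_self subgroupH)

lemma r_coset_eq_iff: "x \<in> carrier G \<Longrightarrow> y \<in> carrier G \<Longrightarrow> H #> y = H #> x \<longleftrightarrow> y \<in> H #> x"
  by (metis repr_independence rcos_self subgroupH)

lemma card_l_coset: "x \<in> carrier G \<Longrightarrow> card (x <# H) = card H"
  using l_card_cosets_equal[of "x <# H" H] finG subset unfolding LCOSETS_def by fastforce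

lemma card_r_coset: "x \<in> carrier G \<Longrightarrow> card (H #> x) = card H"
  using card_cosets_equal[of "H #> x" H] subset unfolding RCOSETS_def
  by (fastforce dest: bij_betw_same_card)

lemma double_coset_subset: "x \<in> carrier G \<Longrightarrow> double_coset G H x \<subseteq> carrier G"
  by (auto simp: double_coset_def)

lemma double_coset_self: "x \<in> carrier G \<Longrightarrow> x \<in> double_coset G H x"
  unfolding double_coset_def using one_in_H by (force intro: exI[of _ \<one>])

lemma double_coset_eq:
  assumes "x \<in> carrier G" "y \<in> double_coset G H x"
  shows "double_coset G H y = double_coset G H x"
proof -
  obtain h k where hk: "h \<in> H" "k \<in> H" "y = h \<otimes> x \<otimes> k"
    using assms by (auto simp: double_coset_def)
  have y: "y \<in> carrier G" using assms double_coset_subset by auto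
  have x: "x = inv h \<otimes> y \<otimes> inv k" using hk assms(1) by (simp add: m_assoc)
  have 1: "double_coset G H (a \<otimes> z \<otimes> b) \<subseteq> double_coset G H z"
    if "z \<in> carrier G" "a \<in> H" "b \<in> H" for z a b
    unfolding double_coset_def
  proof (safe)
    fix u v assume "u \<in> H" "v \<in> H"
    then show "\<exists>h k. u \<otimes> (a \<otimes> z \<otimes> b) \<otimes> v = h \<otimes> z \<otimes> k \<and> h \<in> H \<and> k \<in> H"
      using that by (intro exI[of _ "u \<otimes> a"] exI[of _ "b \<otimes> v"]) (simp add: m_assoc)
  qed
  have "double_coset G H y \<subseteq> double_coset G H x" using 1[OF assms(1) hk(1,2)] hk(3) by simp
  moreover have "double_coset G H x \<subseteq> double_coset G H y"
    using 1[OF y, of "inv h" "inv k"] hk(1,2) x[symmetric] by simp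
  ultimately show ?thesis by (rule equalityI)
qed

lemma double_cosets_disjoint:
  "D \<in> double_cosets G H \<Longrightarrow> E \<in> double_cosets G H \<Longrightarrow> x \<in> D \<Longrightarrow> x \<in> E \<Longrightarrow> D = E"
  unfolding double_cosets_def using double_coset_eq by blast

lemma Union_double_cosets: "\<Union> (double_cosets G H) = carrier G"
  unfolding double_cosets_def using double_coset_self double_coset_subset by blast

lemma finite_double_cosets: "finite (double_cosets G H)"
  by (simp add: double_cosets_def finG)

lemma finite_double_coset: "D \<in> double_cosets G H \<Longrightarrow> finite D"
  using Union_double_cosets finG by (metis Union_upper finite_subset)

lemma l_coset_subset_double_coset:
  assumes "x \<in> carrier G" "y \<in> double_coset G H x" shows "y <# H \<subseteq> double_coset G H x"
proof
  fix z assume "z \<in> y <# H"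
  moreover have y: "y \<in> carrier G" using assms double_coset_subset by blast
  ultimately obtain h where h: "h \<in> H" "z = y \<otimes> h" by (auto simp: l_coset_def)
  then have "z = \<one> \<otimes> y \<otimes> h" using y by simp
  then have "z \<in> double_coset G H y"
    unfolding double_coset_def using one_in_H h by blast
  then show "z \<in> double_coset G H x" using double_coset_eq assms by blast
qed

lemma r_coset_subset_double_coset:
  assumes "x \<in> carrier G" "y \<in> double_coset G H x" shows "H #> y \<subseteq> double_coset G H x"
proof
  fix z assume "z \<in> H #> y"
  moreover have y: "y \<in> carrier G" using assms double_coset_subset by blast
  ultimately obtain h where h: "h \<in> H" "z = h \<otimes> y" by (auto simp: r_coset_def)
  then have "z = h \<otimes> y \<otimes> \<one>" using y by simp
  then have "z \<in> double_coset G H y"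
    unfolding double_coset_def using one_in_H h by blast
  then show "z \<in> double_coset G H x" using double_coset_eq assms by blast
qed

text \<open>The map sending u to h u k is a bijection between the two intersections, because h x a k
  = (h x k)(k^-1 a k) and h b x k = (h b h^-1)(h x k).\<close>

lemma card_l_inter_r_translate:
  assumes x: "x \<in> carrier G" and hk: "h \<in> H" "k \<in> H"
  shows "card (((h \<otimes> x \<otimes> k) <# H) \<inter> (H #> (h \<otimes> x \<otimes> k))) = card ((x <# H) \<inter> (H #> x))"
proof -
  let ?f = "\<lambda>u. h \<otimes> u \<otimes> k"
  have sub: "(x <# H) \<inter> (H #> x) \<subseteq> carrier G" using x by (auto simp: l_coset_def)
  have "inj_on ?f (carrier G)" using hk by (auto intro!: inj_onI)
  then have inj: "inj_on ?f ((x <# H) \<inter> (H #> x))" using sub inj_on_subset by blast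
  have "?f ` ((x <# H) \<inter> (H #> x)) = ((?f x) <# H) \<inter> (H #> (?f x))"
  proof (intro equalityI subsetI)
    fix z assume "z \<in> ?f ` ((x <# H) \<inter> (H #> x))"
    then obtain u where "z = ?f u" "u \<in> x <# H" "u \<in> H #> x" by blast
    then obtain a b where u: "z = ?f u" "a \<in> H" "u = x \<otimes> a" "b \<in> H" "u = b \<otimes> x"
      unfolding in_l_coset[OF x] in_r_coset[OF x] by blast
    have "z = ?f x \<otimes> (inv k \<otimes> a \<otimes> k)" using u(1,2,3) hk x by (simp add: m_assoc)
    moreover have "z = (h \<otimes> b \<otimes> inv h) \<otimes> ?f x" using u(1,4,5) hk x by (simp add: m_assoc)
    moreover have "inv k \<otimes> a \<otimes> k \<in> H" "h \<otimes> b \<otimes> inv h \<in> H" using u hk by auto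
    ultimately show "z \<in> ((?f x) <# H) \<inter> (H #> (?f x))"
      using x hk unfolding l_coset_def r_coset_def by blast
  next
    fix z assume "z \<in> ((?f x) <# H) \<inter> (H #> (?f x))"
    then obtain a b where ab: "a \<in> H" "z = ?f x \<otimes> a" "b \<in> H" "z = b \<otimes> ?f x"
      using x hk by (auto simp: in_l_coset in_r_coset)
    have zc: "z \<in> carrier G" using ab x hk by auto
    have "inv h \<otimes> z \<otimes> inv k = x \<otimes> (k \<otimes> a \<otimes> inv k)" using ab(1,2) hk x by (simp add: m_assoc)
    moreover have "inv h \<otimes> z \<otimes> inv k = (inv h \<otimes> b \<otimes> h) \<otimes> x" using ab(3,4) hk x by (simp add: m_assoc)
    moreover have "k \<otimes> a \<otimes> inv k \<in> H" "inv h \<otimes> b \<otimes> h \<in> H" using ab hk by auto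
    ultimately have "inv h \<otimes> z \<otimes> inv k \<in> (x <# H) \<inter> (H #> x)"
      unfolding l_coset_def r_coset_def by blast
    moreover have "z = ?f (inv h \<otimes> z \<otimes> inv k)" using zc hk by (simp add: m_assoc)
    ultimately show "z \<in> ?f ` ((x <# H) \<inter> (H #> x))" by blast
  qed
  then show ?thesis using card_image[OF inj] by simp
qed

text \<open>For y = h x k and z = h' x k' the element h x k' lies in both y H and H z. It represents
  both cosets, which reduces an arbitrary cell to the previous lemma.\<close>

lemma card_l_inter_r:
  assumes x: "x \<in> carrier G" and y: "y \<in> double_coset G H x" and z: "z \<in> double_coset G H x"
  shows "card ((y <# H) \<inter> (H #> z)) = card ((x <# H) \<inter> (H #> x))"
proof -
  obtain h k where hk: "h \<in> H" "k \<in> H" "y = h \<otimes> x \<otimes> k" using y by (auto simp: double_coset_def)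
  obtain h' k' where hk': "h' \<in> H" "k' \<in> H" "z = h' \<otimes> x \<otimes> k'" using z by (auto simp: double_coset_def)
  let ?w = "h \<otimes> x \<otimes> k'"
  have c: "y \<in> carrier G" "z \<in> carrier G" "?w \<in> carrier G" using hk hk' x by auto
  have "?w = y \<otimes> (inv k \<otimes> k')" using hk hk' x by (simp add: m_assoc)
  then have "?w \<in> y <# H" using hk hk' by (auto simp: l_coset_def)
  moreover have "?w = (h \<otimes> inv h') \<otimes> z" using hk hk' x by (simp add: m_assoc)
  then have "?w \<in> H #> z" using hk hk' by (auto simp: r_coset_def)
  ultimately have "y <# H = ?w <# H" "H #> z = H #> ?w"
    using l_coset_eq_iff[of y ?w] r_coset_eq_iff[of z ?w] c by simp_all
  then show ?thesis using card_l_inter_r_translate[OF x hk(1) hk'(2)] by simp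
qed

text \<open>All cells have the same size \<open>c\<close>. Cutting one left coset along the right
  cosets, and one right coset along the left cosets, expresses \<open>card H\<close> as
  \<open>c\<close> times the number of columns and as \<open>c\<close> times the number of rows, so
  the grid is square.\<close>

lemma double_coset_grid:
  assumes D: "D \<in> double_cosets G H"
  obtains m c where "m \<ge> 1" "m * c = card H" "card D = m * card H"
    "card ((\<lambda>x. x <# H) ` D) = m" "card ((\<lambda>x. H #> x) ` D) = m"
    "\<And>a b. a \<in> (\<lambda>x. x <# H) ` D \<Longrightarrow> b \<in> (\<lambda>x. H #> x) ` D \<Longrightarrow>
        card {x \<in> D. x <# H = a \<and> H #> x = b} = c"
    "\<And>x. x \<in> D \<Longrightarrow> c = card ((x <# H) \<inter> (H #> x))"
proof -
  obtain x0 where x0: "x0 \<in> carrier G" "D = double_coset G H x0"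
    using D by (auto simp: double_cosets_def)
  let ?l = "\<lambda>x. x <# H" and ?r = "\<lambda>x. H #> x"
  define c where "c = card ((x0 <# H) \<inter> (H #> x0))"
  have Dc: "D \<subseteq> carrier G" using x0 double_coset_subset by auto
  have x0D: "x0 \<in> D" using x0 double_coset_self by auto
  have finD: "finite D" using finite_double_coset D .
  have cc: "card ((y <# H) \<inter> (H #> z)) = c" if "y \<in> D" "z \<in> D" for y z
    using card_l_inter_r that x0 by (auto simp: c_def)
  have lD: "{x \<in> D. x <# H = y <# H} = y <# H" if "y \<in> D" for y
    using l_coset_subset_double_coset[OF x0(1)] x0 that Dc l_coset_eq_iff by blast
  have rD: "{x \<in> D. H #> x = H #> y} = H #> y" if "y \<in> D" for y
    using r_coset_subset_double_coset[OF x0(1)] x0 that Dc r_coset_eq_iff by blast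
  have cell: "card {x \<in> D. x <# H = a \<and> H #> x = b} = c" if ab: "a \<in> ?l ` D" "b \<in> ?r ` D" for a b
  proof -
    obtain y z where yz: "y \<in> D" "z \<in> D" "a = y <# H" "b = H #> z" using ab by auto
    have "{x \<in> D. x <# H = a \<and> H #> x = b} = {x \<in> D. x <# H = a} \<inter> {x \<in> D. H #> x = b}" by auto
    also have "\<dots> = (y <# H) \<inter> (H #> z)" using lD rD yz by simp
    finally show ?thesis using cc yz by simp
  qed
  have "{x \<in> D. x <# H = x0 <# H} = (\<Union>b\<in>?r ` D. {x \<in> D. x <# H = x0 <# H \<and> H #> x = b})" by auto
  then have "card {x \<in> D. x <# H = x0 <# H} = (\<Sum>b\<in>?r ` D. card {x \<in> D. x <# H = x0 <# H \<and> H #> x = b})"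
    by (simp only:) (rule card_UN_disjoint; use finD in auto)
  then have r1: "card H = card (?r ` D) * c" using cell x0D lD card_l_coset x0 by simp
  have "{x \<in> D. H #> x = H #> x0} = (\<Union>a\<in>?l ` D. {x \<in> D. x <# H = a \<and> H #> x = H #> x0})" by auto
  then have "card {x \<in> D. H #> x = H #> x0} = (\<Sum>a\<in>?l ` D. card {x \<in> D. x <# H = a \<and> H #> x = H #> x0})"
    by (simp only:) (rule card_UN_disjoint; use finD in auto)
  then have l1: "card H = card (?l ` D) * c" using cell x0D rD card_r_coset x0 by simp
  have "D = (\<Union>a\<in>?l ` D. {x \<in> D. x <# H = a})" by auto
  then have "card D = card (\<Union>a\<in>?l ` D. {x \<in> D. x <# H = a})" by simp
  also have "\<dots> = (\<Sum>a\<in>?l ` D. card {x \<in> D. x <# H = a})"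
    by (rule card_UN_disjoint; use finD in auto)
  also have "\<dots> = (\<Sum>a\<in>?l ` D. card H)"
    by (rule sum.cong) (use lD Dc card_l_coset in auto)
  finally have cD: "card D = card (?l ` D) * card H" by simp
  have "c \<noteq> 0" using r1 cardH_pos by auto
  then have eq: "card (?l ` D) = card (?r ` D)" using r1 l1 by simp
  have "card (?l ` D) \<ge> 1" using x0D finD by (metis One_nat_def Suc_leI card_gt_0_iff empty_iff finite_imageI image_is_empty)
  moreover have "card (?r ` D) = card (?l ` D)" using eq by simp
  ultimately show ?thesis using that[OF _ l1[symmetric] cD refl _ cell] cc[symmetric] by blast
qed

text \<open>Cosets are replaced by fibres of the two coset maps, the form in which
  \<open>grid_transversals\<close> is stated.\<close>

lemma DT_eq:
  "DT G H = {T. T \<subseteq> carrier G \<and> (\<forall>x\<in>carrier G. \<exists>!t. t \<in> T \<and> t <# H = x <# H)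
     \<and> (\<forall>x\<in>carrier G. \<exists>!t. t \<in> T \<and> H #> t = H #> x)}"
proof -
  have "(\<exists>!t. t \<in> T \<and> t <# H = x <# H) \<longleftrightarrow> (\<exists>!t. t \<in> T \<and> t \<in> x <# H)"
    "(\<exists>!t. t \<in> T \<and> H #> t = H #> x) \<longleftrightarrow> (\<exists>!t. t \<in> T \<and> t \<in> H #> x)"
    if "T \<subseteq> carrier G" "x \<in> carrier G" for x T
  proof -
    have "t \<in> T \<and> t <# H = x <# H \<longleftrightarrow> t \<in> T \<and> t \<in> x <# H"
      "t \<in> T \<and> H #> t = H #> x \<longleftrightarrow> t \<in> T \<and> t \<in> H #> x" for t
      using that l_coset_eq_iff[of x t] r_coset_eq_iff[of x t] by blast+
    then show "(\<exists>!t. t \<in> T \<and> t <# H = x <# H) \<longleftrightarrow> (\<exists>!t. t \<in> T \<and> t \<in> x <# H)"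
      "(\<exists>!t. t \<in> T \<and> H #> t = H #> x) \<longleftrightarrow> (\<exists>!t. t \<in> T \<and> t \<in> H #> x)"
      by simp_all
  qed
  then have "left_transversal G H T \<and> right_transversal G H T \<longleftrightarrow>
      T \<subseteq> carrier G \<and> (\<forall>x\<in>carrier G. \<exists>!t. t \<in> T \<and> t <# H = x <# H)
     \<and> (\<forall>x\<in>carrier G. \<exists>!t. t \<in> T \<and> H #> t = H #> x)" for T
    unfolding left_transversal_def right_transversal_def LCOSETS_def RCOSETS_def
    by (cases "T \<subseteq> carrier G") auto
  then show ?thesis unfolding DT_def by simp
qed

text \<open>Every left or right coset lies inside one double coset, so the conditions on
  \<open>T\<close> split into independent conditions on the pieces \<open>T \<inter> D\<close>. The
  families are extensional outside \<open>double_cosets G H\<close>, which makes the union a genuine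
  inverse.\<close>

lemma DT_bij:
  "bij_betw (\<lambda>T. \<lambda>D\<in>double_cosets G H. T \<inter> D) (DT G H)
     (\<Pi>\<^sub>E D\<in>double_cosets G H.
        grid_transversals (\<lambda>x. x <# H) (\<lambda>x. H #> x) D ((\<lambda>x. x <# H) ` D) ((\<lambda>x. H #> x) ` D))"
    (is "bij_betw ?f _ (PiE ?DD ?J)")
proof (rule bij_betw_byWitness[where f' = "\<lambda>F. \<Union>D\<in>?DD. F D"])
  have U: "\<Union> ?DD = carrier G" by (rule Union_double_cosets)
  show "\<forall>T\<in>DT G H. (\<Union>D\<in>?DD. ?f T D) = T" using U by (auto simp: DT_eq)
  have F: "(\<Union>E\<in>?DD. F E) \<inter> D = F D" if "F \<in> PiE ?DD ?J" "D \<in> ?DD" for F D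
  proof -
    have sub: "F E \<subseteq> E" if "E \<in> ?DD" for E
      using \<open>F \<in> PiE ?DD ?J\<close> that by (auto simp: PiE_def Pi_def grid_transversals_def)
    show ?thesis
    proof (intro equalityI subsetI)
      fix x assume "x \<in> (\<Union>E\<in>?DD. F E) \<inter> D"
      then obtain E where E: "E \<in> ?DD" "x \<in> F E" "x \<in> D" by auto
      have "E = D" using double_cosets_disjoint[OF E(1) that(2), of x] E(2,3) sub[OF E(1)] by auto
      then show "x \<in> F D" using E by simp
    next
      fix x assume "x \<in> F D" then show "x \<in> (\<Union>E\<in>?DD. F E) \<inter> D" using sub that(2) by auto
    qed
  qed
  show "\<forall>F\<in>PiE ?DD ?J. ?f (\<Union>D\<in>?DD. F D) = F"
  proof
    fix F assume Fi: "F \<in> PiE ?DD ?J"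
    show "?f (\<Union>D\<in>?DD. F D) = F"
    proof (rule ext)
      fix D show "?f (\<Union>D\<in>?DD. F D) D = F D"
        using F[OF Fi, of D] PiE_arb[OF Fi, of D] unfolding restrict_def by presburger
    qed
  qed
  have lD: "t \<in> D" if asm: "D \<in> ?DD" "x \<in> D" "t \<in> carrier G" "t <# H = x <# H" for D x t
  proof -
    obtain y where y: "y \<in> carrier G" "D = double_coset G H y"
      using asm(1) unfolding double_cosets_def by blast
    have "x <# H \<subseteq> D" using l_coset_subset_double_coset[OF y(1), of x] y(2) asm(2) by simp
    then show ?thesis using lcos_self[OF asm(3) subgroupH] asm(4) by blast
  qed
  have rD: "t \<in> D" if asm: "D \<in> ?DD" "x \<in> D" "t \<in> carrier G" "H #> t = H #> x" for D x t
  proof -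
    obtain y where y: "y \<in> carrier G" "D = double_coset G H y"
      using asm(1) unfolding double_cosets_def by blast
    have "H #> x \<subseteq> D" using r_coset_subset_double_coset[OF y(1), of x] y(2) asm(2) by simp
    then show ?thesis using rcos_self[OF asm(3) subgroupH] asm(4) by blast
  qed
  show "?f ` DT G H \<subseteq> PiE ?DD ?J"
  proof (rule image_subsetI)
    fix T assume T: "T \<in> DT G H"
    show "?f T \<in> PiE ?DD ?J"
    proof (rule PiE_I)
      fix D assume D: "D \<in> ?DD"
      have Dc: "D \<subseteq> carrier G" using D U by auto
      have Tc: "T \<subseteq> carrier G" and Tl: "\<And>x. x \<in> carrier G \<Longrightarrow> \<exists>!t. t \<in> T \<and> t <# H = x <# H"
        and Tr: "\<And>x. x \<in> carrier G \<Longrightarrow> \<exists>!t. t \<in> T \<and> H #> t = H #> x"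
        using T by (auto simp: DT_eq)
      have "inj_on (\<lambda>x. x <# H) (T \<inter> D)"
        by (rule inj_onI) (use Tl Tc in blast)
      moreover have "inj_on (\<lambda>x. H #> x) (T \<inter> D)"
        by (rule inj_onI) (use Tr Tc in blast)
      moreover have "(\<lambda>x. x <# H) ` D \<subseteq> (\<lambda>x. x <# H) ` (T \<inter> D)"
      proof
        fix a assume "a \<in> (\<lambda>x. x <# H) ` D"
        then obtain x where x: "x \<in> D" "a = x <# H" by auto
        then obtain t where t: "t \<in> T" "t <# H = x <# H" using Tl Dc by blast
        then have "t \<in> D" using lD D x Tc by blast
        then show "a \<in> (\<lambda>x. x <# H) ` (T \<inter> D)" using t x by blast
      qed
      moreover have "(\<lambda>x. H #> x) ` D \<subseteq> (\<lambda>x. H #> x) ` (T \<inter> D)"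
      proof
        fix a assume "a \<in> (\<lambda>x. H #> x) ` D"
        then obtain x where x: "x \<in> D" "a = H #> x" by auto
        then obtain t where t: "t \<in> T" "H #> t = H #> x" using Tr Dc by blast
        then have "t \<in> D" using rD D x Tc by blast
        then show "a \<in> (\<lambda>x. H #> x) ` (T \<inter> D)" using t x by blast
      qed
      ultimately show "?f T D \<in> ?J D" using D by (auto simp: grid_transversals_def)
    qed simp
  qed
  show "(\<lambda>F. \<Union>D\<in>?DD. F D) ` PiE ?DD ?J \<subseteq> DT G H"
  proof
    fix T assume "T \<in> (\<lambda>F. \<Union>D\<in>?DD. F D) ` PiE ?DD ?J"
    then obtain F where Fi: "F \<in> PiE ?DD ?J" and T: "T = (\<Union>D\<in>?DD. F D)" by auto
    have J: "T \<inter> D \<in> ?J D" if "D \<in> ?DD" for D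
      using F[OF Fi that] Fi that T by auto
    have Tc: "T \<subseteq> carrier G"
    proof
      fix t assume "t \<in> T"
      then obtain D where D: "D \<in> ?DD" "t \<in> F D" using T by auto
      then have "F D \<in> ?J D" using Fi by auto
      then show "t \<in> carrier G" using D U by (auto simp: grid_transversals_def)
    qed
    have "\<exists>!t. t \<in> T \<and> t <# H = x <# H" if x: "x \<in> carrier G" for x
    proof -
      obtain D where D: "D \<in> ?DD" "x \<in> D" using x U by auto
      have JD: "inj_on (\<lambda>x. x <# H) (T \<inter> D)" "(\<lambda>x. x <# H) ` (T \<inter> D) = (\<lambda>x. x <# H) ` D"
        using J[OF D(1)] by (auto simp: grid_transversals_def)
      have "x <# H \<in> (\<lambda>x. x <# H) ` (T \<inter> D)" unfolding JD(2) using D(2) by (rule imageI)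
      then obtain t where "t \<in> T" "t \<in> D" "t <# H = x <# H" by auto
      moreover have "s = t" if "s \<in> T" "s <# H = x <# H" for s
      proof -
        have "s \<in> D" using lD D that Tc by blast
        then show ?thesis using JD(1) that \<open>t \<in> T\<close> \<open>t \<in> D\<close> \<open>t <# H = x <# H\<close>
          by (auto dest: inj_onD)
      qed
      ultimately show ?thesis by blast
    qed
    moreover have "\<exists>!t. t \<in> T \<and> H #> t = H #> x" if x: "x \<in> carrier G" for x
    proof -
      obtain D where D: "D \<in> ?DD" "x \<in> D" using x U by auto
      have JD: "inj_on (\<lambda>x. H #> x) (T \<inter> D)" "(\<lambda>x. H #> x) ` (T \<inter> D) = (\<lambda>x. H #> x) ` D"
        using J[OF D(1)] by (auto simp: grid_transversals_def)
      have "H #> x \<in> (\<lambda>x. H #> x) ` (T \<inter> D)" unfolding JD(2) using D(2) by (rule imageI)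
      then obtain t where "t \<in> T" "t \<in> D" "H #> t = H #> x" by auto
      moreover have "s = t" if "s \<in> T" "H #> s = H #> x" for s
      proof -
        have "s \<in> D" using rD D that Tc by blast
        then show ?thesis using JD(1) that \<open>t \<in> T\<close> \<open>t \<in> D\<close> \<open>H #> t = H #> x\<close>
          by (auto dest: inj_onD)
      qed
      ultimately show ?thesis by blast
    qed
    ultimately show "T \<in> DT G H" using Tc by (simp add: DT_eq)
  qed
qed

end

text \<open>The probability that a random self-map of an m-element set is a permutation. Since 0^0 =
  1 the value at 0 is 1, from which \<open>perm_prob_le_1\<close> follows by monotonicity.\<close>

definition perm_prob :: "nat \<Rightarrow> real"
  where "perm_prob m = fact m / real m ^ m"

context finite_group_subgroup
begin

text \<open>The division is exact, a double coset being a union of left cosets. Defining the number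
  through cardinalities makes it easy to follow along a surjection, where both are multiplied by the
  order of the kernel.\<close>

definition coset_count :: "'a set \<Rightarrow> nat"
  where "coset_count D = card D div card H"

lemma coset_count:
  assumes "D \<in> double_cosets G H"
  shows "card D = coset_count D * card H" "coset_count D \<ge> 1" "coset_count D dvd card H"
proof -
  obtain m c where m: "m \<ge> 1" "m * c = card H" "card D = m * card H"
    using double_coset_grid[OF assms] by metis
  then have "coset_count D = m" using cardH_pos by (simp add: coset_count_def)
  then show "card D = coset_count D * card H" "coset_count D \<ge> 1" "coset_count D dvd card H"
    using m dvd_triv_left[of m c] by auto
qed

lemma card_sum_double_cosets: "card (carrier G) = (\<Sum>D\<in>double_cosets G H. card D)"
proof -
  have "card (\<Union> (double_cosets G H)) = (\<Sum>D\<in>double_cosets G H. card D)"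
    by (rule card_Union_disjoint)
       (use finite_double_coset double_cosets_disjoint in \<open>auto simp: pairwise_def disjnt_def\<close>)
  then show ?thesis by (simp add: Union_double_cosets)
qed

lemma sum_coset_count: "(\<Sum>D\<in>double_cosets G H. coset_count D) = card (rcosets H)"
proof -
  have "card (rcosets H) * card H = (\<Sum>D\<in>double_cosets G H. coset_count D) * card H"
    using lagrange[OF subgroupH] card_sum_double_cosets coset_count(1)
    by (simp add: order_def sum_distrib_right)
  then show ?thesis using cardH_pos by simp
qed

text \<open>A double coset with m cosets on either side has m! c^m transversals where m c = |H|,
  that is, m!/m^m times |H|^m. The exponents m add up to the index of \<open>H\<close>.\<close>

lemma transversal_prob_eq:
  "transversal_prob G H = (\<Prod>D\<in>double_cosets G H. perm_prob (coset_count D))"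
proof -
  let ?J = "\<lambda>D. grid_transversals (\<lambda>x. x <# H) (\<lambda>x. H #> x) D ((\<lambda>x. x <# H) ` D) ((\<lambda>x. H #> x) ` D)"
  have *: "real (card (?J D)) = perm_prob (coset_count D) * real (card H) ^ coset_count D"
    if D: "D \<in> double_cosets G H" for D
  proof -
    obtain m c where m: "m \<ge> 1" "m * c = card H" "card D = m * card H"
      "card ((\<lambda>x. x <# H) ` D) = m" "card ((\<lambda>x. H #> x) ` D) = m"
      "\<And>a b. a \<in> (\<lambda>x. x <# H) ` D \<Longrightarrow> b \<in> (\<lambda>x. H #> x) ` D \<Longrightarrow>
        card {x \<in> D. x <# H = a \<and> H #> x = b} = c"
      "\<And>x. x \<in> D \<Longrightarrow> c = card ((x <# H) \<inter> (H #> x))"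
      by (rule double_coset_grid[OF D]) (rule that)
    have mm: "coset_count D = m" using m cardH_pos by (simp add: coset_count_def)
    have "card (?J D) = fact m * c ^ m"
      by (rule card_grid_transversals) (use m finite_double_coset[OF D] in auto)
    moreover have "real (card H) ^ m = real m ^ m * real c ^ m"
      using m(2) by (metis of_nat_mult power_mult_distrib)
    ultimately show ?thesis using m(1) mm by (simp add: perm_prob_def)
  qed
  have "card (DT G H) = (\<Prod>D\<in>double_cosets G H. card (?J D))"
    using bij_betw_same_card[OF DT_bij] card_PiE[OF finite_double_cosets, of ?J] by simp
  then have "real (card (DT G H)) =
      (\<Prod>D\<in>double_cosets G H. perm_prob (coset_count D)) * real (card H) ^ card (rcosets H)"
    using * by (simp add: prod.distrib power_sum sum_coset_count[symmetric])
  then show ?thesis using cardH_pos by (simp add: transversal_prob_def)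
qed

end

section \<open>Subgroups of prime order and quotients\<close>

text \<open>The normalizer of \<open>H\<close>, written with equal cosets because these are the
  elements whose double coset is a single coset.\<close>

definition normalizing :: "('a, 'b) monoid_scheme \<Rightarrow> 'a set \<Rightarrow> 'a set"
  where "normalizing G H = {g \<in> carrier G. g <#\<^bsub>G\<^esub> H = H #>\<^bsub>G\<^esub> g}"

context finite_group_subgroup
begin

text \<open>The grid has one cell exactly when the cell x H \<inter> H x has |H| elements, and then
  it fills both cosets.\<close>

lemma coset_count_eq_1_iff:
  assumes D: "D \<in> double_cosets G H" and x: "x \<in> D"
  shows "coset_count D = 1 \<longleftrightarrow> x \<in> normalizing G H"
proof -
  obtain m c where m: "m \<ge> 1" "m * c = card H" "card D = m * card H"
    "card ((\<lambda>x. x <# H) ` D) = m" "card ((\<lambda>x. H #> x) ` D) = m"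
    "\<And>a b. a \<in> (\<lambda>x. x <# H) ` D \<Longrightarrow> b \<in> (\<lambda>x. H #> x) ` D \<Longrightarrow>
      card {x \<in> D. x <# H = a \<and> H #> x = b} = c"
    "\<And>x. x \<in> D \<Longrightarrow> c = card ((x <# H) \<inter> (H #> x))"
    by (rule double_coset_grid[OF D]) (rule that)
  have xc: "x \<in> carrier G" using D x Union_double_cosets by auto
  have mm: "coset_count D = m" using m(3) cardH_pos by (simp add: coset_count_def)
  have c: "c = card ((x <# H) \<inter> (H #> x))" using m(7) x .
  have fin: "finite (x <# H)" "finite (H #> x)"
    using finH by (auto simp: l_coset_def r_coset_def)
  have "m = 1 \<longleftrightarrow> c = card H" using m(1,2) cardH_pos by auto
  also have "\<dots> \<longleftrightarrow> x <# H = H #> x"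
  proof
    assume "c = card H"
    then have "(x <# H) \<inter> (H #> x) = x <# H" "(x <# H) \<inter> (H #> x) = H #> x"
      using c fin card_l_coset[OF xc] card_r_coset[OF xc]
      by (metis card_subset_eq inf_le1, metis card_subset_eq inf_le2)
    then show "x <# H = H #> x" by simp
  next
    assume "x <# H = H #> x"
    then show "c = card H" using c card_r_coset[OF xc] by simp
  qed
  finally show ?thesis using mm xc by (simp add: normalizing_def)
qed

text \<open>\<open>coset_count\<close> divides the prime p, so it is 1 or p. The double cosets with
  value 1 fill the normalizer; \<open>k\<close> counts the others, each having p^2 elements and
  contributing one factor \<open>perm_prob p\<close>.\<close>

lemma prime_order_decomposition:
  assumes p: "card H = p" "Factorial_Ring.prime p"
  shows "\<exists>k. card (carrier G) = card (normalizing G H) + p\<^sup>2 * k \<and>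
    transversal_prob G H = perm_prob p ^ k"
proof -
  let ?A = "{D \<in> double_cosets G H. coset_count D = 1}"
  let ?B = "{D \<in> double_cosets G H. coset_count D \<noteq> 1}"
  have AB: "double_cosets G H = ?A \<union> ?B" by auto
  have fin: "finite ?A" "finite ?B" using finite_double_cosets by auto
  have cB: "coset_count D = p" if "D \<in> ?B" for D
    using that coset_count(3)[of D] p by (auto simp: prime_nat_iff)
  have N: "\<Union> ?A = normalizing G H"
  proof (intro equalityI subsetI)
    fix x assume "x \<in> \<Union> ?A"
    then obtain D where "D \<in> double_cosets G H" "coset_count D = 1" "x \<in> D" by auto
    then show "x \<in> normalizing G H" using coset_count_eq_1_iff by blast
  next
    fix x assume x: "x \<in> normalizing G H"
    then have "x \<in> carrier G" by (simp add: normalizing_def)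
    then obtain D where D: "D \<in> double_cosets G H" "x \<in> D" using Union_double_cosets by blast
    then have "coset_count D = 1" using coset_count_eq_1_iff x by blast
    then show "x \<in> \<Union> ?A" using D by blast
  qed
  have "card (\<Union> ?A) = (\<Sum>D\<in>?A. card D)"
    by (rule card_Union_disjoint)
       (use finite_double_coset double_cosets_disjoint in \<open>auto simp: pairwise_def disjnt_def\<close>)
  then have sA: "card (normalizing G H) = (\<Sum>D\<in>?A. card D)" using N by simp
  have sB: "(\<Sum>D\<in>?B. card D) = card ?B * p\<^sup>2"
  proof -
    have "card D = p\<^sup>2" if "D \<in> ?B" for D
      using cB[OF that] coset_count(1)[of D] that p(1) by (simp add: power2_eq_square)
    then show ?thesis by simp
  qed
  have "card (carrier G) = (\<Sum>D\<in>?A. card D) + (\<Sum>D\<in>?B. card D)"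
    unfolding card_sum_double_cosets
    by (subst AB, rule sum.union_disjoint) (use fin in auto)
  then have 1: "card (carrier G) = card (normalizing G H) + p\<^sup>2 * card ?B" using sA sB by simp
  have "transversal_prob G H =
      (\<Prod>D\<in>?A. perm_prob (coset_count D)) * (\<Prod>D\<in>?B. perm_prob (coset_count D))"
    unfolding transversal_prob_eq
    by (subst AB, rule prod.union_disjoint) (use fin in auto)
  also have "\<dots> = perm_prob p ^ card ?B"
  proof -
    have "(\<Prod>D\<in>?A. perm_prob (coset_count D)) = 1"
      by (rule prod.neutral) (simp add: perm_prob_def)
    moreover have "(\<Prod>D\<in>?B. perm_prob (coset_count D)) = (\<Prod>D\<in>?B. perm_prob p)"
      by (rule prod.cong[OF refl]) (simp only: cB)
    ultimately show ?thesis by simp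
  qed
  finally show ?thesis using 1 by blast
qed

end

section \<open>Restrictions on subgroups of prime order imposed by \<open>tp\<close>\<close>

lemma (in group) finite_subgroups: "finite (carrier G) \<Longrightarrow> finite {H. subgroup H G}"
  by (rule finite_subset[of _ "Pow (carrier G)"]) (auto dest: subgroup.subset)

lemma (in group) tp_le:
  assumes "finite (carrier G)" "subgroup H G"
  shows "tp G \<le> transversal_prob G H"
  unfolding tp_def using assms finite_subgroups by (auto intro!: Min_le)

lemma (in group) tp_attained:
  assumes "finite (carrier G)"
  obtains H where "subgroup H G" "tp G = transversal_prob G H"
proof -
  have "{H. subgroup H G} \<noteq> {}" using subgroup_self by blast
  then have "tp G \<in> transversal_prob G ` {H. subgroup H G}"
    unfolding tp_def using assms finite_subgroups by (intro Min_in) auto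
  then show ?thesis using that by auto
qed

text \<open>One factor m + 1 cancels, leaving m!/(m+1)^m to be compared with m!/m^m.\<close>

lemma perm_prob_Suc_le: "perm_prob (Suc m) \<le> perm_prob m"
proof (cases "m = 0")
  case False
  have "perm_prob (Suc m) = fact m / real (Suc m) ^ m"
    by (simp add: perm_prob_def divide_simps del: of_nat_Suc)
  also have "\<dots> \<le> fact m / real m ^ m"
    using False by (intro divide_left_mono power_mono mult_pos_pos) auto
  finally show ?thesis by (simp add: perm_prob_def)
qed (simp add: perm_prob_def)

lemma perm_prob_antimono: "m \<le> n \<Longrightarrow> perm_prob n \<le> perm_prob m"
  by (rule lift_Suc_antimono_le[of perm_prob]) (auto intro: perm_prob_Suc_le)

lemma perm_prob_nonneg: "perm_prob m \<ge> 0"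
  by (simp add: perm_prob_def)

lemma perm_prob_le_1: "perm_prob m \<le> 1"
  using perm_prob_antimono[of 0 m] by (simp add: perm_prob_def)

lemma perm_prob_numerals:
  "perm_prob 2 = 1/2" "perm_prob 3 = 2/9" "perm_prob 5 = 24/625"
  "perm_prob 7 = 720/117649" "perm_prob 8 = 315/131072"
  by (simp_all add: perm_prob_def fact_numeral)

lemma (in group) prime_order_bound:
  assumes fin: "finite (carrier G)" and tp: "tp G > (1/2)^8" and H: "subgroup H G"
    and p: "card H = p" "Factorial_Ring.prime p"
  shows "\<exists>k. card (carrier G) = card (normalizing G H) + p\<^sup>2 * k \<and>
    (k = 0 \<or> p = 2 \<and> k \<le> 7 \<or> p = 3 \<and> k \<le> 3 \<or> p = 5 \<and> k = 1 \<or> p = 7 \<and> k = 1)"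
proof -
  interpret finite_group_subgroup G H
    using H fin by (simp add: finite_group_subgroup_def finite_group_subgroup_axioms_def is_group)
  obtain k where k: "card (carrier G) = card (normalizing G H) + p\<^sup>2 * k"
    "transversal_prob G H = perm_prob p ^ k"
    using prime_order_decomposition[OF p] by auto
  have gt: "perm_prob p ^ k > 1/256" using tp_le[OF fin H] tp k(2) by (simp add: power_divide)
  have le: "k < n" if "perm_prob p ^ n \<le> 1/256" for n
    using that gt power_decreasing[of n k "perm_prob p"] perm_prob_nonneg perm_prob_le_1
    by (meson leI le_less_trans not_less)
  have "p \<noteq> 0" "p \<noteq> 1" "p \<noteq> 4" "p \<noteq> 6"
    using p(2) prime_product[of 2 2] prime_product[of 2 3] by auto
  then consider "p = 2" | "p = 3" | "p = 5" | "p = 7" | "p \<ge> 8"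
    by linarith
  then have "k = 0 \<or> p = 2 \<and> k \<le> 7 \<or> p = 3 \<and> k \<le> 3 \<or> p = 5 \<and> k = 1 \<or> p = 7 \<and> k = 1"
  proof cases
    \<comment> \<open>(1/2)^8 equals the bound and so already violates the strict inequality;
      (2/9)^4, (24/625)^2 and (720/117649)^2 in the next cases lie below it.\<close>
    case 1 then show ?thesis using le[of 8] by (simp add: perm_prob_numerals power_divide)
  next
    case 2 then show ?thesis using le[of 4] by (simp add: perm_prob_numerals power_divide)
  next
    case 3 then show ?thesis using le[of 2] by (auto simp: perm_prob_numerals power_divide)
  next
    case 4 then show ?thesis using le[of 2] by (auto simp: perm_prob_numerals power_divide)
  next
    \<comment> \<open>8 is the first argument at which \<open>perm_prob\<close> is below 1/256, so
      all primes from 11 on leave only k = 0.\<close>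
    case 5
    then have "perm_prob p ^ 1 \<le> 1/256"
      using perm_prob_antimono[of 8 p] by (simp add: perm_prob_numerals)
    then show ?thesis using le[of 1] by simp
  qed
  then show ?thesis using k by blast
qed

section \<open>Behaviour of \<open>tp\<close> under surjective homomorphisms\<close>

lemma (in group_hom) card_vimage_fibre:
  assumes "x \<in> carrier G"
  shows "card {y \<in> carrier G. h y = h x} = card (kernel G H h)"
proof -
  have "{y \<in> carrier G. h y = h x} = (\<lambda>n. n \<otimes>\<^bsub>G\<^esub> x) ` kernel G H h"
  proof (intro equalityI subsetI)
    fix y assume y: "y \<in> {y \<in> carrier G. h y = h x}"
    then have "y \<otimes>\<^bsub>G\<^esub> inv\<^bsub>G\<^esub> x \<in> kernel G H h" using assms by (simp add: kernel_def)
    moreover have "y = y \<otimes>\<^bsub>G\<^esub> inv\<^bsub>G\<^esub> x \<otimes>\<^bsub>G\<^esub> x" using y assms by (simp add: G.m_assoc)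
    ultimately show "y \<in> (\<lambda>n. n \<otimes>\<^bsub>G\<^esub> x) ` kernel G H h" by blast
  qed (use assms in \<open>auto simp: kernel_def\<close>)
  moreover have "inj_on (\<lambda>n. n \<otimes>\<^bsub>G\<^esub> x) (kernel G H h)"
    using assms by (auto intro!: inj_onI simp: kernel_def)
  ultimately show ?thesis by (simp add: card_image)
qed

lemma (in group_hom) card_preimage:
  assumes "finite (carrier G)" "S \<subseteq> h ` carrier G"
  shows "card {x \<in> carrier G. h x \<in> S} = card S * card (kernel G H h)"
proof -
  have finS: "finite S" using assms finite_subset by blast
  have "{x \<in> carrier G. h x \<in> S} = (\<Union>s\<in>S. {x \<in> carrier G. h x = s})" by auto
  then have "card {x \<in> carrier G. h x \<in> S} = card (\<Union>s\<in>S. {x \<in> carrier G. h x = s})" by simp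
  also have "\<dots> = (\<Sum>s\<in>S. card {x \<in> carrier G. h x = s})"
    by (rule card_UN_disjoint) (use assms finS in auto)
  also have "\<dots> = (\<Sum>s\<in>S. card (kernel G H h))"
    by (rule sum.cong) (use assms card_vimage_fibre in auto)
  finally show ?thesis by simp
qed

text \<open>Let \<open>K\<close> attain the minimum in the image and let \<open>L\<close> be its
  preimage. Taking preimages matches the double cosets of \<open>K\<close> with those of
  \<open>L\<close> and multiplies all cardinalities by the order of the kernel, so the factors of
  the two products agree.\<close>

lemma (in group_hom) tp_le_surjective_image:
  assumes fin: "finite (carrier G)" and surj: "h ` carrier G = carrier H"
  shows "tp G \<le> tp H"
proof -
  have finH: "finite (carrier H)" using fin surj by (metis finite_imageI)
  obtain K where K: "subgroup K H" "tp H = transversal_prob H K"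
    using H.tp_attained[OF finH] by blast
  define L where "L = {x \<in> carrier G. h x \<in> K}"
  have L: "subgroup L G"
  proof (rule G.subgroupI)
    show "L \<noteq> {}" using subgroup.one_closed[OF K(1)] by (auto simp: L_def intro!: exI[of _ "\<one>\<^bsub>G\<^esub>"])
  qed (use K(1) in \<open>auto simp: L_def subgroup.m_closed subgroup.m_inv_closed\<close>)
  interpret HK: finite_group_subgroup H K
    using K finH by (simp add: finite_group_subgroup_def finite_group_subgroup_axioms_def)
  interpret GL: finite_group_subgroup G L
    using L fin by (simp add: finite_group_subgroup_def finite_group_subgroup_axioms_def)
  have dc: "double_coset G L x = {y \<in> carrier G. h y \<in> double_coset H K (h x)}"
    if x: "x \<in> carrier G" for x
  proof (intro equalityI subsetI)
    fix y assume "y \<in> double_coset G L x"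
    then obtain a b where ab: "a \<in> L" "b \<in> L" "y = a \<otimes>\<^bsub>G\<^esub> x \<otimes>\<^bsub>G\<^esub> b"
      by (auto simp: double_coset_def)
    have "a \<in> carrier G" "b \<in> carrier G" "h a \<in> K" "h b \<in> K"
      using ab(1,2) unfolding L_def by blast+
    moreover from this have "y \<in> carrier G" "h y = h a \<otimes>\<^bsub>H\<^esub> h x \<otimes>\<^bsub>H\<^esub> h b"
      using ab(3) x by simp_all
    ultimately show "y \<in> {y \<in> carrier G. h y \<in> double_coset H K (h x)}"
      unfolding double_coset_def by blast
  next
    fix y assume "y \<in> {y \<in> carrier G. h y \<in> double_coset H K (h x)}"
    then obtain a' b' where y: "y \<in> carrier G" "a' \<in> K" "b' \<in> K" "h y = a' \<otimes>\<^bsub>H\<^esub> h x \<otimes>\<^bsub>H\<^esub> b'"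
      unfolding double_coset_def by blast
    have "b' \<in> h ` carrier G" using y K(1) surj subgroup.subset by blast
    then obtain b where b: "b \<in> carrier G" "h b = b'" by auto
    \<comment> \<open>Only \<open>b\<close> has to be lifted; \<open>a\<close> is then the solution
      of y = a x b, and its image turns out to be \<open>a'\<close>.\<close>
    define a where "a = y \<otimes>\<^bsub>G\<^esub> inv\<^bsub>G\<^esub> b \<otimes>\<^bsub>G\<^esub> inv\<^bsub>G\<^esub> x"
    have c: "a' \<in> carrier H" "b' \<in> carrier H" using y HK.subset by auto
    have "h a = a'" using y b x c by (simp add: a_def H.m_assoc)
    moreover have "a \<in> carrier G" unfolding a_def using y(1) b(1) x by simp
    ultimately have "a \<in> L" "b \<in> L" using y(2,3) b unfolding L_def by simp_all
    moreover have "y = a \<otimes>\<^bsub>G\<^esub> x \<otimes>\<^bsub>G\<^esub> b" using x y(1) b(1) by (simp add: a_def G.m_assoc)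
    ultimately show "y \<in> double_coset G L x" unfolding double_coset_def by blast
  qed
  let ?pre = "\<lambda>D. {y \<in> carrier G. h y \<in> D}"
  have sub: "D \<subseteq> h ` carrier G" if "D \<in> double_cosets H K" for D
    using that HK.Union_double_cosets surj by auto
  have bij: "bij_betw ?pre (double_cosets H K) (double_cosets G L)"
    unfolding bij_betw_def
  proof
    show "inj_on ?pre (double_cosets H K)"
    proof (rule inj_onI)
      fix D E assume DE: "D \<in> double_cosets H K" "E \<in> double_cosets H K" "?pre D = ?pre E"
      have "D = h ` ?pre D" "E = h ` ?pre E" using sub[OF DE(1)] sub[OF DE(2)] by blast+
      then show "D = E" using DE(3) by simp
    qed
    have "double_cosets G L = ?pre ` double_coset H K ` h ` carrier G"
      unfolding double_cosets_def using dc by (auto simp: image_image intro!: image_cong)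
    then show "?pre ` double_cosets H K = double_cosets G L"
      by (simp add: double_cosets_def surj)
  qed
  have ker: "card (kernel G H h) > 0"
    using fin subgroup.one_closed[OF subgroup_kernel] by (auto simp: card_gt_0_iff kernel_def)
  have cL: "card L = card K * card (kernel G H h)"
    unfolding L_def by (rule card_preimage[OF fin]) (use HK.subset surj in auto)
  have "transversal_prob H K = (\<Prod>D\<in>double_cosets H K. perm_prob (HK.coset_count D))"
    by (rule HK.transversal_prob_eq)
  also have "\<dots> = (\<Prod>D\<in>double_cosets H K. perm_prob (GL.coset_count (?pre D)))"
  proof (rule prod.cong)
    fix D assume D: "D \<in> double_cosets H K"
    have "card (?pre D) = card D * card (kernel G H h)"
      by (rule card_preimage[OF fin sub[OF D]])
    then show "perm_prob (HK.coset_count D) = perm_prob (GL.coset_count (?pre D))"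
      using cL ker by (simp add: HK.coset_count_def GL.coset_count_def)
  qed simp
  also have "\<dots> = (\<Prod>D\<in>double_cosets G L. perm_prob (GL.coset_count D))"
    by (rule prod.reindex_bij_betw[OF bij])
  also have "\<dots> = transversal_prob G L" by (rule GL.transversal_prob_eq[symmetric])
  finally show ?thesis using K(2) G.tp_le[OF fin L] by simp
qed

section \<open>Conjugation in finite groups\<close>

locale fin_group = group G for G (structure) +
  assumes fin: "finite (carrier G)"
begin

lemma inv_mult_cancel [simp]:
  "\<lbrakk>x \<in> carrier G; y \<in> carrier G\<rbrakk> \<Longrightarrow> inv x \<otimes> (x \<otimes> y) = y"
  "\<lbrakk>x \<in> carrier G; y \<in> carrier G\<rbrakk> \<Longrightarrow> x \<otimes> (inv x \<otimes> y) = y"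
  by (simp_all add: m_assoc[symmetric])

lemma finite_subgroup: "subgroup H G \<Longrightarrow> finite H"
  using fin subgroup.subset finite_subset by blast

lemma subgroup_card_pos: "subgroup H G \<Longrightarrow> card H > 0"
  using finite_subgroup subgroup.one_closed by (metis card_gt_0_iff empty_iff)

lemma card_subgroup_dvd: "subgroup H G \<Longrightarrow> card H dvd card (carrier G)"
  using lagrange[of H] by (metis dvd_triv_right order_def)

lemma card_subgroup_dvd_subgroup:
  assumes "subgroup H G" "subgroup K G" "H \<subseteq> K"
  shows "card H dvd card K"
proof -
  interpret K: group "G\<lparr>carrier := K\<rparr>" using assms(2) subgroup_imp_group by blast
  have "subgroup H (G\<lparr>carrier := K\<rparr>)" using subgroup_incl assms by blast
  then show ?thesis using K.lagrange[of H] by (metis dvd_triv_right order_def partial_object.select_convs(1)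
      partial_object.update_convs(1) partial_object.surjective)
qed

lemma cauchy_subgroup:
  assumes "subgroup K G" "Factorial_Ring.prime p" "p dvd card K"
  obtains H where "subgroup H G" "H \<subseteq> K" "card H = p"
proof -
  interpret K: group "G\<lparr>carrier := K\<rparr>" using assms(1) subgroup_imp_group by blast
  obtain m where "card K = p * m" using assms(3) by auto
  then obtain H where H: "subgroup H (G\<lparr>carrier := K\<rparr>)" "card H = p"
    using sylow_thm[OF assms(2) K.is_group, of 1 m] finite_subgroup[OF assms(1)]
    by (auto simp: order_def)
  then show ?thesis using that[of H] incl_subgroup[OF assms(1)] subgroup.subset[OF H(1)] by auto
qed

definition conj_by :: "'a \<Rightarrow> 'a \<Rightarrow> 'a"
  where "conj_by g x = g \<otimes> x \<otimes> inv g"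

lemma conj_by_closed [simp]: "g \<in> carrier G \<Longrightarrow> x \<in> carrier G \<Longrightarrow> conj_by g x \<in> carrier G"
  by (simp add: conj_by_def)

lemma conj_by_one [simp]: "g \<in> carrier G \<Longrightarrow> conj_by g \<one> = \<one>" "x \<in> carrier G \<Longrightarrow> conj_by \<one> x = x"
  by (simp_all add: conj_by_def)

lemma conj_by_mult: "g \<in> carrier G \<Longrightarrow> x \<in> carrier G \<Longrightarrow> y \<in> carrier G \<Longrightarrow>
    conj_by g (x \<otimes> y) = conj_by g x \<otimes> conj_by g y"
  by (simp add: conj_by_def m_assoc)

lemma conj_by_inv: "g \<in> carrier G \<Longrightarrow> x \<in> carrier G \<Longrightarrow> conj_by g (inv x) = inv (conj_by g x)"
  by (simp add: conj_by_def m_assoc inv_mult_group)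

lemma conj_by_conj_by: "g \<in> carrier G \<Longrightarrow> h \<in> carrier G \<Longrightarrow> x \<in> carrier G \<Longrightarrow>
    conj_by g (conj_by h x) = conj_by (g \<otimes> h) x"
  by (simp add: conj_by_def m_assoc inv_mult_group)

lemma conj_by_inv_cancel [simp]: "g \<in> carrier G \<Longrightarrow> x \<in> carrier G \<Longrightarrow> conj_by (inv g) (conj_by g x) = x"
  "g \<in> carrier G \<Longrightarrow> x \<in> carrier G \<Longrightarrow> conj_by g (conj_by (inv g) x) = x"
  by (simp_all add: conj_by_conj_by)

lemma conj_by_inj: "g \<in> carrier G \<Longrightarrow> inj_on (conj_by g) (carrier G)"
  by (rule inj_onI) (metis conj_by_inv_cancel(1))

lemma conj_by_eq_iff: "g \<in> carrier G \<Longrightarrow> x \<in> carrier G \<Longrightarrow> conj_by g x = x \<longleftrightarrow> g \<otimes> x = x \<otimes> g"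
  by (metis conj_by_def inv_closed inv_solve_right m_closed)

lemma conj_by_eq_one_iff: "g \<in> carrier G \<Longrightarrow> x \<in> carrier G \<Longrightarrow> conj_by g x = \<one> \<longleftrightarrow> x = \<one>"
  by (metis conj_by_inv_cancel(1) conj_by_one(1) inv_closed)

lemma conj_subgroup:
  assumes "subgroup H G" "g \<in> carrier G"
  shows "subgroup (conj_by g ` H) G" "card (conj_by g ` H) = card H"
proof -
  have sub: "H \<subseteq> carrier G" using assms subgroup.subset by blast
  show "card (conj_by g ` H) = card H"
    by (rule card_image) (use conj_by_inj[OF assms(2)] sub inj_on_subset in blast)
  show "subgroup (conj_by g ` H) G"
  proof (rule subgroupI)
    show "conj_by g ` H \<subseteq> carrier G" using sub assms(2) by auto
    show "conj_by g ` H \<noteq> {}" using assms(1) subgroup.one_closed by blast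
  next
    fix a assume "a \<in> conj_by g ` H"
    then obtain h where h: "h \<in> H" "a = conj_by g h" by auto
    then have "inv a = conj_by g (inv h)" using conj_by_inv[OF assms(2), of h] sub by auto
    then show "inv a \<in> conj_by g ` H" using subgroup.m_inv_closed[OF assms(1) h(1)] by blast
  next
    fix a b assume "a \<in> conj_by g ` H" "b \<in> conj_by g ` H"
    then obtain h k where hk: "h \<in> H" "a = conj_by g h" "k \<in> H" "b = conj_by g k" by auto
    then have "h \<in> carrier G" "k \<in> carrier G" using sub by auto
    then have "a \<otimes> b = conj_by g (h \<otimes> k)" using conj_by_mult[OF assms(2)] hk by simp
    then show "a \<otimes> b \<in> conj_by g ` H" using hk subgroup.m_closed[OF assms(1)] by blast
  qed
qed

text \<open>The cosets g H and H g are finite of equal size, so one inclusion between them is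
  already equality.\<close>

lemma normalizing_iff:
  assumes H: "subgroup H G" and g: "g \<in> carrier G"
  shows "g \<in> normalizing G H \<longleftrightarrow> conj_by g ` H \<subseteq> H"
proof -
  interpret finite_group_subgroup G H
    using H fin by (simp add: finite_group_subgroup_def finite_group_subgroup_axioms_def is_group)
  have "g <# H = H #> g \<longleftrightarrow> g <# H \<subseteq> H #> g"
    using card_l_coset[OF g] card_r_coset[OF g] cardH_pos
    by (metis card_gt_0_iff card_subset_eq equalityD1)
  also have "\<dots> \<longleftrightarrow> conj_by g ` H \<subseteq> H"
  proof
    assume L: "g <# H \<subseteq> H #> g"
    show "conj_by g ` H \<subseteq> H"
    proof
      fix y assume "y \<in> conj_by g ` H"
      then obtain h where h: "h \<in> H" "y = g \<otimes> h \<otimes> inv g" by (auto simp: conj_by_def)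
      have "g \<otimes> h \<in> g <# H" using h by (auto simp: l_coset_def)
      then obtain k where k: "k \<in> H" "g \<otimes> h = k \<otimes> g" using L by (auto simp: r_coset_def)
      then have "y = k" using h g by (simp add: m_assoc)
      then show "y \<in> H" using k by simp
    qed
  next
    assume R: "conj_by g ` H \<subseteq> H"
    show "g <# H \<subseteq> H #> g"
    proof
      fix y assume "y \<in> g <# H"
      then obtain h where h: "h \<in> H" "y = g \<otimes> h" by (auto simp: l_coset_def)
      have "conj_by g h \<in> H" using R h by blast
      moreover have "y = conj_by g h \<otimes> g" using h g by (simp add: conj_by_def m_assoc)
      ultimately show "y \<in> H #> g" by (auto simp: r_coset_def)
    qed
  qed
  finally show ?thesis using g by (simp add: normalizing_def)
qed

lemma normalizing_conj_image:
  assumes H: "subgroup H G" and g: "g \<in> carrier G"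
  shows "g \<in> normalizing G H \<longleftrightarrow> conj_by g ` H = H"
  using normalizing_iff[OF assms] conj_subgroup(2)[OF assms] finite_subgroup[OF H]
  by (metis card_subset_eq subset_refl)

lemma normalizing_subset: "normalizing G H \<subseteq> carrier G"
  by (auto simp: normalizing_def)

lemma subgroup_normalizing:
  assumes H: "subgroup H G"
  shows "subgroup (normalizing G H) G"
proof -
  have sub: "H \<subseteq> carrier G" using H subgroup.subset by blast
  have comp: "conj_by a ` conj_by b ` H = conj_by (a \<otimes> b) ` H" if "a \<in> carrier G" "b \<in> carrier G" for a b
    unfolding image_image by (rule image_cong) (use that sub conj_by_conj_by in auto)
  have one: "conj_by \<one> ` H = H" using sub by force
  show ?thesis
  proof (rule subgroupI)
    show "normalizing G H \<subseteq> carrier G" by (rule normalizing_subset)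
    show "normalizing G H \<noteq> {}" using normalizing_conj_image[OF H, of \<one>] one by auto
  next
    fix a assume a: "a \<in> normalizing G H"
    then have ac: "a \<in> carrier G" using normalizing_subset by blast
    then have "conj_by a ` H = H" using a normalizing_conj_image[OF H] by blast
    then have "conj_by (inv a) ` H = H" using comp[of "inv a" a] ac one by simp
    then show "inv a \<in> normalizing G H" using normalizing_conj_image[OF H, of "inv a"] ac by simp
  next
    fix a b assume ab: "a \<in> normalizing G H" "b \<in> normalizing G H"
    then have c: "a \<in> carrier G" "b \<in> carrier G" using normalizing_subset by blast+
    have "conj_by a ` H = H" "conj_by b ` H = H" using ab c normalizing_conj_image[OF H] by blast+
    then have "conj_by (a \<otimes> b) ` H = H" using comp[OF c] by simp
    then show "a \<otimes> b \<in> normalizing G H" using normalizing_conj_image[OF H, of "a \<otimes> b"] c by simp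
  qed
qed

lemma subset_normalizing:
  assumes H: "subgroup H G"
  shows "H \<subseteq> normalizing G H"
proof
  fix x assume x: "x \<in> H"
  then have "conj_by x ` H \<subseteq> H"
    using H by (auto simp: conj_by_def subgroup.m_closed subgroup.m_inv_closed)
  then show "x \<in> normalizing G H" using normalizing_iff[OF H] x subgroup.subset[OF H] by blast
qed

lemma normal_if_normalizing_all:
  assumes H: "subgroup H G" and "normalizing G H = carrier G"
  shows "H \<lhd> G"
  unfolding normal_inv_iff
proof (intro conjI ballI)
  fix x h assume xh: "x \<in> carrier G" "h \<in> H"
  then have "conj_by x ` H \<subseteq> H" using normalizing_iff[OF H] assms(2) by blast
  then show "x \<otimes> h \<otimes> inv x \<in> H" using xh by (auto simp: conj_by_def)
qed (use H in simp)

section \<open>Centralizers, conjugacy classes and orbit counting\<close>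

definition cent :: "'a \<Rightarrow> 'a set"
  where "cent x = {g \<in> carrier G. g \<otimes> x = x \<otimes> g}"

lemma subgroup_cent:
  assumes x: "x \<in> carrier G" shows "subgroup (cent x) G"
proof (rule subgroupI)
  show "cent x \<noteq> {}" using x by (auto simp: cent_def intro!: exI[of _ \<one>])
next
  fix a assume "a \<in> cent x"
  then have a: "a \<in> carrier G" "a \<otimes> x = x \<otimes> a" by (auto simp: cent_def)
  have "conj_by a x = x" using a x conj_by_eq_iff by blast
  then have "conj_by (inv a) x = x" using a x conj_by_inv_cancel(1) by metis
  then show "inv a \<in> cent x" using a x conj_by_eq_iff[of "inv a" x] by (simp add: cent_def)
next
  fix a b assume "a \<in> cent x" "b \<in> cent x"
  then have a: "a \<in> carrier G" "a \<otimes> x = x \<otimes> a" "b \<in> carrier G" "b \<otimes> x = x \<otimes> b" by (auto simp: cent_def)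
  have "a \<otimes> b \<otimes> x = x \<otimes> a \<otimes> b"
    using a x by (simp only: m_assoc m_closed) (simp only: a(2) m_assoc[symmetric] m_closed)
  then show "a \<otimes> b \<in> cent x" using a x by (simp add: cent_def m_assoc)
qed (auto simp: cent_def)

lemma cent_sym: "x \<in> carrier G \<Longrightarrow> y \<in> cent x \<Longrightarrow> x \<in> cent y"
  by (auto simp: cent_def)

text \<open>Orbit counting without a group action: \<open>f\<close> plays the orbit map and
  \<open>S\<close> the stabilizer, and the fibres of \<open>f\<close> are the left cosets of
  \<open>S\<close>. It serves both for conjugates of elements and for conjugates of
  subgroups.\<close>

lemma card_fibres:
  assumes S: "subgroup S G"
    and f: "\<And>g h. g \<in> carrier G \<Longrightarrow> h \<in> carrier G \<Longrightarrow> f g = f h \<longleftrightarrow> inv g \<otimes> h \<in> S"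
  shows "card (f ` carrier G) * card S = card (carrier G)"
proof -
  have fib: "card {h \<in> carrier G. f h = f g} = card S" if g: "g \<in> carrier G" for g
  proof -
    have "{h \<in> carrier G. f h = f g} = (\<lambda>s. g \<otimes> s) ` S"
    proof (intro equalityI subsetI)
      fix h assume "h \<in> {h \<in> carrier G. f h = f g}"
      then have h: "h \<in> carrier G" "inv g \<otimes> h \<in> S" using f[OF g, of h] by auto
      then have "h = g \<otimes> (inv g \<otimes> h)" using g by simp
      then show "h \<in> (\<lambda>s. g \<otimes> s) ` S" using h by blast
    next
      fix h assume "h \<in> (\<lambda>s. g \<otimes> s) ` S"
      then obtain s where s: "s \<in> S" "h = g \<otimes> s" by auto
      then have "s \<in> carrier G" using S subgroup.subset by blast
      then show "h \<in> {h \<in> carrier G. f h = f g}" using s g f[OF g, of h] by simp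
    qed
    moreover have "inj_on (\<lambda>s. g \<otimes> s) S"
      by (rule inj_onI) (use g subgroup.subset[OF S] l_cancel in blast)
    ultimately show ?thesis by (simp add: card_image)
  qed
  have "carrier G = (\<Union>y\<in>f ` carrier G. {h \<in> carrier G. f h = y})" by auto
  then have "card (carrier G) = card (\<Union>y\<in>f ` carrier G. {h \<in> carrier G. f h = y})" by simp
  also have "\<dots> = (\<Sum>y\<in>f ` carrier G. card {h \<in> carrier G. f h = y})"
    by (rule card_UN_disjoint) (use fin in auto)
  also have "\<dots> = (\<Sum>y\<in>f ` carrier G. card S)"
    by (rule sum.cong) (use fib in auto)
  finally show ?thesis by simp
qed

definition conj_class :: "'a \<Rightarrow> 'a set"
  where "conj_class x = (\<lambda>g. conj_by g x) ` carrier G"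

lemma conj_eq_conj_iff:
  assumes "g \<in> carrier G" "h \<in> carrier G" "x \<in> carrier G" "y \<in> carrier G"
  shows "conj_by g x = conj_by h y \<longleftrightarrow> x = conj_by (inv g \<otimes> h) y"
proof
  assume "conj_by g x = conj_by h y"
  then have "conj_by (inv g) (conj_by g x) = conj_by (inv g) (conj_by h y)" by simp
  then show "x = conj_by (inv g \<otimes> h) y" using assms by (simp add: conj_by_conj_by)
next
  assume "x = conj_by (inv g \<otimes> h) y"
  then have "conj_by g x = conj_by g (conj_by (inv g \<otimes> h) y)" by simp
  then show "conj_by g x = conj_by h y" using assms by (simp add: conj_by_conj_by)
qed

lemma card_conj_class:
  assumes x: "x \<in> carrier G"
  shows "card (conj_class x) * card (cent x) = card (carrier G)"
  unfolding conj_class_def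
proof (rule card_fibres[OF subgroup_cent[OF x]])
  fix g h assume gh: "g \<in> carrier G" "h \<in> carrier G"
  have "conj_by g x = conj_by h x \<longleftrightarrow> conj_by (inv g \<otimes> h) x = x"
    using conj_eq_conj_iff[OF gh x x] by auto
  then show "conj_by g x = conj_by h x \<longleftrightarrow> inv g \<otimes> h \<in> cent x"
    using gh x conj_by_eq_iff[of "inv g \<otimes> h" x] by (simp add: cent_def)
qed

lemma card_conj_subgroups:
  assumes H: "subgroup H G"
  shows "card ((\<lambda>g. conj_by g ` H) ` carrier G) * card (normalizing G H) = card (carrier G)"
proof (rule card_fibres[OF subgroup_normalizing[OF H]])
  fix g h assume gh: "g \<in> carrier G" "h \<in> carrier G"
  have sub: "H \<subseteq> carrier G" using H subgroup.subset by blast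
  have "conj_by g ` H = conj_by h ` H \<longleftrightarrow> conj_by (inv g) ` conj_by g ` H = conj_by (inv g) ` conj_by h ` H"
    by (rule inj_on_image_eq_iff[OF conj_by_inj[of "inv g"], symmetric]) (use gh sub in auto)
  also have "conj_by (inv g) ` conj_by g ` H = H"
    unfolding image_image using gh sub by force
  also have "conj_by (inv g) ` conj_by h ` H = conj_by (inv g \<otimes> h) ` H"
    unfolding image_image by (rule image_cong) (use gh sub conj_by_conj_by in auto)
  finally show "conj_by g ` H = conj_by h ` H \<longleftrightarrow> inv g \<otimes> h \<in> normalizing G H"
    using normalizing_conj_image[OF H, of "inv g \<otimes> h"] gh by auto
qed

lemma conj_class_self: "x \<in> carrier G \<Longrightarrow> x \<in> conj_class x"
  unfolding conj_class_def by (rule image_eqI[of _ _ \<one>]) auto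

lemma conj_class_subset: "x \<in> carrier G \<Longrightarrow> conj_class x \<subseteq> carrier G"
  unfolding conj_class_def by auto

lemma conj_class_eq:
  assumes x: "x \<in> carrier G" and y: "y \<in> conj_class x"
  shows "conj_class y = conj_class x"
proof -
  obtain g where g: "g \<in> carrier G" "y = conj_by g x" using y by (auto simp: conj_class_def)
  have "conj_by k y = conj_by (k \<otimes> g) x" if "k \<in> carrier G" for k
    using g x that conj_by_conj_by by simp
  then have 1: "conj_class y \<subseteq> conj_class x" using g by (auto simp: conj_class_def)
  have "conj_by k x = conj_by (k \<otimes> inv g) y" if "k \<in> carrier G" for k
    using g x that by (simp add: conj_by_conj_by m_assoc)
  moreover have "k \<otimes> inv g \<in> carrier G" if "k \<in> carrier G" for k using g that by simp
  ultimately have "conj_class x \<subseteq> conj_class y" unfolding conj_class_def by blast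
  then show ?thesis using 1 by simp
qed

text \<open>By the class equation: the size of a noncentral class is a power of p other than 1, so p
  divides the order of the centre \<open>Z\<close>. A subgroup of order p inside the centre is
  normal.\<close>

lemma prime_power_order_normal_subgroup:
  assumes p: "Factorial_Ring.prime p" and card: "card (carrier G) = p ^ a" "a \<ge> 1"
  shows "\<exists>H. H \<lhd> G \<and> card H = p"
proof -
  define Z where "Z = {z \<in> carrier G. \<forall>g\<in>carrier G. g \<otimes> z = z \<otimes> g}"
  have Zcent: "Z = {z \<in> carrier G. cent z = carrier G}" by (auto simp: Z_def cent_def)
  have Z: "subgroup Z G"
  proof -
    have "Z = \<Inter> (cent ` carrier G)"
      by (auto simp: Z_def cent_def)
    moreover have "subgroup (\<Inter> (cent ` carrier G)) G"
      by (rule subgroups_Inter) (use subgroup_cent in auto)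
    ultimately show ?thesis by simp
  qed
  define W where "W = carrier G - Z"
  let ?C = "conj_class ` W"
  have WU: "\<Union> ?C = W"
  proof (intro equalityI subsetI)
    fix y assume "y \<in> \<Union> ?C"
    then obtain x where x: "x \<in> W" "y \<in> conj_class x" by auto
    have xc: "x \<in> carrier G" using x W_def by auto
    have yc: "y \<in> carrier G" using x conj_class_subset[OF xc] by auto
    have "y \<notin> Z"
    proof
      assume "y \<in> Z"
      then have "conj_by g y = y" if "g \<in> carrier G" for g
        using that yc conj_by_eq_iff by (auto simp: Z_def)
      then have "conj_class y = {y}" using yc unfolding conj_class_def by auto
      then have "x = y" using conj_class_eq[OF xc x(2)] conj_class_self[OF xc] by auto
      then show False using x \<open>y \<in> Z\<close> by (simp add: W_def)
    qed
    then show "y \<in> W" using yc by (simp add: W_def)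
  next
    fix y assume "y \<in> W" then show "y \<in> \<Union> ?C" using conj_class_self by (auto simp: W_def)
  qed
  have "p dvd card C" if C: "C \<in> ?C" for C
  proof -
    obtain x where x: "x \<in> W" "C = conj_class x" using C by auto
    then have xc: "x \<in> carrier G" by (simp add: W_def)
    have prod: "card C * card (cent x) = p ^ a" using card_conj_class[OF xc] x card by simp
    have "card (cent x) \<noteq> card (carrier G)"
    proof
      assume "card (cent x) = card (carrier G)"
      then have "cent x = carrier G" using fin card_subset_eq[of "carrier G" "cent x"] by (auto simp: cent_def)
      then show False using x xc by (simp add: W_def Zcent)
    qed
    then have "card C \<noteq> 1" using prod card by auto
    moreover obtain i where "card C = p ^ i" using prod divides_primepow_nat[OF p] by (metis dvd_triv_left)
    ultimately show ?thesis by (cases i) auto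
  qed
  then have "p dvd (\<Sum>C\<in>?C. card C)" by (rule dvd_sum)
  also have "(\<Sum>C\<in>?C. card C) = card (\<Union> ?C)"
  proof (rule card_Union_disjoint[symmetric])
    show "pairwise disjnt ?C" unfolding pairwise_def disjnt_def
    proof (intro ballI impI)
      fix A B assume "A \<in> ?C" "B \<in> ?C" "A \<noteq> B"
      then obtain x y where "A = conj_class x" "B = conj_class y" "x \<in> carrier G" "y \<in> carrier G"
        by (auto simp: W_def)
      then show "A \<inter> B = {}" using \<open>A \<noteq> B\<close> conj_class_eq by blast
    qed
  next
    fix A assume "A \<in> ?C"
    then have "A \<subseteq> W" using WU by blast
    then show "finite A" using fin by (auto simp: W_def intro: finite_subset)
  qed
  finally have "p dvd card W" using WU by simp
  moreover have "card (carrier G) = card Z + card W"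
    unfolding W_def using subgroup.subset[OF Z] fin finite_subgroup[OF Z]
    by (simp add: card_Diff_subset card_mono)
  moreover have "p dvd card (carrier G)" using card by (simp add: dvd_power)
  ultimately have "p dvd card Z" by (metis dvd_add_left_iff)
  then obtain H where H: "subgroup H G" "H \<subseteq> Z" "card H = p"
    using cauchy_subgroup[OF Z p] by blast
  have "normalizing G H = carrier G"
  proof (rule equalityI[OF normalizing_subset subsetI])
    fix g assume g: "g \<in> carrier G"
    have "conj_by g h = h" if "h \<in> H" for h
      using that H(2) g conj_by_eq_iff by (auto simp: Z_def)
    then have "conj_by g ` H \<subseteq> H" by auto
    then show "g \<in> normalizing G H" using normalizing_iff[OF H(1) g] by simp
  qed
  then show ?thesis using normal_if_normalizing_all[OF H(1)] H(3) by blast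
qed

section \<open>Normalizers of subgroups of prime order\<close>

lemma prime_order_generate:
  assumes H: "subgroup H G" "card H = p" "Factorial_Ring.prime p" and x: "x \<in> H" "x \<noteq> \<one>"
  shows "H = generate G {x}"
proof -
  have xc: "x \<in> carrier G" using H x subgroup.subset by blast
  have g: "subgroup (generate G {x}) G" by (rule generate_is_subgroup) (use xc in auto)
  have sub: "generate G {x} \<subseteq> H" by (rule generate_subgroup_incl) (use H x in auto)
  have "card (generate G {x}) dvd p" using card_subgroup_dvd_subgroup[OF g H(1) sub] H(2) by simp
  moreover have "card (generate G {x}) \<noteq> 1"
    using generate_pow_card[OF xc] ord_eq_1[OF xc] x by simp
  ultimately have "card (generate G {x}) = card H" using H(2,3) by (auto simp: prime_nat_iff)
  then show ?thesis using sub finite_subgroup[OF H(1)] card_subset_eq by blast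
qed

lemma nontrivial_element:
  assumes "subgroup H G" "card H = p" "p > 1"
  obtains x where "x \<in> H" "x \<noteq> \<one>" "x \<in> carrier G"
proof -
  have "H \<noteq> {\<one>}" using assms by auto
  then obtain x where "x \<in> H" "x \<noteq> \<one>" using subgroup.one_closed[OF assms(1)] by blast
  then show ?thesis using that subgroup.subset[OF assms(1)] by blast
qed

text \<open>One nontrivial element decides, because it generates \<open>H\<close>: if g x g^-1 is in
  \<open>H\<close>, then \<open>H\<close> lies in the conjugate of \<open>H\<close> by g^-1, which
  has the same order.\<close>

lemma normalizing_prime_order_iff:
  assumes H: "subgroup H G" "card H = p" "Factorial_Ring.prime p" and x: "x \<in> H" "x \<noteq> \<one>"
    and g: "g \<in> carrier G"
  shows "g \<in> normalizing G H \<longleftrightarrow> conj_by g x \<in> H"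
proof
  assume "g \<in> normalizing G H"
  then show "conj_by g x \<in> H" using normalizing_iff[OF H(1) g] x by blast
next
  assume gx: "conj_by g x \<in> H"
  have xc: "x \<in> carrier G" using H x subgroup.subset by blast
  have "subgroup (conj_by (inv g) ` H) G" using conj_subgroup(1)[OF H(1)] g by simp
  moreover have "x \<in> conj_by (inv g) ` H" using gx g xc by (metis conj_by_inv_cancel(1) imageI)
  ultimately have "generate G {x} \<subseteq> conj_by (inv g) ` H"
    using generate_subgroup_incl[of "{x}"] by simp
  then have "H \<subseteq> conj_by (inv g) ` H" using prime_order_generate[OF H x] by simp
  moreover have "card (conj_by (inv g) ` H) = card H" using conj_subgroup(2)[OF H(1)] g by simp
  ultimately have "conj_by (inv g) ` H = H"
    by (metis card_subset_eq finite_imageI finite_subgroup[OF H(1)])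
  then have "inv g \<in> normalizing G H" using normalizing_conj_image[OF H(1), of "inv g"] g by simp
  then show "g \<in> normalizing G H"
    using subgroup.m_inv_closed[OF subgroup_normalizing[OF H(1)]] g by fastforce
qed

lemma cent_subset_normalizing:
  assumes H: "subgroup H G" "card H = p" "Factorial_Ring.prime p" and x: "x \<in> H" "x \<noteq> \<one>"
  shows "cent x \<subseteq> normalizing G H"
proof
  fix g assume g: "g \<in> cent x"
  then have gc: "g \<in> carrier G" by (simp add: cent_def)
  have xc: "x \<in> carrier G" using H x subgroup.subset by blast
  have "conj_by g x = x" using g gc xc conj_by_eq_iff by (simp add: cent_def)
  then show "g \<in> normalizing G H" using normalizing_prime_order_iff[OF H x gc] x by simp
qed

text \<open>Conjugation within {1, i} can only fix i, so normalizer and centralizer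
  coincide.\<close>

lemma order_2_subgroup:
  assumes H: "subgroup H G" "card H = 2"
  obtains i where "i \<in> carrier G" "i \<noteq> \<one>" "i \<otimes> i = \<one>" "H = {\<one>, i}" "normalizing G H = cent i"
proof -
  obtain i where i: "i \<in> H" "i \<noteq> \<one>" "i \<in> carrier G" using nontrivial_element[OF H] by auto
  have "{\<one>, i} \<subseteq> H" using i subgroup.one_closed[OF H(1)] by auto
  then have Hi: "H = {\<one>, i}" using H i finite_subgroup[OF H(1)] card_subset_eq[of H "{\<one>, i}"] by auto
  have "i \<otimes> i \<in> H" using i subgroup.m_closed[OF H(1)] by blast
  then have ii: "i \<otimes> i = \<one>" using i Hi by (metis insertE r_one l_cancel one_closed singletonD)
  have p: "Factorial_Ring.prime (2::nat)" by simp
  have "normalizing G H \<subseteq> cent i"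
  proof
    fix g assume g: "g \<in> normalizing G H"
    then have gc: "g \<in> carrier G" using normalizing_subset by blast
    have "conj_by g i \<in> H" using normalizing_prime_order_iff[OF H p i(1,2) gc] g by simp
    moreover have "conj_by g i \<noteq> \<one>" using i gc conj_by_eq_one_iff by simp
    ultimately have "conj_by g i = i" using Hi by auto
    then show "g \<in> cent i" using gc i conj_by_eq_iff by (simp add: cent_def)
  qed
  then have "normalizing G H = cent i" using cent_subset_normalizing[OF H p i(1,2)] by blast
  then show ?thesis using that i ii Hi by blast
qed

text \<open>The normalizer of \<open>H\<close> is the centralizer of its involution, so a subgroup
  \<open>P\<close> of order p inside it is centralized by the involution. This carries information
  about order 2 over to the normalizer of a subgroup of odd order.\<close>

lemma involution_normalizes:
  assumes H: "subgroup H G" "card H = 2" and p: "Factorial_Ring.prime p" "p dvd card (normalizing G H)"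
  obtains P where "subgroup P G" "card P = p" "P \<subseteq> normalizing G H" "2 dvd card (normalizing G P)"
proof -
  obtain i where i: "i \<in> carrier G" "i \<noteq> \<one>" "i \<otimes> i = \<one>" "H = {\<one>, i}" "normalizing G H = cent i"
    using order_2_subgroup[OF H] by blast
  obtain P where P: "subgroup P G" "P \<subseteq> normalizing G H" "card P = p"
    using cauchy_subgroup[OF subgroup_normalizing[OF H(1)] p] by blast
  have "conj_by i x = x" if "x \<in> P" for x
    using that P(2) i(1,5) conj_by_eq_iff[of i x] by (auto simp: cent_def)
  then have "i \<in> normalizing G P" using normalizing_iff[OF P(1) i(1)] by auto
  then have "H \<subseteq> normalizing G P" using i(4) subgroup.one_closed[OF subgroup_normalizing[OF P(1)]] by auto
  then have "2 dvd card (normalizing G P)"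
    using card_subgroup_dvd_subgroup[OF H(1) subgroup_normalizing[OF P(1)]] H(2) by simp
  then show ?thesis using that P by blast
qed

end

section \<open>Groups without normal subgroups of prime order\<close>

text \<open>The situation left once no further normal subgroup of prime order can be factored out.
  All order computations happen here and aim at producing A4.\<close>

locale no_prime_normal_group = fin_group +
  assumes tp_gt: "tp G > (1/2)^8"
    and nontrivial: "card (carrier G) > 1"
    and no_prime_normal: "\<And>H. H \<lhd> G \<Longrightarrow> \<not> Factorial_Ring.prime (card H)"
begin

text \<open>\<open>k \<ge> 1\<close> because k = 0 would make \<open>H\<close> normal. Since |N(H)|
  divides |G|, it also divides p^2 k, so the conclusion is a finite arithmetic search for each
  prime.\<close>

lemma prime_order_normalizing:
  assumes H: "subgroup H G" "card H = p" "Factorial_Ring.prime p"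
  shows "\<exists>k\<ge>1. card (carrier G) = card (normalizing G H) + p\<^sup>2 * k \<and>
      card (normalizing G H) dvd card (carrier G) \<and> p dvd card (normalizing G H) \<and>
      (p = 2 \<and> k \<le> 7 \<or> p = 3 \<and> k \<le> 3 \<or> p = 5 \<and> k = 1 \<or> p = 7 \<and> k = 1)"
proof -
  obtain k where k: "card (carrier G) = card (normalizing G H) + p\<^sup>2 * k"
    "k = 0 \<or> p = 2 \<and> k \<le> 7 \<or> p = 3 \<and> k \<le> 3 \<or> p = 5 \<and> k = 1 \<or> p = 7 \<and> k = 1"
    using prime_order_bound[OF fin tp_gt H] by blast
  have "k \<noteq> 0"
  proof
    assume "k = 0"
    then have "normalizing G H = carrier G"
      using k(1) card_subset_eq[OF fin normalizing_subset, of H] by simp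
    then show False using normal_if_normalizing_all[OF H(1)] no_prime_normal H by blast
  qed
  moreover have "card (normalizing G H) dvd card (carrier G)"
    using card_subgroup_dvd subgroup_normalizing H(1) by blast
  moreover have "p dvd card (normalizing G H)"
    using card_subgroup_dvd_subgroup[OF H(1) subgroup_normalizing[OF H(1)] subset_normalizing[OF H(1)]] H(2)
    by simp
  ultimately show ?thesis using k by (intro exI[of _ k]) auto
qed

lemma order_2_normalizing:
  assumes "subgroup H G" "card H = 2"
  shows "\<exists>k\<ge>1. k \<le> 7 \<and> card (carrier G) = card (normalizing G H) + 4 * k \<and>
      card (normalizing G H) dvd card (carrier G) \<and> 2 dvd card (normalizing G H)"
  using prime_order_normalizing[OF assms] by auto

text \<open>Write |N(H)| = 3m. Then m divides 3k with k among 1, 2, 3, and the nine listed pairs are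
  (9k + 3m, 3m) for the nine solutions.\<close>

lemma order_3_normalizing:
  assumes "subgroup H G" "card H = 3"
  shows "(card (carrier G), card (normalizing G H)) \<in>
    {(12,3), (18,9), (21,3), (24,6), (27,9), (36,18), (30,3), (36,9), (54,27)}"
proof -
  let ?n = "card (normalizing G H)"
  have "Factorial_Ring.prime (3::nat)" by simp
  then obtain k where k: "k \<ge> 1" "k \<le> 3" "card (carrier G) = ?n + 9 * k"
     "?n dvd card (carrier G)" "3 dvd ?n"
    using prime_order_normalizing[OF assms] by auto
  have "?n dvd 9 * k" using k(3,4) by (metis dvd_add_right_iff dvd_refl)
  moreover obtain m where m: "?n = 3 * m" using k(5) by auto
  ultimately have md: "m dvd 3 * k" using nat_mult_dvd_cancel_disj[of 3 m "3 * k"] by simp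
  have "m \<le> 9" using dvd_imp_le[OF md] k by simp
  moreover have "m \<noteq> 0"
  proof
    assume "m = 0"
    then have "3 * k = 0" using md by (simp only: dvd_0_left_iff)
    then show False using k(1) by simp
  qed
  ultimately have "m \<in> {1,2,3,4,5,6,7,8,9}" by auto
  moreover have "k \<in> {1,2,3}" using k by auto
  ultimately have "(m, k) \<in> {(1,1), (3,1), (1,2), (2,2), (3,2), (6,2), (1,3), (3,3), (9,3)}"
    using md by (elim insertE emptyE) simp_all
  then have "(3 * m + 9 * k, 3 * m) \<in>
    {(12,3), (18,9), (21,3), (24,6), (27,9), (36,18), (30,3), (36,9), (54,27)}"
    by (elim insertE emptyE) simp_all
  then show ?thesis unfolding k(3) m .
qed

text \<open>Here k = 1 is forced, so |N(H)| is a multiple of 5 dividing 25. The prime 7 behaves in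
  the same way.\<close>

lemma order_5_normalizing:
  assumes "subgroup H G" "card H = 5"
  shows "(card (carrier G), card (normalizing G H)) \<in> {(30,5), (50,25)}"
proof -
  let ?n = "card (normalizing G H)"
  have "Factorial_Ring.prime (5::nat)" by simp
  then have k: "card (carrier G) = ?n + 25" "?n dvd card (carrier G)" "5 dvd ?n"
    using prime_order_normalizing[OF assms] by auto
  have "?n dvd 25" using k by (metis dvd_add_right_iff dvd_refl)
  moreover obtain m where m: "?n = 5 * m" using k by auto
  ultimately have md: "m dvd 5" using nat_mult_dvd_cancel_disj[of 5 m 5] by simp
  then have "m \<le> 5" "m \<noteq> 0" using dvd_imp_le[OF md] by (auto intro: Nat.gr0I)
  then have "m \<in> {1,2,3,4,5}" by auto
  then show ?thesis using md k m by auto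
qed

lemma order_7_normalizing:
  assumes "subgroup H G" "card H = 7"
  shows "(card (carrier G), card (normalizing G H)) \<in> {(56,7), (98,49)}"
proof -
  let ?n = "card (normalizing G H)"
  have "Factorial_Ring.prime (7::nat)" by simp
  then have k: "card (carrier G) = ?n + 49" "?n dvd card (carrier G)" "7 dvd ?n"
    using prime_order_normalizing[OF assms] by auto
  have "?n dvd 49" using k by (metis dvd_add_right_iff dvd_refl)
  moreover obtain m where m: "?n = 7 * m" using k by auto
  ultimately have md: "m dvd 7" using nat_mult_dvd_cancel_disj[of 7 m 7] by simp
  then have "m \<le> 7" "m \<noteq> 0" using dvd_imp_le[OF md] by (auto intro: Nat.gr0I)
  then have "m \<in> {1,2,3,4,5,6,7}" by auto
  then show ?thesis using md k m by auto
qed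

section \<open>Candidate orders and their elimination\<close>

lemma cauchy:
  assumes "Factorial_Ring.prime p" "p dvd card (carrier G)"
  obtains H where "subgroup H G" "card H = p"
  using cauchy_subgroup[OF subgroup_self assms] that by blast

lemma not_prime_power: "Factorial_Ring.prime p \<Longrightarrow> card (carrier G) \<noteq> p ^ a"
  using prime_power_order_normal_subgroup[of p a] no_prime_normal nontrivial
  by (metis One_nat_def less_numeral_extra(4) not_less_eq_eq power_0 le0 Suc_leI gr0I)

text \<open>The order is not a power of 2, so an odd prime divides it, necessarily 3, 5 or 7, and
  the tables apply. Of their orders, 21 fails the table for 7 and 27 is a prime power.\<close>

lemma possible_orders: "card (carrier G) \<in> {12, 18, 24, 30, 36, 50, 54, 56, 98}"
proof -
  let ?n = "card (carrier G)"
  have p2: "Factorial_Ring.prime (2::nat)" and p7: "Factorial_Ring.prime (7::nat)"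
    and p3: "Factorial_Ring.prime (3::nat)" by simp_all
  have "?n \<noteq> 0" using nontrivial by simp
  then obtain a m where am: "?n = 2 ^ a * m" "\<not> 2 dvd m"
    using multiplicity_decompose'[of ?n "2::nat"] p2
    by (metis not_prime_unit mult.commute)
  have "m \<noteq> 1" using am(1) not_prime_power[OF p2, of a] by auto
  then obtain p where p: "Factorial_Ring.prime p" "p dvd m" using prime_factor_nat by blast
  then have "p \<noteq> 2" "p dvd ?n" using am by auto
  obtain H where H: "subgroup H G" "card H = p" using cauchy p(1) \<open>p dvd ?n\<close> by blast
  have "p = 3 \<or> p = 5 \<or> p = 7" using prime_order_normalizing[OF H p(1)] \<open>p \<noteq> 2\<close> by auto
  then have "?n \<in> {12,18,21,24,27,36,30,54,50,56,98}"
    using order_3_normalizing[of H] order_5_normalizing[of H] order_7_normalizing[of H] H by auto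
  moreover have "?n \<noteq> 21"
  proof
    assume n: "?n = 21"
    then obtain K where "subgroup K G" "card K = 7" using cauchy[OF p7] by auto
    then show False using order_7_normalizing n by fastforce
  qed
  moreover have "?n \<noteq> 27" using not_prime_power[OF p3, of 3] by simp
  ultimately show ?thesis by auto
qed

lemma order_not_50_54_98: "card (carrier G) \<notin> {50, 54, 98}"
proof
  assume n: "card (carrier G) \<in> {50, 54, 98}"
  then have "2 dvd card (carrier G)" by auto
  then obtain H where H: "subgroup H G" "card H = 2" using cauchy[of 2] by auto
  let ?n = "card (normalizing G H)"
  obtain k where k: "1 \<le> k" "k \<le> 7" "card (carrier G) = ?n + 4 * k" "?n dvd card (carrier G)"
    using order_2_normalizing[OF H] by auto
  have "?n dvd 4 * k" using k(3,4) by (metis dvd_add_right_iff dvd_refl)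
  \<comment> \<open>With k \<le> 7 this bounds |G| by 56 and removes 98. For 50 and 54 none of the
    differences |G| - 4k divides |G|.\<close>
  then have "?n \<le> 4 * k" using dvd_imp_le k by simp
  then have "card (carrier G) \<le> 56" using k by simp
  moreover have "k \<in> {1,2,3,4,5,6,7}" using k by auto
  ultimately show False using n k(3,4) by auto
qed

text \<open>56 is the extreme case of |N(H)| \<le> 4k \<le> 28, so an involution has a centralizer
  of order 28. This contains a subgroup of order 7, whose normalizer would be even, whereas the
  table gives 7.\<close>

lemma order_not_56: "card (carrier G) \<noteq> 56"
proof
  assume n: "card (carrier G) = 56"
  then obtain H where H: "subgroup H G" "card H = 2" using cauchy[of 2] by auto
  let ?n = "card (normalizing G H)"
  obtain k where k: "1 \<le> k" "k \<le> 7" "card (carrier G) = ?n + 4 * k" "?n dvd card (carrier G)"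
    using order_2_normalizing[OF H] by auto
  have "?n dvd 4 * k" using k(3,4) by (metis dvd_add_right_iff dvd_refl)
  then have "?n \<le> 4 * k" using dvd_imp_le k by simp
  then have "?n = 28" using n k by simp
  then have "7 dvd ?n" by simp
  then obtain P where P: "subgroup P G" "card P = 7" "2 dvd card (normalizing G P)"
    using involution_normalizes[OF H, of 7] by auto
  then show False using order_7_normalizing[OF P(1,2)] n by auto
qed

text \<open>The conjugacy classes of elements of order 2, 3 and 5 would have at least 15, 10 and 6 elements.\<close>

lemma order_not_30: "card (carrier G) \<noteq> 30"
proof
  assume n: "card (carrier G) = 30"
  have p: "Factorial_Ring.prime (2::nat)" "Factorial_Ring.prime (3::nat)" "Factorial_Ring.prime (5::nat)" by simp_all
  obtain H where H: "subgroup H G" "card H = 2" using cauchy[of 2] n by auto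
  obtain S where S: "subgroup S G" "card S = 3" using cauchy[of 3] n by auto
  obtain T where T: "subgroup T G" "card T = 5" using cauchy[of 5] n by auto
  let ?n = "card (normalizing G H)"
  have n3: "card (normalizing G P) = 3" if "subgroup P G" "card P = 3" for P
    using order_3_normalizing[OF that] n by auto
  have n5: "card (normalizing G P) = 5" if "subgroup P G" "card P = 5" for P
    using order_5_normalizing[OF that] n by auto
  \<comment> \<open>Among the numbers 30 - 4k only 10, 6 and 2 divide 30. The first two would put an
    element of order 5 or 3 into the centralizer of an involution and make the normalizer of its
    subgroup even, against \<open>n5\<close> and \<open>n3\<close>.\<close>
  have n2: "?n = 2"
  proof -
    obtain k where k: "1 \<le> k" "k \<le> 7" "card (carrier G) = ?n + 4 * k" "?n dvd card (carrier G)"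
      using order_2_normalizing[OF H] by auto
    have "\<not> 3 dvd ?n"
    proof
      assume "3 dvd ?n"
      then obtain P where "subgroup P G" "card P = 3" "2 dvd card (normalizing G P)"
        using involution_normalizes[OF H, of 3] by auto
      then show False using n3 by auto
    qed
    moreover have "\<not> 5 dvd ?n"
    proof
      assume "5 dvd ?n"
      then obtain P where "subgroup P G" "card P = 5" "2 dvd card (normalizing G P)"
        using involution_normalizes[OF H, of 5] by auto
      then show False using n5 by auto
    qed
    moreover have "k \<in> {1,2,3,4,5,6,7}" using k by auto
    ultimately show ?thesis using n k(3,4) by auto
  qed
  \<comment> \<open>The centralizer of z lies in the normalizer of Q, so the class of z has at least
    30/m elements; all of them generate conjugates of Q and thus have order q.\<close>
  have big: "card (conj_class z) * m \<ge> 30 \<and> conj_class z \<subseteq> {w \<in> carrier G. ord w = q} "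
    if "subgroup Q G" "card Q = q" "Factorial_Ring.prime q" "z \<in> Q" "z \<noteq> \<one>" "card (normalizing G Q) = m"
    for Q q z m
  proof
    have zc: "z \<in> carrier G" using that subgroup.subset by blast
    have "card (cent z) \<le> m"
      using cent_subset_normalizing[OF that(1-5)] that(6) card_mono
        finite_subset[OF normalizing_subset fin] by blast
    then show "card (conj_class z) * m \<ge> 30"
      using card_conj_class[OF zc] n mult_le_mono2 by metis
    show "conj_class z \<subseteq> {w \<in> carrier G. ord w = q}"
    proof
      fix w assume "w \<in> conj_class z"
      then obtain g where g: "g \<in> carrier G" "w = conj_by g z" by (auto simp: conj_class_def)
      have R: "subgroup (conj_by g ` Q) G" "card (conj_by g ` Q) = q"
        using conj_subgroup[OF that(1) g(1)] that(2) by auto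
      have "w \<in> conj_by g ` Q" using g that by auto
      moreover have "w \<noteq> \<one>" using g zc that(5) conj_by_eq_one_iff by simp
      ultimately have "conj_by g ` Q = generate G {w}" using prime_order_generate[OF R that(3)] by blast
      moreover have "w \<in> carrier G" using g zc by simp
      ultimately show "w \<in> {w \<in> carrier G. ord w = q}" using R(2) generate_pow_card by simp
    qed
  qed
  obtain i where i: "i \<in> H" "i \<noteq> \<one>" using nontrivial_element[OF H] by auto
  obtain x where x: "x \<in> S" "x \<noteq> \<one>" using nontrivial_element[OF S] by auto
  obtain y where y: "y \<in> T" "y \<noteq> \<one>" using nontrivial_element[OF T] by auto
  note ci = big[OF H p(1) i n2] and cx = big[OF S p(2) x n3[OF S]] and cy = big[OF T p(3) y n5[OF T]]
  \<comment> \<open>Different element orders make the three classes disjoint, and 15 + 10 + 6 = 31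
    exceeds 30.\<close>
  have "card (conj_class i \<union> conj_class x \<union> conj_class y) =
      card (conj_class i) + card (conj_class x) + card (conj_class y)"
  proof -
    have f: "finite (conj_class i)" "finite (conj_class x)" "finite (conj_class y)"
      using fin by (simp_all add: conj_class_def)
    have e: "w \<in> conj_class i \<Longrightarrow> ord w = 2" "w \<in> conj_class x \<Longrightarrow> ord w = 3"
      "w \<in> conj_class y \<Longrightarrow> ord w = 5" for w using ci cx cy by blast+
    have d: "conj_class i \<inter> conj_class x = {}" "(conj_class i \<union> conj_class x) \<inter> conj_class y = {}"
    proof -
      have "False" if "w \<in> conj_class i" "w \<in> conj_class x" for w
        using e(1)[OF that(1)] e(2)[OF that(2)] by simp
      moreover have "False" if "w \<in> conj_class i" "w \<in> conj_class y" for w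
        using e(1)[OF that(1)] e(3)[OF that(2)] by simp
      moreover have "False" if "w \<in> conj_class x" "w \<in> conj_class y" for w
        using e(2)[OF that(1)] e(3)[OF that(2)] by simp
      ultimately show "conj_class i \<inter> conj_class x = {}" "(conj_class i \<union> conj_class x) \<inter> conj_class y = {}"
        by blast+
    qed
    show ?thesis using f d by (simp add: card_Un_disjoint)
  qed
  moreover have "card (conj_class i \<union> conj_class x \<union> conj_class y) \<le> 30"
    unfolding n[symmetric] by (rule card_mono[OF fin]) (use ci cx cy in auto)
  ultimately show False using ci cx cy by linarith
qed

lemma order_3_element:
  assumes "subgroup P G" "card P = 3" "x \<in> P" "x \<noteq> \<one>"
  shows "x \<in> carrier G" "x \<otimes> x \<otimes> x = \<one>" "P = {\<one>, x, x \<otimes> x}"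
proof -
  show xc: "x \<in> carrier G" using assms subgroup.subset by blast
  have "ord x = 3" using prime_order_generate[OF assms(1,2) _ assms(3,4)] generate_pow_card[OF xc] assms(2) by simp
  then have "x [^] (3::nat) = \<one>" using pow_ord_eq_1[OF xc] by simp
  then show x3: "x \<otimes> x \<otimes> x = \<one>" using xc by (simp add: numeral_3_eq_3)
  have "\<one> \<in> P" "x \<otimes> x \<in> P" using assms subgroup.one_closed subgroup.m_closed by metis+
  moreover have "x \<otimes> x \<noteq> x" "x \<otimes> x \<noteq> \<one>" using x3 xc assms(4) by auto
  ultimately have "{\<one>, x, x \<otimes> x} \<subseteq> P" "card {\<one>, x, x \<otimes> x} = 3" using assms(3,4) by auto
  then show "P = {\<one>, x, x \<otimes> x}" using card_subset_eq[OF finite_subgroup[OF assms(1)]] assms(2) by metis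
qed

lemma order_3_subgroup:
  assumes x: "x \<in> carrier G" "x \<noteq> \<one>" "x \<otimes> x \<otimes> x = \<one>"
  shows "subgroup (generate G {x}) G" "card (generate G {x}) = 3" "x \<in> generate G {x}"
proof -
  show "subgroup (generate G {x}) G" by (rule generate_is_subgroup) (use x in auto)
  show "x \<in> generate G {x}" by (rule generate.incl) simp
  have "x [^] (3::nat) = \<one>" using x by (simp add: numeral_3_eq_3)
  then have "ord x dvd 3" using pow_eq_id x(1) by blast
  moreover have "ord x \<noteq> 1" using ord_eq_1 x by blast
  moreover have "Factorial_Ring.prime (3::nat)" by simp
  ultimately have "ord x = 3" by (auto simp: prime_nat_iff)
  then show "card (generate G {x}) = 3" using generate_pow_card[OF x(1)] by simp
qed

text \<open>If z is outside \<open>N\<close>, then G is the union of \<open>N\<close> and z N, and z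
  z in z N would put z into \<open>N\<close>. This replaces the passage to a quotient of order
  2.\<close>

lemma square_in_index_2:
  assumes N: "subgroup N G" "card (carrier G) = 2 * card N" and z: "z \<in> carrier G"
  shows "z \<otimes> z \<in> N"
proof (cases "z \<in> N")
  case True then show ?thesis using N subgroup.m_closed by metis
next
  case False
  interpret finite_group_subgroup G N
    using N fin by (simp add: finite_group_subgroup_def finite_group_subgroup_axioms_def is_group)
  have fN: "finite N" "finite (z <# N)" using finH by (auto simp: l_coset_def)
  have "N \<inter> (z <# N) = {}"
  proof (rule ccontr)
    assume "N \<inter> (z <# N) \<noteq> {}"
    then obtain n where n: "n \<in> N" "z \<otimes> n \<in> N" by (auto simp: l_coset_def)
    then have "z \<otimes> n \<otimes> inv n \<in> N" by simp
    then show False using False n z by (simp add: m_assoc)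
  qed
  then have "card (N \<union> (z <# N)) = card (carrier G)"
    using fN card_l_coset[OF z] N(2) by (simp add: card_Un_disjoint)
  then have U: "N \<union> (z <# N) = carrier G"
    using card_subset_eq[OF fin, of "N \<union> (z <# N)"] subset z by (auto simp: l_coset_def)
  show ?thesis
  proof (rule ccontr)
    assume "z \<otimes> z \<notin> N"
    then have "z \<otimes> z \<in> z <# N" using U z by blast
    then obtain n where "n \<in> N" "z \<otimes> z = z \<otimes> n" by (auto simp: l_coset_def)
    then show False using False z by simp
  qed
qed

text \<open>Conjugation by w sends a generator x to x or to x^2, so applying it twice fixes
  x.\<close>

lemma square_centralizes:
  assumes P: "subgroup P G" "card P = 3" "x \<in> P" "x \<noteq> \<one>" and w: "w \<in> normalizing G P"
  shows "w \<otimes> w \<otimes> x = x \<otimes> (w \<otimes> w)"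
proof -
  have wc: "w \<in> carrier G" using w normalizing_subset by blast
  note x = order_3_element[OF P]
  have "conj_by w x \<in> P" using normalizing_iff[OF P(1) wc] w P(3) by blast
  moreover have "conj_by w x \<noteq> \<one>" using conj_by_eq_one_iff wc x(1) P(4) by blast
  ultimately consider "conj_by w x = x" | "conj_by w x = x \<otimes> x" using x(3) by blast
  then have "conj_by w (conj_by w x) = x"
  proof cases
    case 2
    then have "conj_by w (conj_by w x) = x \<otimes> x \<otimes> (x \<otimes> x)"
      using conj_by_mult[OF wc x(1) x(1)] by simp
    also have "\<dots> = x" using x(1,2) by (simp add: m_assoc[symmetric])
    finally show ?thesis .
  qed simp
  then show ?thesis using conj_by_conj_by[OF wc wc x(1)] conj_by_eq_iff[of "w \<otimes> w" x] wc x(1) by simp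
qed

text \<open>An element of order 3 is the fourth power of itself, so squares suffice.\<close>

lemma order_3_commute_index_2:
  assumes P: "subgroup P G" "card P = 3" "x \<in> P" "x \<noteq> \<one>"
    and N: "card (carrier G) = 2 * card (normalizing G P)"
    and y: "y \<in> carrier G" "y \<otimes> y \<otimes> y = \<one>"
  shows "y \<otimes> x = x \<otimes> y"
proof -
  have "y \<otimes> y \<in> normalizing G P"
    using square_in_index_2[OF subgroup_normalizing[OF P(1)] N y(1)] .
  then have "(y \<otimes> y) \<otimes> (y \<otimes> y) \<otimes> x = x \<otimes> ((y \<otimes> y) \<otimes> (y \<otimes> y))"
    by (rule square_centralizes[OF P])
  moreover have "(y \<otimes> y) \<otimes> (y \<otimes> y) = y" using y by (simp add: m_assoc[symmetric])
  ultimately show ?thesis by simp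
qed

lemma conj_cube:
  assumes "g \<in> carrier G" "x \<in> carrier G" "x \<otimes> x \<otimes> x = \<one>"
  shows "conj_by g x \<otimes> conj_by g x \<otimes> conj_by g x = \<one>"
  using conj_by_mult[of g x x] conj_by_mult[of g "x \<otimes> x" x] assms by simp

text \<open>Every subgroup of order 3 has a normalizer of order 9, so no involution i normalizes
  one. Yet x and its conjugate y under i commute and are swapped by i, so i fixes u = x y. If u = 1,
  then y = x^-1 and i normalizes \<open>P\<close>; otherwise i normalizes the subgroup of order 3
  generated by u.\<close>

lemma order_not_18: "card (carrier G) \<noteq> 18"
proof
  assume n: "card (carrier G) = 18"
  obtain H where H: "subgroup H G" "card H = 2" using cauchy[of 2] n by auto
  obtain i where i: "i \<in> carrier G" "i \<noteq> \<one>" "i \<otimes> i = \<one>" "H = {\<one>, i}" "normalizing G H = cent i"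
    using order_2_subgroup[OF H] by blast
  obtain P where P: "subgroup P G" "card P = 3" using cauchy[of 3] n by auto
  obtain x where x: "x \<in> P" "x \<noteq> \<one>" using nontrivial_element[OF P] by auto
  note x3 = order_3_element[OF P x]
  have n3: "card (normalizing G Q) = 9" if "subgroup Q G" "card Q = 3" for Q
    using order_3_normalizing[OF that] n by auto
  have i3: "i \<notin> normalizing G Q" if Q: "subgroup Q G" "card Q = 3" for Q
  proof
    assume "i \<in> normalizing G Q"
    then have "H \<subseteq> normalizing G Q" using i(4) subgroup.one_closed[OF subgroup_normalizing[OF Q(1)]] by auto
    then have "2 dvd card (normalizing G Q)"
      using card_subgroup_dvd_subgroup[OF H(1) subgroup_normalizing[OF Q(1)]] H(2) by simp
    then show False using n3[OF Q] by simp
  qed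
  have invi: "inv i = i" using i by (simp add: inv_equality)
  let ?y = "conj_by i x"
  have y: "?y \<in> carrier G" "?y \<otimes> ?y \<otimes> ?y = \<one>" using i x3 conj_cube by auto
  have comm: "?y \<otimes> x = x \<otimes> ?y"
    by (rule order_3_commute_index_2[OF P x _ y]) (use n3[OF P] n in simp)
  have iy: "conj_by i ?y = x" using i x3 invi by (metis conj_by_inv_cancel(1))
  let ?u = "x \<otimes> ?y"
  have uc: "?u \<in> carrier G" using x3 y by simp
  have "conj_by i ?u = ?u" using conj_by_mult[OF i(1) x3(1) y(1)] iy comm by simp
  have "?u \<noteq> \<one>"
  proof
    assume "?u = \<one>"
    then have "?y = inv x" using x3(1) y(1) by (metis inv_equality inv_inv comm)
    then have "?y \<in> P" using x(1) subgroup.m_inv_closed[OF P(1)] by simp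
    then have "i \<in> normalizing G P" using normalizing_prime_order_iff[OF P _ x i(1)] by simp
    then show False using i3[OF P] by blast
  qed
  moreover have "?u \<otimes> ?u \<otimes> ?u = \<one>"
  proof -
    have xy: "x \<otimes> (?y \<otimes> z) = ?y \<otimes> (x \<otimes> z)" if "z \<in> carrier G" for z
      using comm x3(1) y(1) that by (simp add: m_assoc[symmetric])
    have "?u \<otimes> ?u \<otimes> ?u = (?y \<otimes> ?y \<otimes> ?y) \<otimes> (x \<otimes> x \<otimes> x)"
      using x3(1) y(1) xy comm[symmetric] by (simp add: m_assoc)
    then show ?thesis using x3 y by simp
  qed
  ultimately have Q: "subgroup (generate G {?u}) G" "card (generate G {?u}) = 3" "?u \<in> generate G {?u}"
    using order_3_subgroup[OF uc] by auto
  have "i \<in> normalizing G (generate G {?u})"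
    using normalizing_prime_order_iff[OF Q(1,2) _ Q(3) \<open>?u \<noteq> \<one>\<close> i(1)] \<open>conj_by i ?u = ?u\<close> Q(3) by simp
  then show False using i3[OF Q(1,2)] by blast
qed

text \<open>The disjoint sets P and P y consist of six elements with trivial cube, and the
  involution i is a seventh element. The bound serves to beat the value 6 that divisibility leaves
  open for order 36.\<close>

lemma card_ge_7:
  assumes P: "subgroup P G" "card P = 3" "x \<in> P" "x \<noteq> \<one>" and S: "subgroup S G"
    and y: "y \<notin> P" "y \<otimes> y \<otimes> y = \<one>" "y \<otimes> x = x \<otimes> y"
    and i: "i \<noteq> \<one>" "i \<otimes> i = \<one>" and mem: "x \<in> S" "y \<in> S" "i \<in> S"
  shows "card S \<ge> 7"
proof -
  note x3 = order_3_element[OF P]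
  have c: "y \<in> carrier G" "i \<in> carrier G" using mem S subgroup.subset by blast+
  let ?c = "\<lambda>z. z \<otimes> z \<otimes> z"
  have sub: "P \<union> (\<lambda>a. a \<otimes> y) ` P \<union> {i} \<subseteq> S"
    using mem x3(3) subgroup.one_closed[OF S] subgroup.m_closed[OF S] by auto
  have Pc: "P \<subseteq> carrier G" using P subgroup.subset by blast
  have inj: "inj_on (\<lambda>a. a \<otimes> y) P" by (rule inj_onI) (use Pc c r_cancel in blast)
  have "P \<inter> (\<lambda>a. a \<otimes> y) ` P = {}"
  proof (rule ccontr)
    assume "P \<inter> (\<lambda>a. a \<otimes> y) ` P \<noteq> {}"
    then obtain a where a: "a \<in> P" "a \<otimes> y \<in> P" by auto
    then have "inv a \<otimes> (a \<otimes> y) \<in> P" using P(1) by (metis subgroup.m_closed subgroup.m_inv_closed)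
    then show False using y a c Pc by auto
  qed
  then have card6: "card (P \<union> (\<lambda>a. a \<otimes> y) ` P) = 6"
    using finite_subgroup[OF P(1)] P(2) card_image[OF inj] by (simp add: card_Un_disjoint)
  have cubeP: "?c a = \<one>" if "a \<in> P" for a
    using that x3 order_3_element(2)[OF P(1,2)] by (cases "a = \<one>") auto
  have yP: "y \<otimes> a = a \<otimes> y" if "a \<in> P" for a
  proof -
    have "P \<subseteq> cent y"
      using x3 y(3) c prime_order_generate[OF P(1,2) _ P(3,4)]
        generate_subgroup_incl[OF _ subgroup_cent[OF c(1)], of "{x}"] by (simp add: cent_def)
    then show ?thesis using that by (auto simp: cent_def)
  qed
  have "?c (a \<otimes> y) = \<one>" if a: "a \<in> P" for a
  proof -
    have ac: "a \<in> carrier G" using a Pc by auto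
    have xy: "y \<otimes> (a \<otimes> z) = a \<otimes> (y \<otimes> z)" if "z \<in> carrier G" for z
      using yP[OF a] ac c that by (simp add: m_assoc[symmetric])
    have "?c (a \<otimes> y) = ?c a \<otimes> ?c y"
      using ac c xy yP[OF a] by (simp add: m_assoc)
    then show ?thesis using cubeP[OF a] y by simp
  qed
  then have "?c z = \<one>" if "z \<in> P \<union> (\<lambda>a. a \<otimes> y) ` P" for z using that cubeP by auto
  moreover have "?c i \<noteq> \<one>" using i c by simp
  ultimately have "i \<notin> P \<union> (\<lambda>a. a \<otimes> y) ` P" by blast
  then have "card (insert i (P \<union> (\<lambda>a. a \<otimes> y) ` P)) = 7"
    using card6 finite_subgroup[OF P(1)] by simp
  moreover have "card (insert i (P \<union> (\<lambda>a. a \<otimes> y) ` P)) \<le> card S"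
    by (rule card_mono[OF finite_subgroup[OF S]]) (use sub in auto)
  ultimately show ?thesis by simp
qed

text \<open>An involution i centralizes some x of order 3 whose subgroup \<open>P\<close> has a
  normalizer of index 2. A conjugate y of x outside \<open>P\<close> commutes with x, and i turns
  out to centralize y as well. Then the centralizers of i and x, of orders 12 and 18, share x, y and
  i, hence at least 7 elements, although their intersection has an order dividing 6.\<close>

lemma order_not_36: "card (carrier G) \<noteq> 36"
proof
  assume n: "card (carrier G) = 36"
  obtain H where H: "subgroup H G" "card H = 2" using cauchy[of 2] n by auto
  obtain i where i: "i \<in> carrier G" "i \<noteq> \<one>" "i \<otimes> i = \<one>" "H = {\<one>, i}" "normalizing G H = cent i"
    using order_2_subgroup[OF H] by blast
  \<comment> \<open>Only k = 6 makes 36 - 4k a divisor of 36 within k \<le> 7. The value k = 8,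
    which belongs to the affine group, is cut off by the strict bound on \<open>tp\<close>.\<close>
  have n2: "card (normalizing G H) = 12"
  proof -
    obtain k where k: "1 \<le> k" "k \<le> 7" "card (carrier G) = card (normalizing G H) + 4 * k"
      "card (normalizing G H) dvd card (carrier G)"
      using order_2_normalizing[OF H] by auto
    then have "k \<in> {1,2,3,4,5,6,7}" by auto
    then show ?thesis using n k(3,4) by auto
  qed
  then obtain P where P: "subgroup P G" "card P = 3" "P \<subseteq> cent i" "2 dvd card (normalizing G P)"
    using involution_normalizes[OF H, of 3] i(5) by auto
  \<comment> \<open>The table offers 9 and 18 for order 36; evenness selects 18.\<close>
  have n3: "card (normalizing G P) = 18" using order_3_normalizing[OF P(1,2)] n P(4) by auto
  obtain x where x: "x \<in> P" "x \<noteq> \<one>" using nontrivial_element[OF P(1,2)] by auto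
  note x3 = order_3_element[OF P(1,2) x]
  have ix: "i \<in> cent x" using P(3) x(1) i(1) cent_sym by blast
  have p3: "Factorial_Ring.prime (3::nat)" by simp
  have index: "card (carrier G) = 2 * card (normalizing G P)" using n n3 by simp
  obtain g where g: "g \<in> carrier G" "g \<notin> normalizing G P"
  proof -
    have "normalizing G P \<noteq> carrier G" using n n3 by auto
    then show ?thesis using that normalizing_subset by blast
  qed
  let ?y = "conj_by g x"
  have y: "?y \<in> carrier G" "?y \<otimes> ?y \<otimes> ?y = \<one>" using g(1) x3 conj_cube by auto
  have yP: "?y \<notin> P" using normalizing_prime_order_iff[OF P(1,2) p3 x g(1)] g(2) by simp
  have comm: "?y \<otimes> x = x \<otimes> ?y" by (rule order_3_commute_index_2[OF P(1,2) x index y])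
  have cx: "cent x = normalizing G P"
  proof -
    have sub: "cent x \<subseteq> normalizing G P" by (rule cent_subset_normalizing[OF P(1,2) p3 x])
    have d: "card (cent x) dvd 18"
      using card_subgroup_dvd_subgroup[OF subgroup_cent[OF x3(1)] subgroup_normalizing[OF P(1)] sub] n3 by simp
    have 7: "card (cent x) \<ge> 7"
      by (rule card_ge_7[OF P(1,2) x subgroup_cent[OF x3(1)] yP y(2) comm i(2,3)])
         (use x3 y comm ix in \<open>auto simp: cent_def\<close>)
    have "3 dvd card (cent x)"
    proof -
      have "P \<subseteq> cent x" using x3 by (auto simp: cent_def m_assoc)
      then show ?thesis using card_subgroup_dvd_subgroup[OF P(1) subgroup_cent[OF x3(1)]] P(2) by simp
    qed
    moreover have "2 dvd card (cent x)"
    proof -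
      have "H \<subseteq> cent x" using ix i(4) subgroup.one_closed[OF subgroup_cent[OF x3(1)]] by auto
      then show ?thesis using card_subgroup_dvd_subgroup[OF H(1) subgroup_cent[OF x3(1)]] H(2) by simp
    qed
    moreover have "card (cent x) \<le> 18" using d dvd_imp_le by auto
    \<comment> \<open>The multiples of 6 between 7 and 18; as 12 does not divide 18, the centralizer
      is the whole normalizer.\<close>
    ultimately have "card (cent x) \<in> {12, 18}" using 7 by (auto; presburger)
    then have "card (cent x) = 18" using d by auto
    then show ?thesis using card_subset_eq[OF _ sub] n3 finite_subset[OF normalizing_subset fin] by simp
  qed
  have "inv g \<otimes> i \<otimes> g \<in> cent x"
  proof -
    have N: "subgroup (cent x) G" by (rule subgroup_cent[OF x3(1)])
    have sq: "z \<otimes> z \<in> cent x" if "z \<in> carrier G" for z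
      using square_in_index_2[OF N _ that] index cx by simp
    \<comment> \<open>Squares lie in the index-2 subgroup \<open>cent x\<close>, and g^-1 i g equals
      g^-2 (g i)^2 i because i is an involution.\<close>
    have "(inv g \<otimes> inv g) \<otimes> ((g \<otimes> i) \<otimes> (g \<otimes> i)) \<otimes> i \<in> cent x"
      using sq[of "inv g"] sq[of "g \<otimes> i"] g(1) i(1) ix subgroup.m_closed[OF N] by auto
    moreover have "(inv g \<otimes> inv g) \<otimes> ((g \<otimes> i) \<otimes> (g \<otimes> i)) \<otimes> i = inv g \<otimes> i \<otimes> g"
      using g(1) i(1,3) by (simp add: m_assoc)
    ultimately show ?thesis by simp
  qed
  then have "conj_by (inv g \<otimes> i \<otimes> g) x = x"
    using conj_by_eq_iff[of "inv g \<otimes> i \<otimes> g" x] x3(1) by (simp add: cent_def)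
  then have "conj_by g (conj_by (inv g \<otimes> i \<otimes> g) x) = ?y" by simp
  then have "conj_by i ?y = ?y"
    using g(1) i(1) x3(1) by (simp add: conj_by_conj_by m_assoc)
  then have yi: "?y \<in> cent i" using y(1) i(1) conj_by_eq_iff by (simp add: cent_def)
  let ?S = "cent i \<inter> cent x"
  have S: "subgroup ?S G" using subgroups_Inter_pair subgroup_cent i(1) x3(1) by blast
  have "card ?S \<ge> 7"
    by (rule card_ge_7[OF P(1,2) x S yP y(2) comm i(2,3)])
       (use x3 y comm ix i yi P(3) x(1) in \<open>auto simp: cent_def\<close>)
  moreover have "card ?S dvd 12"
    using card_subgroup_dvd_subgroup[OF S subgroup_cent[OF i(1)]] n2 i(5) by simp
  moreover have "card ?S dvd 18"
    using card_subgroup_dvd_subgroup[OF S subgroup_cent[OF x3(1)]] n3 cx by simp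
  ultimately have "card ?S dvd gcd 12 18" by (intro gcd_greatest)
  moreover have "gcd 12 18 = (6::nat)" by code_simp
  ultimately show False using \<open>card ?S \<ge> 7\<close> dvd_imp_le[of "card ?S" 6] by simp
qed

text \<open>The surviving pairs (12, 3) and (24, 6) both give a normalizer of index 4, so a subgroup
  of order 3 has four conjugates to act on.\<close>

lemma order_12_or_24:
  "card (carrier G) = 12 \<or> card (carrier G) = 24"
  "subgroup P G \<Longrightarrow> card P = 3 \<Longrightarrow> card (carrier G) = 4 * card (normalizing G P)"
proof -
  show *: "card (carrier G) = 12 \<or> card (carrier G) = 24"
    using possible_orders order_not_50_54_98 order_not_56 order_not_30 order_not_18 order_not_36 by auto
  show "card (carrier G) = 4 * card (normalizing G P)" if "subgroup P G" "card P = 3"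
    using order_3_normalizing[OF that] * by auto
qed

end

section \<open>The action on four conjugate subgroups of order 3\<close>

context no_prime_normal_group
begin

definition conjugates :: "'a set \<Rightarrow> 'a set set"
  where "conjugates P = (\<lambda>g. conj_by g ` P) ` carrier G"

lemma conjugates_subgroup:
  assumes "subgroup P G" "card P = 3" "Q \<in> conjugates P"
  shows "subgroup Q G" "card Q = 3"
  using assms conj_subgroup[OF assms(1)] by (auto simp: conjugates_def)

lemma card_conjugates:
  assumes "subgroup P G" "card P = 3"
  shows "card (conjugates P) = 4"
proof -
  have "card (conjugates P) * card (normalizing G P) = 4 * card (normalizing G P)"
    unfolding conjugates_def card_conj_subgroups[OF assms(1)] using order_12_or_24(2)[OF assms] .
  moreover have "card (normalizing G P) > 0" using subgroup_card_pos subgroup_normalizing assms(1) by blast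
  ultimately show ?thesis by simp
qed

text \<open>Distinct subgroups of order 3 meet only in the identity, so four of them cover 4 * 2 + 1
  elements. This is too many for the kernel of the action and enough to force the even part to have
  order 12.\<close>

lemma card_Union_conjugates:
  assumes P: "subgroup P G" "card P = 3"
  shows "card (\<Union> (conjugates P)) \<ge> 9"
proof -
  let ?E = "conjugates P"
  have finE: "finite ?E" using fin by (simp add: conjugates_def)
  have Q: "subgroup Q G" "card Q = 3" if "Q \<in> ?E" for Q using conjugates_subgroup[OF P that] .
  have finQ: "finite Q" if "Q \<in> ?E" for Q using finite_subgroup Q that by blast
  have p3: "Factorial_Ring.prime (3::nat)" by simp
  have disj: "Q = R" if QR: "Q \<in> ?E" "R \<in> ?E" and z: "z \<in> Q" "z \<in> R" "z \<noteq> \<one>" for Q R z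
    using prime_order_generate[OF Q[OF QR(1)] p3 z(1,3)] prime_order_generate[OF Q[OF QR(2)] p3 z(2,3)] by simp
  have "card (\<Union>Q\<in>?E. Q - {\<one>}) = (\<Sum>Q\<in>?E. card (Q - {\<one>}))"
  proof (rule card_UN_disjoint[OF finE])
    show "\<forall>i\<in>?E. \<forall>j\<in>?E. i \<noteq> j \<longrightarrow> (i - {\<one>}) \<inter> (j - {\<one>}) = {}" using disj by blast
  qed (use finQ in auto)
  also have "\<dots> = (\<Sum>Q\<in>?E. 2)"
  proof (rule sum.cong[OF refl])
    fix R assume R: "R \<in> ?E"
    show "card (R - {\<one>}) = 2"
      using Q(2)[OF R] subgroup.one_closed[OF Q(1)[OF R]] by (simp add: card_Diff_singleton)
  qed
  also have "\<dots> = 8" using card_conjugates[OF P] by simp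
  finally have "card (insert \<one> (\<Union>Q\<in>?E. Q - {\<one>})) = 9"
    using finE finQ by (subst card_insert_disjoint) auto
  moreover have "card (insert \<one> (\<Union>Q\<in>?E. Q - {\<one>})) \<le> card (\<Union> ?E)"
  proof (rule card_mono)
    have "P \<in> ?E" unfolding conjugates_def
      by (rule image_eqI[of _ _ \<one>]) (use P(1) subgroup.subset in \<open>force+\<close>)
    then show "insert \<one> (\<Union>Q\<in>?E. Q - {\<one>}) \<subseteq> \<Union> ?E" using subgroup.one_closed[OF P(1)] by blast
  qed (use finE finQ in auto)
  ultimately show ?thesis by simp
qed

text \<open>The conjugation action on the four conjugates of \<open>P\<close> embeds G into S4. The
  elements acting evenly form a subgroup \<open>U\<close> that contains all these conjugates, and
  its size forces its image to be all of A4.\<close>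

lemma epimorphism_to_alt_group_4:
  "\<exists>U f. subgroup U G \<and> f \<in> hom (G\<lparr>carrier := U\<rparr>) (alt_group 4) \<and> f ` U = carrier (alt_group 4)"
proof -
  have "3 dvd card (carrier G)" using order_12_or_24(1) by auto
  then obtain P where P: "subgroup P G" "card P = 3" using cauchy[of 3] by auto
  have Pc: "P \<subseteq> carrier G" using P subgroup.subset by blast
  let ?E = "conjugates P"
  have finE: "finite ?E" using fin by (simp add: conjugates_def)
  obtain e where e: "bij_betw e {1..4::nat} ?E"
    using ex_bij_betw_nat_finite_1[OF finE] card_conjugates[OF P] by auto
  have Ec: "Q \<subseteq> carrier G" if "Q \<in> ?E" for Q
    using conjugates_subgroup(1)[OF P that] subgroup.subset by blast
  have comp: "conj_by g ` conj_by h ` Q = conj_by (g \<otimes> h) ` Q"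
    if "g \<in> carrier G" "h \<in> carrier G" "Q \<subseteq> carrier G" for g h Q
    unfolding image_image by (rule image_cong) (use that conj_by_conj_by in auto)
  have actE: "conj_by g ` Q \<in> ?E" if g: "g \<in> carrier G" and Q: "Q \<in> ?E" for g Q
  proof -
    obtain h where h: "h \<in> carrier G" "Q = conj_by h ` P" using Q by (auto simp: conjugates_def)
    then have "conj_by g ` Q = conj_by (g \<otimes> h) ` P" using comp[OF g h(1) Pc] by simp
    then show ?thesis using g h by (auto simp: conjugates_def)
  qed
  \<comment> \<open>The four conjugates are numbered by \<open>e\<close> so that the action lands in
    permutations of {1..4}; outside it is the identity, as \<open>permutes\<close> demands.\<close>
  define \<phi> where "\<phi> g = (\<lambda>k. if k \<in> {1..4} then inv_into {1..4} e (conj_by g ` e k) else k)" for g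
  have eE: "e k \<in> ?E" if "k \<in> {1..4}" for k using e that by (auto simp: bij_betw_def)
  have \<phi>e: "e (\<phi> g k) = conj_by g ` e k" "\<phi> g k \<in> {1..4}" if "g \<in> carrier G" "k \<in> {1..4}" for g k
  proof -
    have im: "conj_by g ` e k \<in> e ` {1..4}"
      using actE[OF that(1) eE[OF that(2)]] e by (simp add: bij_betw_def)
    have "\<phi> g k = inv_into {1..4} e (conj_by g ` e k)" using that(2) by (simp add: \<phi>_def)
    then show "e (\<phi> g k) = conj_by g ` e k" "\<phi> g k \<in> {1..4}"
      using f_inv_into_f[OF im] inv_into_into[OF im] by simp_all
  qed
  have einj: "inj_on e {1..4}" using e by (simp add: bij_betw_def)
  have \<phi>_out: "\<phi> g k = k" if "k \<notin> {1..4}" for g k using that by (auto simp: \<phi>_def)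
  have \<phi>_mult: "\<phi> (g \<otimes> h) = \<phi> g \<circ> \<phi> h" if g: "g \<in> carrier G" and h: "h \<in> carrier G" for g h
  proof
    fix k show "\<phi> (g \<otimes> h) k = (\<phi> g \<circ> \<phi> h) k"
    proof (cases "k \<in> {1..4}")
      case True
      have "e (\<phi> (g \<otimes> h) k) = conj_by (g \<otimes> h) ` e k" using \<phi>e(1)[OF m_closed[OF g h] True] .
      also have "\<dots> = conj_by g ` conj_by h ` e k" using comp[OF g h Ec[OF eE[OF True]]] by simp
      also have "\<dots> = e (\<phi> g (\<phi> h k))"
        using \<phi>e(1)[OF g \<phi>e(2)[OF h True]] \<phi>e(1)[OF h True] by simp
      finally show ?thesis
        using inj_onD[OF einj _ \<phi>e(2)[OF m_closed[OF g h] True] \<phi>e(2)[OF g \<phi>e(2)[OF h True]]] by simp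
    next
      case False then show ?thesis using \<phi>_out by simp
    qed
  qed
  have \<phi>_one: "\<phi> \<one> = id"
  proof
    fix k show "\<phi> \<one> k = id k"
    proof (cases "k \<in> {1..4}")
      case True
      have "conj_by \<one> ` e k = (\<lambda>x. x) ` e k"
        by (rule image_cong) (use Ec[OF eE[OF True]] in auto)
      then have "e (\<phi> \<one> k) = e k" using \<phi>e(1)[OF one_closed True] by simp
      then show ?thesis using inj_onD[OF einj _ \<phi>e(2)[OF one_closed True] True] by simp
    qed (use \<phi>_out in simp)
  qed
  have \<phi>_permutes: "\<phi> g permutes {1..4}" if g: "g \<in> carrier G" for g
  proof -
    have "\<phi> g \<circ> \<phi> (inv g) = id" "\<phi> (inv g) \<circ> \<phi> g = id"
      using \<phi>_mult[of g "inv g"] \<phi>_mult[of "inv g" g] g \<phi>_one by simp_all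
    then have "bij (\<phi> g)" using o_bij by blast
    then show ?thesis using \<phi>_out unfolding permutes_def by (metis bij_pointE)
  qed
  have perm: "permutation (\<phi> g)" if "g \<in> carrier G" for g
    using \<phi>_permutes[OF that] permutation_permutes by blast
  interpret S: group "sym_group 4" by (rule sym_group_is_group)
  have hom: "group_hom G (sym_group 4) \<phi>"
    by unfold_locales (simp add: hom_def Pi_iff sym_group_carrier sym_group_mult \<phi>_permutes \<phi>_mult
        del: One_nat_def)
  interpret \<phi>: group_hom G "sym_group 4" \<phi> by (rule hom)
  define K where "K = kernel G (sym_group 4) \<phi>"
  have K: "K \<lhd> G" "subgroup K G"
    using \<phi>.normal_kernel \<phi>.subgroup_kernel by (simp_all add: K_def)
  have KN: "K \<subseteq> normalizing G P"
  proof
    fix g assume "g \<in> K"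
    then have g: "g \<in> carrier G" "\<phi> g = id" by (auto simp: K_def kernel_def sym_group_one)
    have "P = conj_by \<one> ` P" using Pc by force
    then have "P \<in> ?E" by (auto simp: conjugates_def)
    then have "P \<in> e ` {1..4}" using bij_betw_imp_surj_on[OF e] by simp
    then obtain k where "P = e k" and k1: "k \<in> {1..4}" by (rule imageE)
    then have k: "k \<in> {1..4}" "e k = P" by (simp_all del: One_nat_def)
    have "conj_by g ` P = P" using \<phi>e(1)[OF g(1) k(1)] g(2) k(2) by simp
    then show "g \<in> normalizing G P" using normalizing_iff[OF P(1) g(1)] by simp
  qed
  have N6: "card (normalizing G P) = 3 \<or> card (normalizing G P) = 6"
    using order_12_or_24(1) order_12_or_24(2)[OF P] by auto
  have Kdvd: "card K dvd card (normalizing G P)"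
    using card_subgroup_dvd_subgroup[OF K(2) subgroup_normalizing[OF P(1)] KN] .
  have K6: "card K \<le> 6" using N6 dvd_imp_le[OF Kdvd] by auto
  \<comment> \<open>The normal subgroup \<open>K\<close> would contain all conjugates of a subgroup
    of order 3, hence at least 9 elements, but it lies in a normalizer of order at most 6.\<close>
  have "\<not> 3 dvd card K"
  proof
    assume "3 dvd card K"
    then obtain R where R: "subgroup R G" "R \<subseteq> K" "card R = 3" using cauchy_subgroup[OF K(2), of 3] by auto
    have "\<Union> (conjugates R) \<subseteq> K"
      using R(2) K(1) normal.inv_op_closed2[OF K(1)] by (auto simp: conjugates_def conj_by_def)
    then have "card (\<Union> (conjugates R)) \<le> card K" using card_mono finite_subgroup[OF K(2)] by blast
    then show False using card_Union_conjugates[OF R(1,3)] K6 by simp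
  qed
  moreover have "card K \<noteq> 2" using no_prime_normal[OF K(1)] by auto
  moreover have "card K \<in> {1,2,3,4,5,6}" using K6 subgroup_card_pos[OF K(2)] by auto
  ultimately have "card K = 1" using N6 Kdvd by auto
  then have "K = {\<one>}" using subgroup.one_closed[OF K(2)] by (metis card_1_singletonE singletonD)
  then have \<phi>_inj: "inj_on \<phi> (carrier G)" using \<phi>.inj_iff_trivial_ker by (simp add: K_def)
  define U where "U = {g \<in> carrier G. evenperm (\<phi> g)}"
  have U: "subgroup U G"
  proof (rule subgroupI)
    show "U \<noteq> {}" using \<phi>_one evenperm_id by (auto simp: U_def)
  next
    fix a assume a: "a \<in> U"
    then have ac: "a \<in> carrier G" by (simp add: U_def)
    have "evenperm (\<phi> (inv a) \<circ> \<phi> a)" using \<phi>_mult[of "inv a" a] ac \<phi>_one evenperm_id by simp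
    then show "inv a \<in> U" using a ac perm evenperm_comp[OF perm perm, of "inv a" a] by (simp add: U_def)
  next
    fix a b assume "a \<in> U" "b \<in> U"
    then show "a \<otimes> b \<in> U" using \<phi>_mult[of a b] evenperm_comp[OF perm perm, of a b] by (simp add: U_def)
  qed (auto simp: U_def)
  have "\<Union> ?E \<subseteq> U"
  proof
    fix q assume "q \<in> \<Union> ?E"
    then obtain Q where Q: "Q \<in> ?E" "q \<in> Q" by auto
    have qc: "q \<in> carrier G" using Ec Q by blast
    have q3: "q \<otimes> q \<otimes> q = \<one>"
      using order_3_element(2)[OF conjugates_subgroup[OF P Q(1)] Q(2)] by (cases "q = \<one>") auto
    \<comment> \<open>From q^3 = 1 follows q = (q^2)^2, so q acts as a square and hence
      evenly.\<close>
    have "q = (q \<otimes> q) \<otimes> (q \<otimes> q)" using q3 qc by (simp add: m_assoc[symmetric])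
    then have "\<phi> q = \<phi> (q \<otimes> q) \<circ> \<phi> (q \<otimes> q)" using \<phi>_mult[of "q \<otimes> q" "q \<otimes> q"] qc by simp
    then have "evenperm (\<phi> q)" using evenperm_comp[OF perm perm, of "q \<otimes> q" "q \<otimes> q"] qc by simp
    then show "q \<in> U" using qc by (simp add: U_def)
  qed
  then have U9: "card U \<ge> 9"
    using card_Union_conjugates[OF P] card_mono[OF finite_subgroup[OF U]] by (meson le_trans)
  have img: "\<phi> ` U \<subseteq> carrier (alt_group 4)"
    using \<phi>_permutes by (auto simp: U_def alt_group_carrier simp del: One_nat_def)
  have A12: "card (carrier (alt_group 4)) = 12"
    using alt_group_card_carrier[of 4] by (simp add: fact_numeral)
  then have finA: "finite (carrier (alt_group 4))" by (metis card.infinite zero_neq_numeral)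
  have cU: "card (\<phi> ` U) = card U"
    by (rule card_image) (use \<phi>_inj subgroup.subset[OF U] inj_on_subset in blast)
  then have "card U \<le> 12" using card_mono[OF finA img] A12 by simp
  moreover have "card U dvd 24" using card_subgroup_dvd[OF U] order_12_or_24(1) by (auto intro: dvd_trans)
  \<comment> \<open>Of these only 12 divides 24.\<close>
  moreover have "card U \<in> {9,10,11,12}" using U9 calculation(1) by auto
  ultimately have "card U = 12" by auto
  then have "\<phi> ` U = carrier (alt_group 4)" using card_subset_eq[OF finA img] cU A12 by simp
  moreover have "\<phi> \<in> hom (G\<lparr>carrier := U\<rparr>) (alt_group 4)"
    using img subgroup.mem_carrier[OF U] by (auto simp: hom_def alt_group_mult sym_group_mult)
  ultimately show ?thesis using U by blast
qed

end

section \<open>Supersolubility\<close>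

text \<open>The first isomorphism theorem. It lets the proof work with surjections from subgroups
  and return to sections only at the end.\<close>

lemma has_section_iso_of_epimorphism:
  assumes "group G" "subgroup U G" "group K" "f \<in> hom (G\<lparr>carrier := U\<rparr>) K" "f ` U = carrier K"
  shows "has_section_iso G K"
proof -
  interpret U: group "G\<lparr>carrier := U\<rparr>" using group.subgroup_imp_group[OF assms(1,2)] .
  interpret K: group K by fact
  interpret f: group_hom "G\<lparr>carrier := U\<rparr>" K f by unfold_locales (rule assms(4))
  have "(G\<lparr>carrier := U\<rparr> Mod kernel (G\<lparr>carrier := U\<rparr>) K f) \<cong> K"
    by (rule f.FactGroup_iso) (simp add: assms(5))
  then show ?thesis unfolding has_section_iso_def using assms(2) f.normal_kernel by blast
qed

text \<open>Restrict \<open>h\<close> to the preimage of \<open>U\<close> and compose with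
  \<open>f\<close>: what is found in a quotient is thereby found in the group.\<close>

lemma (in group_hom) epimorphism_from_subgroup_pullback:
  assumes surj: "h ` carrier G = carrier H"
    and U: "subgroup U H" and f: "f \<in> hom (H\<lparr>carrier := U\<rparr>) K" "f ` U = carrier K"
  shows "\<exists>V f'. subgroup V G \<and> f' \<in> hom (G\<lparr>carrier := V\<rparr>) K \<and> f' ` V = carrier K"
proof (intro exI conjI)
  let ?V = "{x \<in> carrier G. h x \<in> U}"
  show "subgroup ?V G"
  proof (rule G.subgroupI)
    show "?V \<noteq> {}" using subgroup.one_closed[OF U] G.one_closed hom_one by fastforce
  qed (use U in \<open>auto simp: subgroup.m_closed subgroup.m_inv_closed\<close>)
  show "f \<circ> h \<in> hom (G\<lparr>carrier := ?V\<rparr>) K"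
    using f(1) by (auto simp: hom_def Pi_iff)
  have "U \<subseteq> h ` carrier G" using surj subgroup.subset[OF U] by simp
  then have "U = h ` ?V" by blast
  then show "(f \<circ> h) ` ?V = carrier K" using f(2) by (metis image_comp)
qed

lemma (in fin_group) prime_order_imp_cyclic_group:
  assumes "Factorial_Ring.prime (card (carrier G))"
  shows "cyclic_group G"
proof -
  obtain x where x: "x \<in> carrier G" "x \<noteq> \<one>"
    using nontrivial_element[OF subgroup_self refl] prime_gt_1_nat[OF assms] by blast
  have "carrier G = generate G {x}" by (rule prime_order_generate[OF subgroup_self refl assms x])
  then have "subgroup_generated G {x} = G" using x by (simp add: subgroup_generated_def)
  then show ?thesis unfolding cyclic_group_def using x by blast
qed

lemma prime_normal_or_epimorphism:
  assumes "group G" "finite (carrier G)" "card (carrier G) > 1" "tp G > (1/2)^8"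
  shows "(\<exists>H. H \<lhd> G \<and> Factorial_Ring.prime (card H)) \<or>
    (\<exists>U f. subgroup U G \<and> f \<in> hom (G\<lparr>carrier := U\<rparr>) (alt_group 4) \<and> f ` U = carrier (alt_group 4))"
proof (rule disjCI)
  assume "\<not> (\<exists>U f. subgroup U G \<and> f \<in> hom (G\<lparr>carrier := U\<rparr>) (alt_group 4) \<and> f ` U = carrier (alt_group 4))"
  moreover have "fin_group G" using assms by (simp add: fin_group_def fin_group_axioms_def)
  ultimately show "\<exists>H. H \<lhd> G \<and> Factorial_Ring.prime (card H)"
    using no_prime_normal_group.epimorphism_to_alt_group_4[of G] assms
    unfolding no_prime_normal_group_def no_prime_normal_group_axioms_def by blast
qed

text \<open>Supersolubility with a free end point \<open>N\<close>, so that the longest reach of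
  such a series can be taken as an extremal object.\<close>

definition cyclic_series :: "('a, 'b) monoid_scheme \<Rightarrow> 'a set \<Rightarrow> bool"
  where "cyclic_series G N \<longleftrightarrow>
    (\<exists>(k::nat) M. M 0 = {\<one>\<^bsub>G\<^esub>} \<and> M k = N \<and> (\<forall>i\<le>k. M i \<lhd> G) \<and>
      (\<forall>i<k. M i \<subseteq> M (Suc i) \<and> cyclic_group (G\<lparr>carrier := M (Suc i)\<rparr> Mod M i)))"

lemma supersoluble_iff_cyclic_series: "supersoluble G \<longleftrightarrow> cyclic_series G (carrier G)"
  by (simp add: supersoluble_def cyclic_series_def)

lemma cyclic_series_extend:
  assumes "cyclic_series G N" "N' \<lhd> G" "N \<subseteq> N'" "cyclic_group (G\<lparr>carrier := N'\<rparr> Mod N)"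
  shows "cyclic_series G N'"
proof -
  obtain k M where M: "M 0 = {\<one>\<^bsub>G\<^esub>}" "M k = N" "\<forall>i\<le>k. M i \<lhd> G"
      "\<forall>i<k. M i \<subseteq> M (Suc i) \<and> cyclic_group (G\<lparr>carrier := M (Suc i)\<rparr> Mod M i)"
    using assms(1) unfolding cyclic_series_def by blast
  show ?thesis unfolding cyclic_series_def
  proof (intro exI[of _ "Suc k"] exI[of _ "M(Suc k := N')"] conjI allI impI)
    fix i assume "i < Suc k"
    then consider "i < k" | "i = k" by linarith
    then show "(M(Suc k := N')) i \<subseteq> (M(Suc k := N')) (Suc i)"
      "cyclic_group (G\<lparr>carrier := (M(Suc k := N')) (Suc i)\<rparr> Mod (M(Suc k := N')) i)"
      using M assms by (cases; simp)+
  next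
    fix i assume "i \<le> Suc k"
    then show "(M(Suc k := N')) i \<lhd> G" using M(3) assms(2) by (cases "i = Suc k") auto
  qed (use M in auto)
qed

text \<open>Take \<open>N\<close> maximal among the normal subgroups reached by a cyclic series. If
  \<open>N\<close> were proper, a normal subgroup of prime order in G/N would pull back to a larger
  such subgroup, and a surjection onto A4 would pull back to G. The extremal choice stands in for an
  induction on the order, in which the quotients would change the element type from
  \<open>'a\<close> to \<open>'a set\<close>.\<close>

lemma supersoluble_or_epimorphism:
  fixes G (structure)
  assumes G: "group G" "finite (carrier G)" "tp G > (1/2)^8"
  shows "supersoluble G \<or>
    (\<exists>U f. subgroup U G \<and> f \<in> hom (G\<lparr>carrier := U\<rparr>) (alt_group 4) \<and> f ` U = carrier (alt_group 4))"
proof (rule disjCI)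
  assume noepi: "\<not> (\<exists>U f. subgroup U G \<and> f \<in> hom (G\<lparr>carrier := U\<rparr>) (alt_group 4) \<and> f ` U = carrier (alt_group 4))"
  interpret group G by fact
  let ?S = "{N. N \<lhd> G \<and> cyclic_series G N}"
  have finS: "finite ?S"
    by (rule finite_subset[of _ "Pow (carrier G)"])
       (use G(2) in \<open>auto dest!: normal_imp_subgroup subgroup.subset\<close>)
  have "{\<one>} \<lhd> G" by (rule one_is_normal)
  then have "cyclic_series G {\<one>}"
    unfolding cyclic_series_def by (intro exI[of _ 0] exI[of _ "\<lambda>_. {\<one>}"]) auto
  then have "?S \<noteq> {}" using \<open>{\<one>} \<lhd> G\<close> by blast
  then obtain N where N: "N \<in> ?S" and max: "\<And>M. M \<in> ?S \<Longrightarrow> N \<subseteq> M \<Longrightarrow> M = N"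
    using finite_has_maximal[OF finS] by metis
  have NG: "N \<lhd> G" and Ncs: "cyclic_series G N" using N by auto
  interpret N: normal N G by (rule NG)
  have "N = carrier G"
  proof (rule ccontr)
    assume ne: "N \<noteq> carrier G"
    let ?Q = "G Mod N" and ?\<pi> = "\<lambda>a. N #> a"
    interpret Q: group ?Q by (rule N.factorgroup_is_group)
    interpret \<pi>: group_hom G ?Q ?\<pi> by unfold_locales (rule N.r_coset_hom_Mod)
    have surj: "?\<pi> ` carrier G = carrier ?Q" by (auto simp: FactGroup_def RCOSETS_def)
    have finQ: "finite (carrier ?Q)" using G(2) surj by (metis finite_imageI)
    have "card (carrier ?Q) > 1"
    proof -
      obtain x where x: "x \<in> carrier G" "x \<notin> N" using ne N.subset by blast
      have "N #> x \<noteq> N" using x rcos_self[OF x(1) N.subgroup_axioms] by auto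
      then have "{N, N #> x} \<subseteq> carrier ?Q" "card {N, N #> x} = 2"
        using x surj Q.one_closed by (auto simp: FactGroup_def)
      then show ?thesis using card_mono[OF finQ, of "{N, N #> x}"] by simp
    qed
    moreover have "tp ?Q > (1/2)^8" using \<pi>.tp_le_surjective_image[OF G(2) surj] G(3) by simp
    ultimately consider H where "H \<lhd> ?Q" "Factorial_Ring.prime (card H)"
      | U f where "subgroup U ?Q" "f \<in> hom (?Q\<lparr>carrier := U\<rparr>) (alt_group 4)" "f ` U = carrier (alt_group 4)"
      using prime_normal_or_epimorphism[OF Q.is_group finQ] by blast
    then show False
    proof cases
      case 2
      then show False using \<pi>.epimorphism_from_subgroup_pullback[OF surj] noepi by blast
    next
      case 1
      define N' where "N' = {x \<in> carrier G. N #> x \<in> H}"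
      have H: "subgroup H ?Q" using 1(1) normal_imp_subgroup by blast
      have sub: "subgroup N' G"
      proof (rule subgroupI)
        show "N' \<noteq> {}" using subgroup.one_closed[OF H] \<pi>.hom_one by (auto simp: N'_def intro!: exI[of _ \<one>])
      next
        fix a assume "a \<in> N'"
        then have a: "a \<in> carrier G" "N #> a \<in> H" by (auto simp: N'_def)
        then show "inv a \<in> N'" using subgroup.m_inv_closed[OF H a(2)] \<pi>.hom_inv[OF a(1)] by (simp add: N'_def)
      next
        fix a b assume "a \<in> N'" "b \<in> N'"
        then have ab: "a \<in> carrier G" "N #> a \<in> H" "b \<in> carrier G" "N #> b \<in> H" by (auto simp: N'_def)
        then show "a \<otimes> b \<in> N'"
          using subgroup.m_closed[OF H ab(2,4)] \<pi>.hom_mult[OF ab(1,3)] by (simp add: N'_def)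
      qed (auto simp: N'_def)
      have N'G: "N' \<lhd> G"
        unfolding normal_inv_iff
      proof (intro conjI ballI)
        fix x n assume xn: "x \<in> carrier G" "n \<in> N'"
        then have n: "n \<in> carrier G" "N #> n \<in> H" by (auto simp: N'_def)
        have "N #> (x \<otimes> n \<otimes> inv x) = (N #> x) \<otimes>\<^bsub>?Q\<^esub> (N #> n) \<otimes>\<^bsub>?Q\<^esub> inv\<^bsub>?Q\<^esub> (N #> x)"
          using \<pi>.hom_mult[of "x \<otimes> n" "inv x"] \<pi>.hom_mult[of x n] \<pi>.hom_inv[of x] xn(1) n(1) by simp
        also have "\<dots> \<in> H" using normal.inv_op_closed2[OF 1(1) \<pi>.hom_closed[OF xn(1)] n(2)] .
        finally show "x \<otimes> n \<otimes> inv x \<in> N'" using xn(1) n(1) by (simp add: N'_def)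
      qed (rule sub)
      have NN': "N \<subseteq> N'"
      proof
        fix n assume n: "n \<in> N"
        then have "N #> n = \<one>\<^bsub>?Q\<^esub>" using N.rcos_const[OF is_group n] by (simp add: FactGroup_def)
        then show "n \<in> N'" using n subgroup.one_closed[OF H] N.subset by (auto simp: N'_def)
      qed
      have "H \<subseteq> ?\<pi> ` carrier G" using subgroup.subset[OF H] surj by simp
      then have Him: "H = ?\<pi> ` N'" unfolding N'_def by blast
      \<comment> \<open>An equality of records, not just an isomorphism, so cyclicity can be
        rewritten along it.\<close>
      have eq: "G\<lparr>carrier := N'\<rparr> Mod N = ?Q\<lparr>carrier := H\<rparr>"
      proof -
        have "set_mult (G\<lparr>carrier := N'\<rparr>) = set_mult G"
          by (intro ext) (simp add: set_mult_def)
        then show ?thesis by (auto simp: FactGroup_def RCOSETS_def r_coset_def Him)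
      qed
      have finH: "finite H" using finQ subgroup.subset[OF H] finite_subset by blast
      interpret H: fin_group "?Q\<lparr>carrier := H\<rparr>"
        using Q.subgroup_imp_group[OF H] finH by (simp add: fin_group_def fin_group_axioms_def)
      have "cyclic_group (?Q\<lparr>carrier := H\<rparr>)"
        by (rule H.prime_order_imp_cyclic_group) (simp add: 1(2))
      then have "cyclic_series G N'" using cyclic_series_extend[OF Ncs N'G NN'] eq by simp
      then have "N' = N" using max N'G NN' by blast
      \<comment> \<open>\<open>H\<close> is the image of \<open>N'\<close>; if \<open>N'\<close> is
        no larger than \<open>N\<close>, that image is trivial.\<close>
      then have "H \<subseteq> {N}" using Him N.rcos_const[OF is_group] by auto
      then have "card H \<le> 1" using card_mono[of "{N}" H] by simp
      then show False using prime_gt_1_nat[OF 1(2)] by simp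
    qed
  qed
  then show "supersoluble G" using Ncs by (simp add: supersoluble_iff_cyclic_series)
qed

section \<open>Sharpness\<close>

lemma div_add_div_le: "a div q + b div q \<le> (a + b) div (q::nat)"
proof (cases "q = 0")
  case False
  have "(a div q + b div q) * q \<le> a + b"
    unfolding add_mult_distrib by (intro add_mono div_times_less_eq_dividend)
  then show ?thesis using False by (simp add: less_eq_div_iff_mult_less_eq)
qed simp

text \<open>Bounds for single double cosets become a bound depending only on the total number of
  cosets: floors are superadditive, and powers of c \<le> 1 decrease. It is applied with (c, q) =
  (1/2, 2), (2/9, 3) and (1/2, 1).\<close>

lemma prod_perm_prob_ge:
  assumes "finite A" and c: "0 \<le> c" "c \<le> 1"
    and "\<And>D. D \<in> A \<Longrightarrow> perm_prob (m D) \<ge> c ^ (m D div q)"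
  shows "(\<Prod>D\<in>A. perm_prob (m D)) \<ge> c ^ ((\<Sum>D\<in>A. m D) div q)"
  using assms(1,4)
proof (induction A rule: finite_induct)
  case (insert x A)
  have "(m x + (\<Sum>D\<in>A. m D)) div q \<ge> m x div q + (\<Sum>D\<in>A. m D) div q"
    by (rule div_add_div_le)
  then have "c ^ ((m x + (\<Sum>D\<in>A. m D)) div q) \<le> c ^ (m x div q) * c ^ ((\<Sum>D\<in>A. m D) div q)"
    using power_decreasing[OF _ c] by (simp add: power_add[symmetric])
  also have "\<dots> \<le> perm_prob (m x) * (\<Prod>D\<in>A. perm_prob (m D))"
    using insert c by (intro mult_mono) (auto simp: perm_prob_nonneg)
  finally show ?case using insert by simp
qed simp

text \<open>The limit 5 is exact: at m = 6 the value 5/324 is below 1/64.\<close>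

lemma perm_prob_ge_half_power:
  assumes "m \<le> 5" shows "perm_prob m \<ge> (1/2) ^ m"
proof -
  have "m \<in> {0,1,2,3,4,5}" using assms by auto
  then show ?thesis by (auto simp: perm_prob_def fact_numeral power_divide)
qed

context finite_group_subgroup
begin

lemma H_double_coset: "H \<in> double_cosets G H" "coset_count H = 1"
proof -
  have "double_coset G H \<one> = H"
  proof (intro equalityI subsetI)
    fix y assume "y \<in> double_coset G H \<one>"
    then show "y \<in> H" by (auto simp: double_coset_def)
  next
    fix y assume y: "y \<in> H"
    then have "y = y \<otimes> \<one> \<otimes> \<one>" by simp
    then show "y \<in> double_coset G H \<one>" unfolding double_coset_def using y one_in_H by blast
  qed
  then show "H \<in> double_cosets G H" unfolding double_cosets_def by (intro image_eqI[of _ _ \<one>]) auto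
  show "coset_count H = 1" using cardH_pos by (simp add: coset_count_def)
qed

text \<open>The double coset \<open>H\<close> itself contributes 1, so only index minus one cosets
  count. For |H| = 2 these are 17, giving at most 8 factors 1/2; for |H| = 3 they are 11, giving at
  most 3 factors 2/9; for |H| \<ge> 4 there are at most 8, each costing at most a factor
  1/2.\<close>

lemma transversal_prob_order_36:
  assumes "card (carrier G) = 36"
  shows "transversal_prob G H \<ge> (1/2)^8"
proof -
  let ?A = "double_cosets G H - {H}"
  have fin: "finite ?A" using finite_double_cosets by simp
  have P: "transversal_prob G H = (\<Prod>D\<in>?A. perm_prob (coset_count D))"
    unfolding transversal_prob_eq
    using prod.remove[OF finite_double_cosets H_double_coset(1), of "\<lambda>D. perm_prob (coset_count D)"]
    by (simp add: H_double_coset(2) perm_prob_def)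
  have idx: "card (rcosets H) * card H = 36" using lagrange[OF subgroupH] assms by (simp add: order_def)
  have S: "(\<Sum>D\<in>?A. coset_count D) = card (rcosets H) - 1"
    using sum.remove[OF finite_double_cosets H_double_coset(1), of coset_count] sum_coset_count
    by (simp add: H_double_coset(2))
  have dvdH: "coset_count D dvd card H" "coset_count D \<ge> 1" if "D \<in> ?A" for D
    using coset_count(2,3)[of D] that by auto
  have leS: "coset_count D \<le> card (rcosets H) - 1" if "D \<in> ?A" for D
    using member_le_sum[of D ?A coset_count] that fin S by simp
  consider "card H = 1" | "card H = 2" | "card H = 3" | "card H \<ge> 4" using cardH_pos by linarith
  then show ?thesis
  proof cases
    case 1
    then have "coset_count D = 1" if "D \<in> ?A" for D using dvdH[OF that] by simp
    then have "transversal_prob G H = (\<Prod>D\<in>?A. perm_prob 1)" unfolding P by (intro prod.cong) auto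
    then show ?thesis by (simp add: perm_prob_def power_divide)
  next
    case 2
    have "perm_prob (coset_count D) \<ge> (1/2) ^ (coset_count D div 2)" if "D \<in> ?A" for D
    proof -
      have "coset_count D \<in> {1, 2}" using dvdH[OF that] dvd_imp_le[of "coset_count D" 2] 2 by auto
      then show ?thesis by (auto simp: perm_prob_def)
    qed
    then have "transversal_prob G H \<ge> (1/2) ^ ((\<Sum>D\<in>?A. coset_count D) div 2)"
      unfolding P using fin by (intro prod_perm_prob_ge) auto
    moreover have "card (rcosets H) = 18" using idx 2 by simp
    ultimately show ?thesis using S by simp
  next
    case 3
    have "perm_prob (coset_count D) \<ge> (2/9) ^ (coset_count D div 3)" if "D \<in> ?A" for D
    proof -
      have "coset_count D \<in> {1, 3}" using dvdH[OF that] 3 prime_nat_iff[of 3] by auto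
      then show ?thesis by (auto simp: perm_prob_def fact_numeral)
    qed
    then have "transversal_prob G H \<ge> (2/9) ^ ((\<Sum>D\<in>?A. coset_count D) div 3)"
      unfolding P using fin by (intro prod_perm_prob_ge) auto
    moreover have "card (rcosets H) = 12" using idx 3 by simp
    ultimately have "transversal_prob G H \<ge> (2/9) ^ 3" using S by simp
    then show ?thesis by (simp add: power_divide)
  next
    case 4
    have le9: "card (rcosets H) \<le> 9"
    proof (rule ccontr)
      assume "\<not> card (rcosets H) \<le> 9"
      then have "10 * 4 \<le> card (rcosets H) * card H" using 4 by (intro mult_le_mono) auto
      then show False using idx by simp
    qed
    have "perm_prob (coset_count D) \<ge> (1/2) ^ (coset_count D div 1)" if D: "D \<in> ?A" for D
    proof -
      \<comment> \<open>If |H| \<ge> 6, the index is at most 6 and the cosets outside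
        \<open>H\<close> number at most 5; otherwise \<open>coset_count D\<close> divides |H| \<le>
        5.\<close>
      have "coset_count D \<le> 5"
      proof (cases "card H \<ge> 6")
        case True
        then have "card (rcosets H) \<le> 6"
          using idx mult_le_mono[of 7 "card (rcosets H)" 6 "card H"] by (cases "card (rcosets H) \<le> 6") auto
        then show ?thesis using leS[OF D] by simp
      next
        case False
        then show ?thesis using dvd_imp_le[OF dvdH(1)[OF D] cardH_pos] by simp
      qed
      then show ?thesis using perm_prob_ge_half_power by simp
    qed
    then have "transversal_prob G H \<ge> (1/2) ^ ((\<Sum>D\<in>?A. coset_count D) div 1)"
      unfolding P using fin by (intro prod_perm_prob_ge) auto
    moreover have "(1/2::real) ^ ((\<Sum>D\<in>?A. coset_count D) div 1) \<ge> (1/2) ^ 8"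
      by (rule power_decreasing) (use S le9 in auto)
    ultimately show ?thesis by linarith
  qed
qed

end

lemma tp_order_36:
  assumes "group G" "card (carrier G) = 36"
  shows "tp G \<ge> (1/2)^8"
proof -
  interpret group G by fact
  have fin: "finite (carrier G)" using assms(2) by (metis card.infinite zero_neq_numeral)
  obtain H where H: "subgroup H G" "tp G = transversal_prob G H" using tp_attained[OF fin] by blast
  interpret finite_group_subgroup G H
    using H fin assms(1) by (simp add: finite_group_subgroup_def finite_group_subgroup_axioms_def)
  show ?thesis using transversal_prob_order_36[OF assms(2)] H(2) by simp
qed

text \<open>The affine maps \<open>z \<mapsto> u z + v\<close> of the field with nine elements with \<open>u\<close> a power of \<open>i\<close>,
  where \<open>u = c + d i\<close> and \<open>v = a + b i\<close> are stored as \<open>(a, b, c, d)\<close>.\<close>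

definition affine_mult :: "3 \<times> 3 \<times> 3 \<times> 3 \<Rightarrow> 3 \<times> 3 \<times> 3 \<times> 3 \<Rightarrow> 3 \<times> 3 \<times> 3 \<times> 3"
  where "affine_mult = (\<lambda>(a, b, c, d) (a', b', c', d').
    (a + c * a' - d * b', b + d * a' + c * b', c * c' - d * d', c * d' + d * c'))"

definition fourth_roots :: "(3 \<times> 3) set"
  where "fourth_roots = {(1, 0), (0, 1), (-1, 0), (0, -1)}"

definition affine_group :: "(3 \<times> 3 \<times> 3 \<times> 3) monoid"
  where "affine_group = \<lparr>carrier = UNIV \<times> UNIV \<times> fourth_roots, monoid.mult = affine_mult, one = (0, 0, 1, 0)\<rparr>"

lemma affine_group_simps [simp]:
  "(a, b, c, d) \<in> carrier affine_group \<longleftrightarrow> (c, d) \<in> fourth_roots"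
  "(a, b, c, d) \<otimes>\<^bsub>affine_group\<^esub> (a', b', c', d') =
    (a + c * a' - d * b', b + d * a' + c * b', c * c' - d * d', c * d' + d * c')"
  "\<one>\<^bsub>affine_group\<^esub> = (0, 0, 1, 0)"
  by (auto simp: affine_group_def affine_mult_def)

lemma group_affine_group: "group affine_group"
proof (rule groupI)
  fix x y assume "x \<in> carrier affine_group" "y \<in> carrier affine_group"
  then show "x \<otimes>\<^bsub>affine_group\<^esub> y \<in> carrier affine_group"
    by (cases x; cases y) (auto simp: fourth_roots_def)
next
  fix x y z :: "3 \<times> 3 \<times> 3 \<times> 3"
  show "x \<otimes>\<^bsub>affine_group\<^esub> y \<otimes>\<^bsub>affine_group\<^esub> z = x \<otimes>\<^bsub>affine_group\<^esub> (y \<otimes>\<^bsub>affine_group\<^esub> z)"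
    by (cases x; cases y; cases z) (simp add: algebra_simps)
next
  fix x assume "x \<in> carrier affine_group"
  then obtain a b c d where x: "x = (a, b, c, d)" "(c, d) \<in> fourth_roots" by (cases x) auto
  \<comment> \<open>The inverse of z -> u z + v has coefficients u^-1 and -u^-1 v, and u^-1 = c - d
    i since c^2 + d^2 = 1 for fourth roots of unity.\<close>
  then have "(- (c * a + d * b), d * a - c * b, c, - d) \<otimes>\<^bsub>affine_group\<^esub> x = \<one>\<^bsub>affine_group\<^esub>"
    "(- (c * a + d * b), d * a - c * b, c, - d) \<in> carrier affine_group"
    by (auto simp: fourth_roots_def)
  then show "\<exists>y\<in>carrier affine_group. y \<otimes>\<^bsub>affine_group\<^esub> x = \<one>\<^bsub>affine_group\<^esub>" by blast
next
  fix x assume "x \<in> carrier affine_group"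
  then show "\<one>\<^bsub>affine_group\<^esub> \<otimes>\<^bsub>affine_group\<^esub> x = x" by (cases x) simp
qed (simp add: fourth_roots_def)

lemma card_affine_group: "card (carrier affine_group) = 36"
proof -
  have "card fourth_roots = 4" by (simp add: fourth_roots_def)
  then show ?thesis by (simp add: affine_group_def card_cartesian_product)
qed

lemma three_cases: "x = 0 \<or> x = 1 \<or> x = (2::3)"
proof -
  obtain z where "x = of_int z" "0 \<le> z" "z < int CARD(3)" by (rule bit1_cases)
  then have "z = 0 \<or> z = 1 \<or> z = 2" by auto
  then show ?thesis using \<open>x = of_int z\<close> by auto
qed

text \<open>The negative results are proved for any group with affine coordinates \<delta>, so that
  they apply to the copy on the natural numbers.\<close>

locale affine_copy = group K for K :: "('k, 'l) monoid_scheme" (structure) +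
  fixes \<delta> :: "'k \<Rightarrow> 3 \<times> 3 \<times> 3 \<times> 3"
  assumes hom: "\<delta> \<in> hom K affine_group" and bij: "bij_betw \<delta> (carrier K) (carrier affine_group)"
begin

sublocale \<delta>: group_hom K affine_group \<delta>
  using hom group_affine_group by (simp add: group_hom_def group_hom_axioms_def is_group)

lemma \<delta>_eq: "x \<in> carrier K \<Longrightarrow> y \<in> carrier K \<Longrightarrow> \<delta> x = \<delta> y \<Longrightarrow> x = y"
  using bij by (meson bij_betw_imp_inj_on inj_onD)

lemma \<delta>_surj:
  assumes "(c, d) \<in> fourth_roots"
  obtains x where "x \<in> carrier K" "\<delta> x = (a, b, c, d)"
proof -
  have "(a, b, c, d) \<in> \<delta> ` carrier K" using bij assms by (simp add: bij_betw_imp_surj_on)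
  then show ?thesis using that by (metis imageE)
qed

text \<open>The coefficient u, which is multiplicative; the elements with value (1, 0) are the
  translations.\<close>

definition linear_part :: "'k \<Rightarrow> 3 \<times> 3"
  where "linear_part x = snd (snd (\<delta> x))"

lemma linear_part_in: "x \<in> carrier K \<Longrightarrow> linear_part x \<in> fourth_roots"
  using \<delta>.hom_closed[of x] by (cases "\<delta> x") (auto simp: linear_part_def)

lemma linear_part_mult:
  assumes "x \<in> carrier K" "y \<in> carrier K" "linear_part x = (c, d)" "linear_part y = (c', d')"
  shows "linear_part (x \<otimes> y) = (c * c' - d * d', c * d' + d * c')"
  using assms by (cases "\<delta> x"; cases "\<delta> y") (simp add: linear_part_def)

lemma translation_cube:
  assumes "x \<in> carrier K" "linear_part x = (1, 0)"
  shows "x \<otimes> x \<otimes> x = \<one>"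
proof -
  obtain a b where x: "\<delta> x = (a, b, 1, 0)" using assms(2) by (cases "\<delta> x") (auto simp: linear_part_def)
  have 3: "3 * y = 0" for y :: 3 using three_cases[of y] by auto
  have "\<delta> (x \<otimes> x \<otimes> x) = \<delta> \<one>" using assms(1) x by (simp add: 3)
  then show ?thesis using \<delta>_eq assms(1) by simp
qed

text \<open>The Sylow 2-subgroup of the affine group is cyclic, that of the alternating group is not.\<close>

lemma no_epimorphism_to_group_with_four_group:
  assumes U: "subgroup U K" and L: "group L" and f: "f \<in> hom (K\<lparr>carrier := U\<rparr>) L" "f ` U = carrier L"
    and V: "V \<subseteq> carrier L" "card V = 3" "\<one>\<^bsub>L\<^esub> \<notin> V"
    and sq: "\<And>p. p \<in> V \<Longrightarrow> p \<otimes>\<^bsub>L\<^esub> p = \<one>\<^bsub>L\<^esub>"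
    and closed: "\<And>p q. p \<in> V \<Longrightarrow> q \<in> V \<Longrightarrow> p \<noteq> q \<Longrightarrow> p \<otimes>\<^bsub>L\<^esub> q \<in> V"
  shows False
proof -
  interpret L: group L by fact
  have Uc: "x \<in> carrier K" if "x \<in> U" for x by (rule subgroup.mem_carrier[OF U that])
  have Um: "x \<otimes> y \<in> U" if "x \<in> U" "y \<in> U" for x y by (rule subgroup.m_closed[OF U that])
  have fm: "f (x \<otimes> y) = f x \<otimes>\<^bsub>L\<^esub> f y" if "x \<in> U" "y \<in> U" for x y
    using f(1) that by (simp add: hom_def)
  have fc: "f x \<in> carrier L" if "x \<in> U" for x using f(2) that by blast
  interpret UK: group "K\<lparr>carrier := U\<rparr>" using subgroup_imp_group[OF U] .
  have f1: "f \<one> = \<one>\<^bsub>L\<^esub>" using hom_one[OF f(1) UK.is_group L] by simp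
  \<comment> \<open>A translation has trivial cube while its image in \<open>V\<close> has trivial
    square, so the image would be the identity.\<close>
  have A: "linear_part x \<noteq> (1, 0)" if x: "x \<in> U" "f x \<in> V" for x
  proof
    assume "linear_part x = (1, 0)"
    then have "x \<otimes> x \<otimes> x = \<one>" using translation_cube Uc x by blast
    then have "f x \<otimes>\<^bsub>L\<^esub> f x \<otimes>\<^bsub>L\<^esub> f x = \<one>\<^bsub>L\<^esub>" using fm Um x f1 by metis
    then have "f x = \<one>\<^bsub>L\<^esub>" using sq[OF x(2)] fc[OF x(1)] by simp
    then show False using V(3) x(2) by simp
  qed
  have B: "f x = f y" if x: "x \<in> U" "f x \<in> V" and y: "y \<in> U" "f y \<in> V" and eq: "linear_part x = linear_part y" for x y
  proof (rule ccontr)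
    assume ne: "f x \<noteq> f y"
    \<comment> \<open>As u^4 = 1, the factor y^3 inverts y up to translations, so \<open>?z\<close>
      is a translation. Its image is nevertheless f x f y, because f y is an involution, and lies in
      \<open>V\<close>.\<close>
    let ?z = "x \<otimes> (y \<otimes> (y \<otimes> y))"
    have z: "?z \<in> U" using Um x y by blast
    have "f ?z = f x \<otimes>\<^bsub>L\<^esub> f y" using fm Um x y sq[OF y(2)] fc[OF y(1)] by simp
    then have "f ?z \<in> V" using closed[OF x(2) y(2) ne] by simp
    moreover have "linear_part ?z = (1, 0)"
    proof -
      obtain c d where cd: "linear_part y = (c, d)" "(c, d) \<in> fourth_roots"
        using linear_part_in[OF Uc[OF y(1)]] by (cases "linear_part y") auto
      have yc: "y \<in> carrier K" "x \<in> carrier K" using Uc x y by auto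
      show ?thesis
        using linear_part_mult[OF yc(2) _ _ linear_part_mult[OF yc(1) _ cd(1) linear_part_mult[OF yc(1) yc(1) cd(1) cd(1)]]]
          eq cd yc by (auto simp: fourth_roots_def)
    qed
    ultimately show False using A[OF z] by blast
  qed
  have "V \<subseteq> f ` U" using V(1) f(2) by simp
  then have "\<forall>p\<in>V. \<exists>x. x \<in> U \<and> f x = p" by blast
  from bchoice[OF this] obtain s where s: "\<And>p. p \<in> V \<Longrightarrow> s p \<in> U \<and> f (s p) = p" by blast
  let ?l = "\<lambda>p. linear_part (s p)"
  have "inj_on ?l V" by (rule inj_onI) (use B s in metis)
  then have "card (?l ` V) = 3" using V(2) card_image by metis
  \<comment> \<open>By \<open>B\<close> the three elements of \<open>V\<close> have distinct linear
    parts, and by \<open>A\<close> none is 1, so i, -1 and -i all occur.\<close>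
  moreover have "?l ` V \<subseteq> {(0, 1), (-1, 0), (0, -1)}"
  proof
    fix w assume "w \<in> ?l ` V"
    then obtain p where p: "p \<in> V" "w = linear_part (s p)" by auto
    then have "w \<in> fourth_roots" "w \<noteq> (1, 0)" using A[of "s p"] s[OF p(1)] linear_part_in Uc by auto
    then show "w \<in> {(0, 1), (-1, 0), (0, -1)}" by (auto simp: fourth_roots_def)
  qed
  moreover have "card {(0, 1), (-1, 0), (0, -1 :: 3) :: 3 \<times> 3} = 3" by simp
  ultimately have im: "?l ` V = {(0, 1), (-1, 0), (0, -1)}" by (intro card_subset_eq) auto
  obtain p q where pq: "p \<in> V" "linear_part (s p) = (0, 1)" "q \<in> V" "linear_part (s q) = (-1, 0)"
  proof -
    have "(0, 1) \<in> ?l ` V" "(-1, 0) \<in> ?l ` V" using im by auto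
    then show ?thesis using that by (metis (no_types, lifting) imageE)
  qed
  let ?x = "s p" and ?y = "s q"
  have xy: "?x \<in> U" "f ?x = p" "?y \<in> U" "f ?y = q" using s pq by auto
  \<comment> \<open>Since i^2 = -1, the product of \<open>?x\<close> squared with \<open>?y\<close>
    is a translation, yet it still maps to q in \<open>V\<close>.\<close>
  have "f ((?x \<otimes> ?x) \<otimes> ?y) = q" using fm Um xy sq[OF pq(1)] V(1) pq(3) by auto
  moreover have "linear_part ((?x \<otimes> ?x) \<otimes> ?y) = (1, 0)"
    using linear_part_mult[OF _ _ linear_part_mult[OF _ _ pq(2) pq(2)] pq(4)] Uc xy by simp
  ultimately show False using A[of "(?x \<otimes> ?x) \<otimes> ?y"] Um xy pq(3) by auto
qed

text \<open>A translation generates a subgroup that is not invariant under rotation by \<open>i\<close>, and a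
  non-translation does not commute with all its conjugates.\<close>

lemma normal_cyclic_trivial:
  assumes N: "N \<lhd> K" and x: "x \<in> N" "\<And>z. z \<in> N \<Longrightarrow> \<exists>n::int. z = x [^] n"
  shows "x = \<one>"
proof -
  have Ns: "subgroup N K" using N normal_imp_subgroup by blast
  have xc: "x \<in> carrier K" by (rule subgroup.mem_carrier[OF Ns x(1)])
  obtain a b c d where dx: "\<delta> x = (a, b, c, d)" by (cases "\<delta> x") auto
  have cd: "(c, d) \<in> fourth_roots" using \<delta>.hom_closed[OF xc] dx by simp
  \<comment> \<open>Normality is put in the form g x = n g to keep inverses out of the coordinate
    equations.\<close>
  have swap: "\<exists>n\<in>N. g \<otimes> x = n \<otimes> g" if g: "g \<in> carrier K" for g
  proof
    show "g \<otimes> x \<otimes> inv g \<in> N" using normal.inv_op_closed2[OF N g x(1)] .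
    show "g \<otimes> x = g \<otimes> x \<otimes> inv g \<otimes> g" using g xc by (simp add: m_assoc)
  qed
  show ?thesis
  proof (cases "(c, d) = (1, 0)")
    case True
    \<comment> \<open>The translations by multiples of the vector of x; this subgroup contains every
      power of x and hence \<open>N\<close>.\<close>
    let ?S = "{z \<in> carrier K. \<exists>k. \<delta> z = (k * a, k * b, 1, 0)}"
    have S: "subgroup ?S K"
    proof (rule subgroupI)
      have "\<one> \<in> ?S" by (auto intro!: exI[of _ 0])
      then show "?S \<noteq> {}" by blast
    next
      fix y z assume yz: "y \<in> ?S" "z \<in> ?S"
      then obtain k l where "\<delta> y = (k * a, k * b, 1, 0)" "\<delta> z = (l * a, l * b, 1, 0)" by auto
      then show "y \<otimes> z \<in> ?S" using yz by (auto intro!: exI[of _ "k + l"] simp: algebra_simps)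
    next
      fix z assume z: "z \<in> ?S"
      then obtain k where k: "z \<in> carrier K" "\<delta> z = (k * a, k * b, 1, 0)" by auto
      have "z \<otimes> z \<otimes> z = \<one>" by (rule translation_cube[OF k(1)]) (simp add: linear_part_def k)
      then have "inv z = z \<otimes> z" using k(1) by (simp add: inv_equality)
      then show "inv z \<in> ?S" using k by (auto intro!: exI[of _ "k + k"] simp: algebra_simps)
    qed auto
    have xS: "x \<in> ?S" using xc dx True by (auto intro!: exI[of _ 1])
    have NS: "N \<subseteq> ?S"
    proof
      fix z assume "z \<in> N"
      then obtain n :: int where "z = x [^] n" using x(2) by blast
      then show "z \<in> ?S" using subgroup_int_pow_closed[OF S xS] by simp
    qed
    have "(0, 1) \<in> fourth_roots" by (simp add: fourth_roots_def)
    then obtain t where t: "t \<in> carrier K" "\<delta> t = (0, 0, 0, 1)" using \<delta>_surj by blast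
    obtain n where n: "n \<in> N" "t \<otimes> x = n \<otimes> t" using swap[OF t(1)] by blast
    obtain k where k: "n \<in> carrier K" "\<delta> n = (k * a, k * b, 1, 0)" using NS n(1) by blast
    have "\<delta> (t \<otimes> x) = \<delta> (n \<otimes> t)" using n(2) by simp
    \<comment> \<open>Rotation by i turns (a, b) into (-b, a), which would be the multiple by k.
      Then a = -k^2 a, and as -1 is not a square modulo 3, the vector vanishes.\<close>
    then have "- b = k * a" "a = k * b" using t xc k dx True by simp_all
    then have "a = 0 \<and> b = 0" using three_cases[of a] three_cases[of b] three_cases[of k] by auto
    then have "\<delta> x = \<delta> \<one>" using dx True by simp
    then show ?thesis using \<delta>_eq xc by simp
  next
    case False
    have "(1, 0) \<in> fourth_roots" by (simp add: fourth_roots_def)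
    then obtain t where t: "t \<in> carrier K" "\<delta> t = (1, 0, 1, 0)" using \<delta>_surj by blast
    obtain n where n: "n \<in> N" "t \<otimes> x = n \<otimes> t" using swap[OF t(1)] by blast
    have nc: "n \<in> carrier K" by (rule subgroup.mem_carrier[OF Ns n(1)])
    obtain a' b' c' d' where dn: "\<delta> n = (a', b', c', d')" by (cases "\<delta> n") auto
    obtain k :: int where k: "n = x [^] k" using x(2)[OF n(1)] by blast
    have "n \<otimes> x = x \<otimes> n"
      unfolding k using int_pow_mult[OF xc, of k 1] int_pow_mult[OF xc, of 1 k] xc by (simp add: add.commute)
    then have comm: "\<delta> (n \<otimes> x) = \<delta> (x \<otimes> n)" by simp
    have "\<delta> (t \<otimes> x) = \<delta> (n \<otimes> t)" using n(2) by simp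
    then have e: "c' = c" "d' = d" "1 + a = a' + c'" "b = b' + d'" using t xc nc dx dn by simp_all
    then have a': "a' = 1 + a - c" "b' = b - d" by simp_all
    have "a' + c' * a - d' * b = a + c * a' - d * b'" "b' + d' * a + c' * b = b + d * a' + c * b'"
      using comm xc nc dx dn by simp_all
    \<comment> \<open>Conjugating x by the translation by 1 keeps u and adds w = 1 - u to v. The
      conjugate is a power of x and commutes with it, which gives w = u w, that is (1 - u)^2 = 0,
      although u is not 1.\<close>
    then have "1 - c = c * (1 - c) + d * d" "- d = d * (1 - c) - c * d"
      unfolding e(1,2) a' by (simp_all add: algebra_simps)
    then show ?thesis using cd False by (auto simp: fourth_roots_def)
  qed
qed

text \<open>The first nontrivial term of a cyclic series follows a trivial term, so it is itself a
  nontrivial cyclic normal subgroup, against \<open>normal_cyclic_trivial\<close>. The cosets of the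
  trivial subgroup are singletons, through which a generator is read off.\<close>

lemma not_supersoluble: "\<not> supersoluble K"
proof
  assume "supersoluble K"
  then obtain k N where N0: "N (0::nat) = {\<one>}" and Nk: "N k = carrier K" and norm: "\<And>i. i \<le> k \<Longrightarrow> N i \<lhd> K"
    and cyc: "\<And>i. i < k \<Longrightarrow> cyclic_group (K\<lparr>carrier := N (Suc i)\<rparr> Mod N i)"
    unfolding supersoluble_def by blast
  have "card (carrier K) = 36" using bij_betw_same_card[OF bij] card_affine_group by simp
  then have "N k \<noteq> {\<one>}" using Nk by auto
  define j where "j = (LEAST j. N j \<noteq> {\<one>})"
  have j: "N j \<noteq> {\<one>}" unfolding j_def by (rule LeastI[of _ k]) fact
  have "j \<le> k" unfolding j_def by (rule Least_le) fact
  obtain i where i: "j = Suc i" using j N0 by (cases j) auto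
  have Ni: "N i = {\<one>}" using not_less_Least[of i "\<lambda>j. N j \<noteq> {\<one>}"] i j_def by auto
  let ?M = "N (Suc i)"
  have M: "?M \<lhd> K" "?M \<noteq> {\<one>}" using norm[of "Suc i"] j i \<open>j \<le> k\<close> by auto
  have Ms: "subgroup ?M K" using M(1) normal_imp_subgroup by blast
  let ?L = "K\<lparr>carrier := ?M\<rparr>"
  interpret L: group ?L using subgroup_imp_group[OF Ms] .
  interpret T: normal "{\<one>}" ?L using L.one_is_normal by simp
  let ?Q = "?L Mod {\<one>}" and ?\<pi> = "\<lambda>z. {\<one>} #>\<^bsub>?L\<^esub> z"
  interpret Q: group ?Q by (rule T.factorgroup_is_group)
  interpret \<pi>: group_hom ?L ?Q ?\<pi> by unfold_locales (rule T.r_coset_hom_Mod)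
  have \<pi>: "?\<pi> z = {z}" if "z \<in> ?M" for z
    using subgroup.mem_carrier[OF Ms that] by (auto simp: r_coset_def)
  have "cyclic_group ?Q" using cyc[of i] Ni i \<open>j \<le> k\<close> by simp
  then obtain y where y: "y \<in> carrier ?Q" "carrier ?Q = range (\<lambda>n::int. y [^]\<^bsub>?Q\<^esub> n)"
    using Q.cyclic_group by blast
  then obtain x where x: "x \<in> ?M" "y = ?\<pi> x" by (auto simp: FactGroup_def RCOSETS_def)
  have gen: "\<exists>n::int. z = x [^] n" if z: "z \<in> ?M" for z
  proof -
    have "?\<pi> z \<in> carrier ?Q" using z by (intro \<pi>.hom_closed) simp
    then obtain n :: int where "?\<pi> z = y [^]\<^bsub>?Q\<^esub> n" using y(2) by blast
    also have "\<dots> = ?\<pi> (x [^]\<^bsub>?L\<^esub> n)" unfolding x(2) by (rule \<pi>.hom_int_pow[symmetric]) (simp add: x(1))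
    finally have "{z} = {x [^]\<^bsub>?L\<^esub> n}" using \<pi>[OF z] \<pi>[of "x [^]\<^bsub>?L\<^esub> n"] L.int_pow_closed[of x n] x(1) by simp
    then have "z = x [^] n" using int_pow_consistent[OF Ms x(1), of n] by simp
    then show ?thesis by blast
  qed
  have "x = \<one>" by (rule normal_cyclic_trivial[OF M(1) x(1) gen])
  then have "?M \<subseteq> {\<one>}" using gen by auto
  then show False using M(2) subgroup.one_closed[OF Ms] by auto
qed

end

lemma has_section_iso_imp_epimorphism:
  assumes "group G" "has_section_iso G K"
  shows "\<exists>U f. subgroup U G \<and> f \<in> hom (G\<lparr>carrier := U\<rparr>) K \<and> f ` U = carrier K"
proof -
  obtain U N \<psi> where U: "subgroup U G" and N: "N \<lhd> G\<lparr>carrier := U\<rparr>"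
    and \<psi>: "\<psi> \<in> iso (G\<lparr>carrier := U\<rparr> Mod N) K"
    using assms(2) unfolding has_section_iso_def is_iso_def by blast
  let ?U = "G\<lparr>carrier := U\<rparr>" and ?\<pi> = "\<lambda>x. N #>\<^bsub>G\<lparr>carrier := U\<rparr>\<^esub> x"
  interpret N: normal N ?U by (rule N)
  have "\<psi> \<circ> ?\<pi> \<in> hom ?U K"
    using hom_compose[OF N.r_coset_hom_Mod] \<psi> by (auto simp: iso_def)
  moreover have "(\<psi> \<circ> ?\<pi>) ` U = carrier K"
  proof -
    have "?\<pi> ` U = carrier (?U Mod N)" by (auto simp: FactGroup_def RCOSETS_def)
    then have "\<psi> ` ?\<pi> ` U = carrier K" using \<psi> by (simp add: iso_def bij_betw_def)
    then show ?thesis by (simp only: image_comp)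
  qed
  ultimately show ?thesis using U by blast
qed

text \<open>The three double transpositions, that is, the Klein four-group without the identity.
  This is all that the nonexistence argument uses about A4.\<close>

lemma alt_group_4_four_group:
  obtains V where "V \<subseteq> carrier (alt_group 4)" "card V = 3" "\<one>\<^bsub>alt_group 4\<^esub> \<notin> V"
    "\<And>p. p \<in> V \<Longrightarrow> p \<otimes>\<^bsub>alt_group 4\<^esub> p = \<one>\<^bsub>alt_group 4\<^esub>"
    "\<And>p q. p \<in> V \<Longrightarrow> q \<in> V \<Longrightarrow> p \<noteq> q \<Longrightarrow> p \<otimes>\<^bsub>alt_group 4\<^esub> q \<in> V"
proof -
  define a b c :: "nat \<Rightarrow> nat" where "a = transpose 1 2 \<circ> transpose 3 4"
    and "b = transpose 1 3 \<circ> transpose 2 4" and "c = transpose 1 4 \<circ> transpose 2 3"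
  note abc = a_def b_def c_def
  have even: "evenperm (transpose i j \<circ> transpose k l)" if "i \<noteq> j" "k \<noteq> l" for i j k l :: nat
    using that by (simp add: evenperm_comp permutation_swap_id evenperm_swap)
  have mem: "a \<in> carrier (alt_group 4)" "b \<in> carrier (alt_group 4)" "c \<in> carrier (alt_group 4)"
    unfolding alt_group_carrier abc
    by (auto intro!: permutes_compose permutes_swap_id even)
  have val: "a 1 = 2" "b 1 = 3" "c 1 = 4" by (simp_all add: abc transpose_def)
  then have ne: "a \<noteq> b" "a \<noteq> c" "b \<noteq> c" "id \<notin> {a, b, c}" by auto
  have sq: "a \<circ> a = id" "b \<circ> b = id" "c \<circ> c = id"
    and pr: "a \<circ> b = c" "b \<circ> a = c" "a \<circ> c = b" "c \<circ> a = b" "b \<circ> c = a" "c \<circ> b = a"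
    by (auto simp: abc fun_eq_iff transpose_def)
  show ?thesis
  proof (rule that[of "{a, b, c}"])
    show "{a, b, c} \<subseteq> carrier (alt_group 4)" using mem by simp
    show "card {a, b, c} = 3" using ne by simp
    show "\<one>\<^bsub>alt_group 4\<^esub> \<notin> {a, b, c}" using ne(4) by (simp add: alt_group_one)
    show "p \<otimes>\<^bsub>alt_group 4\<^esub> p = \<one>\<^bsub>alt_group 4\<^esub>" if "p \<in> {a, b, c}" for p
      using that sq by (auto simp: alt_group_mult alt_group_one)
    show "p \<otimes>\<^bsub>alt_group 4\<^esub> q \<in> {a, b, c}" if "p \<in> {a, b, c}" "q \<in> {a, b, c}" "p \<noteq> q" for p q
      using that pr by (auto simp: alt_group_mult)
  qed
qed

lemma (in affine_copy) no_alt_group_4_section: "\<not> has_section_iso K (alt_group 4)"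
proof
  assume "has_section_iso K (alt_group 4)"
  then obtain U f where "subgroup U K" "f \<in> hom (K\<lparr>carrier := U\<rparr>) (alt_group 4)" "f ` U = carrier (alt_group 4)"
    using has_section_iso_imp_epimorphism is_group by blast
  then show False
    using no_epimorphism_to_group_with_four_group[OF _ alt_group_is_group] alt_group_4_four_group by metis
qed

text \<open>Transport of structure along an injection \<open>e\<close> into the natural numbers; the
  coordinate map \<delta> is its inverse.\<close>

lemma affine_copy_nat: "\<exists>(K :: nat monoid) \<delta>. affine_copy K \<delta>"
proof -
  let ?C = "carrier affine_group"
  interpret A: group affine_group by (rule group_affine_group)
  have "finite ?C" using card_affine_group by (metis card.infinite zero_neq_numeral)
  then obtain e :: "3 \<times> 3 \<times> 3 \<times> 3 \<Rightarrow> nat" where e: "inj_on e ?C"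
    using finite_imp_inj_to_nat_seg by metis
  define \<delta> where "\<delta> = inv_into ?C e"
  have \<delta>: "\<delta> (e z) = z" if "z \<in> ?C" for z using e that by (simp add: \<delta>_def)
  define K where "K = \<lparr>carrier = e ` ?C, monoid.mult = (\<lambda>x y. e (\<delta> x \<otimes>\<^bsub>affine_group\<^esub> \<delta> y)),
    one = e \<one>\<^bsub>affine_group\<^esub>\<rparr>"
  have K: "carrier K = e ` ?C" "x \<otimes>\<^bsub>K\<^esub> y = e (\<delta> x \<otimes>\<^bsub>affine_group\<^esub> \<delta> y)"
    "\<one>\<^bsub>K\<^esub> = e \<one>\<^bsub>affine_group\<^esub>" for x y by (simp_all add: K_def)
  have \<delta>C: "\<delta> x \<in> ?C" "e (\<delta> x) = x" if "x \<in> carrier K" for x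
    using that \<delta> by (auto simp: K(1))
  have \<delta>K: "\<delta> (x \<otimes>\<^bsub>K\<^esub> y) = \<delta> x \<otimes>\<^bsub>affine_group\<^esub> \<delta> y" if "x \<in> carrier K" "y \<in> carrier K" for x y
    unfolding K(2) using \<delta>C that by (intro \<delta> A.m_closed)
  have \<delta>1: "\<delta> \<one>\<^bsub>K\<^esub> = \<one>\<^bsub>affine_group\<^esub>" unfolding K(3) by (rule \<delta>[OF A.one_closed])
  have closed: "x \<otimes>\<^bsub>K\<^esub> y \<in> carrier K" if "x \<in> carrier K" "y \<in> carrier K" for x y
    unfolding K(1,2) using \<delta>C that by (intro imageI A.m_closed)
  have inj: "inj_on \<delta> (carrier K)" by (rule inj_onI) (metis \<delta>C(2))
  have "group K"
  proof (rule groupI)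
    show "\<one>\<^bsub>K\<^esub> \<in> carrier K" unfolding K(1,3) by (rule imageI) (rule A.one_closed)
    then have oneK: "\<one>\<^bsub>K\<^esub> \<in> carrier K" .
    fix x assume x: "x \<in> carrier K"
    have "\<delta> (\<one>\<^bsub>K\<^esub> \<otimes>\<^bsub>K\<^esub> x) = \<delta> x" unfolding \<delta>K[OF oneK x] \<delta>1 by (rule A.l_one[OF \<delta>C(1)[OF x]])
    then show "\<one>\<^bsub>K\<^esub> \<otimes>\<^bsub>K\<^esub> x = x" using inj_onD[OF inj] closed[OF oneK x] x by blast
    let ?y = "e (inv\<^bsub>affine_group\<^esub> \<delta> x)"
    have yC: "inv\<^bsub>affine_group\<^esub> \<delta> x \<in> ?C" using \<delta>C(1)[OF x] by (rule A.inv_closed)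
    have y: "?y \<in> carrier K" unfolding K(1) using yC by (rule imageI)
    have "\<delta> (?y \<otimes>\<^bsub>K\<^esub> x) = \<delta> \<one>\<^bsub>K\<^esub>"
      unfolding \<delta>K[OF y x] \<delta>1 \<delta>[OF yC] by (rule A.l_inv[OF \<delta>C(1)[OF x]])
    then have "?y \<otimes>\<^bsub>K\<^esub> x = \<one>\<^bsub>K\<^esub>" using inj_onD[OF inj] closed[OF y x] oneK by blast
    then show "\<exists>y\<in>carrier K. y \<otimes>\<^bsub>K\<^esub> x = \<one>\<^bsub>K\<^esub>" using y by blast
  next
    fix x y z assume c: "x \<in> carrier K" "y \<in> carrier K" "z \<in> carrier K"
    have "\<delta> (x \<otimes>\<^bsub>K\<^esub> y \<otimes>\<^bsub>K\<^esub> z) = \<delta> (x \<otimes>\<^bsub>K\<^esub> (y \<otimes>\<^bsub>K\<^esub> z))"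
      unfolding \<delta>K[OF closed[OF c(1,2)] c(3)] \<delta>K[OF c(1,2)] \<delta>K[OF c(1) closed[OF c(2,3)]] \<delta>K[OF c(2,3)]
      by (rule A.m_assoc) (use \<delta>C(1) c in auto)
    then show "x \<otimes>\<^bsub>K\<^esub> y \<otimes>\<^bsub>K\<^esub> z = x \<otimes>\<^bsub>K\<^esub> (y \<otimes>\<^bsub>K\<^esub> z)"
      using inj_onD[OF inj] closed c by blast
  qed (rule closed)
  moreover have "\<delta> \<in> hom K affine_group" using \<delta>C(1) \<delta>K by (auto simp: hom_def)
  moreover have "\<delta> ` carrier K = ?C"
  proof
    show "\<delta> ` carrier K \<subseteq> ?C" using \<delta>C(1) by (rule image_subsetI)
    show "?C \<subseteq> \<delta> ` carrier K"
    proof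
      fix z assume z: "z \<in> ?C"
      then have "e z \<in> carrier K" unfolding K(1) by (rule imageI)
      then show "z \<in> \<delta> ` carrier K" using \<delta>[OF z] by (metis imageI)
    qed
  qed
  ultimately have "affine_copy K \<delta>"
    using inj by (simp add: affine_copy_def affine_copy_axioms_def bij_betw_def)
  then show ?thesis by blast
qed

theorem theorem4p4:
  fixes G :: "('a, 'b) monoid_scheme"
  shows "(group G \<and> finite (carrier G) \<and> tp G > (1/2)^8 \<longrightarrow>
            supersoluble G \<or> has_section_iso G (alt_group 4)) \<and>
         (\<forall>c::real. c < (1/2)^8 \<longrightarrow>
            \<not> (\<forall>K :: nat monoid. group K \<and> finite (carrier K) \<and> tp K > c \<longrightarrow>
                  supersoluble K \<or> has_section_iso K (alt_group 4)))"
proof (intro conjI impI allI notI)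
  assume "group G \<and> finite (carrier G) \<and> tp G > (1/2)^8"
  then show "supersoluble G \<or> has_section_iso G (alt_group 4)"
    using supersoluble_or_epimorphism[of G] has_section_iso_of_epimorphism[of G _ "alt_group 4"]
      alt_group_is_group by blast
next
  fix c :: real
  assume c: "c < (1/2)^8" and all: "\<forall>K :: nat monoid. group K \<and> finite (carrier K) \<and> tp K > c \<longrightarrow>
                  supersoluble K \<or> has_section_iso K (alt_group 4)"
  obtain K :: "nat monoid" and \<delta> where K: "affine_copy K \<delta>" using affine_copy_nat by blast
  interpret affine_copy K \<delta> by (rule K)
  have "card (carrier K) = 36" using bij_betw_same_card[OF bij] card_affine_group by simp
  moreover from this have "finite (carrier K)" by (metis card.infinite zero_neq_numeral)
  \<comment> \<open>The copy has order 36, so its \<open>tp\<close> is at least (1/2)^8 and exceeds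
    every admissible c.\<close>
  ultimately show False
    using all is_group tp_order_36[OF is_group] c not_supersoluble no_alt_group_4_section by fastforce
qed

end
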